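(* The Hamiltonians $E_k$ for the commuting flows $Y_k$ (i.e. functionals on $\mathcal{M}$ with $dE_k=\sigma(Y_k,-)$), $k\ge 0$, are given by the generating function $$\sum_{k\ge0}E_k\lambda^{-k}=0+E_1\lambda^{-1}+E_2\lambda^{-2}+\tfrac12\,\lambda^{-2}\int_I\ \sum_{i\ge1,\,j\ge0}(Y_i,Y_1)\,\lambda^{-i}(-1)^j\Big(\sum_{l\ge2}\tfrac12(T,Y_l)\lambda^{-l}\Big)^j\,dx ,$$ where $E_1$ is the length and $E_2$ the total torsion. For instance, $$E_4=-\tfrac12\int_I\det(\gamma',\gamma'',\gamma''')\,dx,\qquad E_5=\int_I\big(\tfrac12|\gamma'''|^2-\tfrac58|\gamma''|^4\big)\,dx,$$ $$E_6=\int_I\big(-\tfrac12\det(\gamma',\gamma''',\gamma'''')+\tfrac78|\gamma''|^2\det(\gamma',\gamma'',\gamma''')\big)\,dx .$$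
   Context: Let $M\cong\mathbb{R}$ be an oriented 1-manifold with a fixed translation $\tau\in\mathrm{Diff}(M)$, $M/\tau\cong S^1$, and $I\subset M$ a fundamental domain for $\tau$. Let $h(p)=Ap+a$ ($A\in SO(3)$, $a\in\mathbb{R}^3$), and let $\mathcal{M}=\mathcal{M}_h$ be the manifold of smooth immersions $\gamma\colon M\to\mathbb{R}^3$ with $\gamma\circ\tau=h\circ\gamma$; $T_\gamma\mathcal{M}$ consists of smooth $\xi\colon M\to\mathbb{R}^3$ with $\xi\circ\tau=A\xi$. For $\gamma\in\mathcal{M}$ let $dx$ be its arclength 1-form, $(\ )'$ the arclength derivative, $T=\gamma'$. The Marsden–Weinstein 2-form on $\mathcal{M}$ is $\sigma_\gamma(\xi,\eta)=\int_I\det(T,\xi,\eta)\,dx$. The vector fields $Y_k\in\Gamma(T\mathcal{M})$, $k\ge0$, are defined by $Y_0=T$ and $Y_{k+1}=T\times Y_k'-\tfrac12\sum_{i=1}^{k}(Y_i,Y_{k-i+1})T$; they satisfy $Y_k'+T\times Y_{k+1}=0$. $E_0=0$. The length functional is $E_1=\int_I dx$. The total torsion $E_2$, defined modulo $2\pi$, is $E_2=\int_I(\nu',T\times\nu)\,dx$ for any unit length normal vector field $\nu$ along $\gamma$ with $\nu\circ\tau=A\nu$ (independent of $\nu$ modulo $2\pi$). The generating function is an identity of formal power series in $\lambda^{-1}$. *)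

theory Defs
  imports "HOL-Analysis.Analysis"
begin

type_synonym curve = "real \<Rightarrow> real^3"

primrec times_differentiable ::
  "nat \<Rightarrow> ('a::real_normed_vector \<Rightarrow> 'b::real_normed_vector) \<Rightarrow> bool" where
  "times_differentiable 0 f \<longleftrightarrow> continuous_on UNIV f"
| "times_differentiable (Suc n) f \<longleftrightarrow>
     (\<forall>x. f differentiable (at x)) \<and>
     (\<forall>v. times_differentiable n (\<lambda>x. frechet_derivative f (at x) v))"

text \<open>Used for finite-dimensional domains only; there it is the usual notion of being
  of class C-infinity, since all iterated directional derivatives exist and are continuous.\<close>

definition smooth :: "('a::real_normed_vector \<Rightarrow> 'b::real_normed_vector) \<Rightarrow> bool" where
  "smooth f \<longleftrightarrow> (\<forall>n. times_differentiable n f)"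

text \<open>The oriented 1-manifold is the real line. A deck transformation is an arbitrary
  diffeomorphism without fixed points: such a map preserves the orientation, is conjugate to
  a translation, and may move points to the right or to the left. The fundamental domain is
  the segment between a base point \<open>t0\<close> and its image \<open>\<tau> t0\<close>.\<close>

definition deck_transformation :: "(real \<Rightarrow> real) \<Rightarrow> bool" where
  "deck_transformation \<tau> \<longleftrightarrow>
     smooth \<tau> \<and> bij \<tau> \<and> smooth (inv \<tau>) \<and> (\<forall>t. \<tau> t \<noteq> t)"

definition fundamental_domain :: "(real \<Rightarrow> real) \<Rightarrow> real \<Rightarrow> real set" where
  "fundamental_domain \<tau> t0 = closed_segment t0 (\<tau> t0)"

definition curve_space :: "real^3^3 \<Rightarrow> real^3 \<Rightarrow> (real \<Rightarrow> real) \<Rightarrow> curve set" where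
  "curve_space A a \<tau> =
     {\<gamma>. smooth \<gamma> \<and> (\<forall>t. vector_derivative \<gamma> (at t) \<noteq> 0) \<and> (\<forall>t. \<gamma> (\<tau> t) = A *v \<gamma> t + a)}"

definition tangent_space :: "real^3^3 \<Rightarrow> (real \<Rightarrow> real) \<Rightarrow> curve set" where
  "tangent_space A \<tau> = {\<xi>. smooth \<xi> \<and> (\<forall>t. \<xi> (\<tau> t) = A *v \<xi> t)}"

definition speed :: "curve \<Rightarrow> real \<Rightarrow> real" where
  "speed \<gamma> t = norm (vector_derivative \<gamma> (at t))"

definition arc_deriv :: "curve \<Rightarrow> (real \<Rightarrow> 'b::real_normed_vector) \<Rightarrow> real \<Rightarrow> 'b" where
  "arc_deriv \<gamma> f t = vector_derivative f (at t) /\<^sub>R speed \<gamma> t"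

abbreviation arc_diff :: "nat \<Rightarrow> curve \<Rightarrow> real \<Rightarrow> real^3" where
  "arc_diff n \<gamma> \<equiv> (arc_deriv \<gamma> ^^ n) \<gamma>"

definition arc_integral :: "real set \<Rightarrow> curve \<Rightarrow> (real \<Rightarrow> real) \<Rightarrow> real" where
  "arc_integral I \<gamma> f = integral I (\<lambda>t. f t * speed \<gamma> t)"

definition tangent :: "curve \<Rightarrow> real \<Rightarrow> real^3" where
  "tangent \<gamma> = arc_deriv \<gamma> \<gamma>"

definition det3 :: "real^3 \<Rightarrow> real^3 \<Rightarrow> real^3 \<Rightarrow> real" where
  "det3 u v w = det (vector [u, v, w] :: real^3^3)"

definition MW_form :: "real set \<Rightarrow> curve \<Rightarrow> curve \<Rightarrow> curve \<Rightarrow> real" where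
  "MW_form I \<gamma> \<xi> \<eta> = arc_integral I \<gamma> (\<lambda>t. det3 (tangent \<gamma> t) (\<xi> t) (\<eta> t))"

fun Y :: "nat \<Rightarrow> curve \<Rightarrow> real \<Rightarrow> real^3" where
  "Y 0 \<gamma> t = tangent \<gamma> t"
| "Y (Suc k) \<gamma> t =
     cross3 (tangent \<gamma> t) (arc_deriv \<gamma> (Y k \<gamma>) t)
     - ((1/2) * (\<Sum>i=1..k. Y i \<gamma> t \<bullet> Y (k - i + 1) \<gamma> t)) *\<^sub>R tangent \<gamma> t"

definition curve_length :: "real set \<Rightarrow> curve \<Rightarrow> real" where
  "curve_length I \<gamma> = arc_integral I \<gamma> (\<lambda>t. 1)"

definition unit_normal_field :: "real^3^3 \<Rightarrow> (real \<Rightarrow> real) \<Rightarrow> curve \<Rightarrow> curve \<Rightarrow> bool" where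
  "unit_normal_field A \<tau> \<gamma> \<nu> \<longleftrightarrow>
     smooth \<nu> \<and> (\<forall>t. norm (\<nu> t) = 1 \<and> \<nu> t \<bullet> tangent \<gamma> t = 0 \<and> \<nu> (\<tau> t) = A *v \<nu> t)"

definition torsion_integral :: "real set \<Rightarrow> curve \<Rightarrow> curve \<Rightarrow> real" where
  "torsion_integral I \<gamma> \<nu> =
     arc_integral I \<gamma> (\<lambda>t. arc_deriv \<gamma> \<nu> t \<bullet> cross3 (tangent \<gamma> t) (\<nu> t))"

text \<open>A real representative of a quantity that is meaningful only modulo \<open>2 * pi\<close>:
  the chosen normal field may jump as the curve varies, so statements about the total torsion
  must allow for integer multiples of \<open>2 * pi\<close>.\<close>

definition total_torsion :: "real^3^3 \<Rightarrow> (real \<Rightarrow> real) \<Rightarrow> real \<Rightarrow> curve \<Rightarrow> real" where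
  "total_torsion A \<tau> t0 \<gamma> =
     torsion_integral (fundamental_domain \<tau> t0) \<gamma> (SOME \<nu>. unit_normal_field A \<tau> \<gamma> \<nu>)"

text \<open>Formal power series in \<open>fps_X\<close>, which stands for the inverse of the spectral
  parameter. The sum over \<open>j\<close> converges in the topology of formal power series, because the
  series raised to the power \<open>j\<close> begins in degree 2; integration is coefficientwise.\<close>

definition hamiltonian_density :: "curve \<Rightarrow> real \<Rightarrow> real fps" where
  "hamiltonian_density \<gamma> t =
     (\<Sum>j. Abs_fps (\<lambda>i. if i \<ge> 1 then Y i \<gamma> t \<bullet> Y 1 \<gamma> t else 0) * (- 1) ^ j *
          Abs_fps (\<lambda>l. if l \<ge> 2 then 1/2 * (tangent \<gamma> t \<bullet> Y l \<gamma> t) else 0) ^ j)"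

definition arc_integral_fps :: "real set \<Rightarrow> curve \<Rightarrow> (real \<Rightarrow> real fps) \<Rightarrow> real fps" where
  "arc_integral_fps I \<gamma> F = Abs_fps (\<lambda>n. arc_integral I \<gamma> (\<lambda>t. fps_nth (F t) n))"

definition hamiltonian_series ::
  "real^3^3 \<Rightarrow> (real \<Rightarrow> real) \<Rightarrow> real \<Rightarrow> curve \<Rightarrow> real fps" where
  "hamiltonian_series A \<tau> t0 \<gamma> =
     0 + fps_const (curve_length (fundamental_domain \<tau> t0) \<gamma>) * fps_X
       + fps_const (total_torsion A \<tau> t0 \<gamma>) * fps_X ^ 2
       + fps_const (1/2) * fps_X ^ 2 *
         arc_integral_fps (fundamental_domain \<tau> t0) \<gamma> (hamiltonian_density \<gamma>)"

definition hamiltonian :: "real^3^3 \<Rightarrow> (real \<Rightarrow> real) \<Rightarrow> real \<Rightarrow> nat \<Rightarrow> curve \<Rightarrow> real" where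
  "hamiltonian A \<tau> t0 k \<gamma> = fps_nth (hamiltonian_series A \<tau> t0 \<gamma>) k"

text \<open>A germ at \<open>s = 0\<close> of a smooth path in the curve space through \<open>\<gamma>\<close> with velocity \<open>\<xi>\<close>.
  Every tangent vector \<open>\<xi>\<close> is the velocity of such a path: take \<open>\<Gamma> s t = \<gamma> t + s *\<^sub>R \<xi> t\<close>.\<close>

definition variation ::
  "curve set \<Rightarrow> curve \<Rightarrow> curve \<Rightarrow> (real \<Rightarrow> curve) \<Rightarrow> bool" where
  "variation M \<gamma> \<xi> \<Gamma> \<longleftrightarrow>
     smooth (\<lambda>(s, t). \<Gamma> s t) \<and> (\<forall>\<^sub>F s in nhds 0. \<Gamma> s \<in> M) \<and> \<Gamma> 0 = \<gamma> \<and>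
     (\<forall>t. ((\<lambda>s. \<Gamma> s t) has_vector_derivative \<xi> t) (at 0))"

text \<open>\<open>D\<close> is the differential at \<open>\<gamma>\<close> of the functional \<open>F\<close> with values in the reals modulo
  \<open>p\<close>: along every variation, \<open>F\<close> has a local lift \<open>e\<close> to the reals with the prescribed
  derivative. For \<open>p = 0\<close> the lift is \<open>F\<close> itself, and this is the ordinary differential.\<close>

definition has_differential_mod ::
  "real \<Rightarrow> curve set \<Rightarrow> curve set \<Rightarrow> (curve \<Rightarrow> real) \<Rightarrow> curve \<Rightarrow> (curve \<Rightarrow> real) \<Rightarrow> bool" where
  "has_differential_mod p M V F \<gamma> D \<longleftrightarrow>
     (\<forall>\<xi>\<in>V. \<forall>\<Gamma>. variation M \<gamma> \<xi> \<Gamma> \<longrightarrow>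
        (\<exists>e. (\<forall>\<^sub>F s in nhds 0. \<exists>n::int. e s = F (\<Gamma> s) + p * of_int n) \<and>
             (e has_real_derivative D \<xi>) (at 0)))"

end

theory Submission
  imports Defs
begin

text \<open>
  Let \<open>z = 1 / \<lambda>\<close> and let \<open>Y\<close> be the generating series of the fields \<open>Y k\<close> in powers of \<open>z\<close>. It has formal length
  one and satisfies \<open>Y' + \<lambda> T \<times> Y = 0\<close> (\<open>Y_formal_unit\<close>, \<open>Y_transport\<close>). Hence \<open>Y\<close> is a parallel unit
  vector for the connection \<open>\<nabla> = d/dx + \<lambda> T \<times>\<close>, and the holonomy of \<open>\<nabla>\<close> over one period is
  a rotation about \<open>Y\<close>. Its angle is the integral of \<open>(\<nabla>\<nu>, Y \<times> \<nu>)\<close> for any unit field \<open>\<nu>\<close> orthogonal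
  to \<open>Y\<close>. If the curve moves with velocity \<open>\<xi>\<close>, then \<open>\<nabla>\<close> changes by \<open>\<lambda> \<xi>' \<times>\<close>, so the angle changes by the
  integral of \<open>\<lambda> (\<xi>', Y)\<close>. Integrating by parts and using the equation for \<open>Y\<close>, this is
  \<open>\<lambda>\<^sup>2 \<sigma>(Y, \<xi>)\<close>. Consequently \<open>z\<^sup>2\<close> times the angle is a generating function of Hamiltonians for the
  fields \<open>Y k\<close>.

  It remains to compute the angle. Take a unit normal field \<open>N\<close> of the curve, put \<open>B = T \<times> N\<close>, write
  \<open>T' = a N + b B\<close>, and let \<open>y0, y1, y2\<close> be the components of \<open>Y\<close> in the frame \<open>(T, N, B)\<close>. Turning
  this frame by the smallest rotation that takes \<open>T\<close> to \<open>Y\<close> yields a field \<open>\<nu>\<close> with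
  \<open>(\<nabla>\<nu>, Y \<times> \<nu>) = \<lambda> + (N', B) + (a y2 - b y1) / (1 + y0)\<close>. The first two terms integrate to the
  length and the total torsion. The last one is \<open>(Y, Y 1) / (1 + (T, Y))\<close>, and expanding the denominator
  as a geometric series gives the stated double sum (\<open>density_frame\<close>).

  The turned frame itself is not constructed. Instead, \<open>rotating_frame_identity\<close> and \<open>curvature_term\<close> verify
  that the \<open>s\<close>-derivative of the density above is the pairing of \<open>Y\<close> with \<open>\<xi>'\<close> up to a derivative along the
  curve. The former is an identity in a commutative ring that holds for any varying parallel unit vector, the
  latter expresses that the frame \<open>(T, N, B)\<close> moves in a flat space. The derivatives along the curve
  integrate to zero because they are derivatives of functions invariant under \<open>\<tau>\<close>; the result is
  \<open>integral_variation\<close>.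

  Equivariant unit normal fields exist because, among the constant combinations of an equivariant moving
  frame, almost all are nowhere tangent to the curve (\<open>unit_normal_field_exists\<close>). Two such fields differ by a
  rotation in the normal planes whose angle changes by a multiple of \<open>2 \<pi>\<close> over one period
  (\<open>torsion_integral_mod\<close>). Along a variation, the normal field of the initial curve can be projected to the
  normal planes of the nearby curves, which provides a smooth local lift of the total torsion
  (\<open>variation_framed_family\<close>, \<open>hamiltonian_derivative\<close>). The explicit Hamiltonians come from the first
  coefficients of the density and from integration by parts.
\<close>

section \<open>Smooth functions and their directional derivatives\<close>

abbreviation ddir :: "'a::real_normed_vector \<Rightarrow> ('a \<Rightarrow> 'b::real_normed_vector) \<Rightarrow> 'a \<Rightarrow> 'b" where
  "ddir v f \<equiv> (\<lambda>x. frechet_derivative f (at x) v)"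

lemma ddir_eqI:
  assumes "(f has_derivative f') (at x)"
  shows "ddir v f x = f' v"
  using frechet_derivative_at[OF assms] by simp

lemma times_differentiable_imp_continuous:
  "times_differentiable n f \<Longrightarrow> continuous_on UNIV f"
  by (cases n) (auto simp: continuous_on_eq_continuous_at intro: differentiable_imp_continuous_within)

text \<open>The recursion for \<open>times_differentiable (Suc n)\<close> controls only derivatives, so that each order implies
  the lower ones needs an argument. The inductions below use it because the product and chain rules
  mix \<open>f\<close> with its derivatives.\<close>

lemma times_differentiable_Suc_D: "times_differentiable (Suc n) f \<Longrightarrow> times_differentiable n f"
proof (induction n arbitrary: f)
  case 0
  then show ?case using times_differentiable_imp_continuous by (metis times_differentiable.simps(1))
next
  case (Suc n)
  then show ?case by (metis times_differentiable.simps(2))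
qed

text \<open>The form in which smoothness is used: smooth functions are the largest class of differentiable
  functions closed under directional derivatives.\<close>

lemma smooth_iff_ddir:
  "smooth f \<longleftrightarrow> (\<forall>x. f differentiable (at x)) \<and> (\<forall>v. smooth (ddir v f))"
proof
  assume f: "smooth f"
  show "(\<forall>x. f differentiable (at x)) \<and> (\<forall>v. smooth (ddir v f))"
  proof (intro conjI allI)
    show "f differentiable at x" for x
      using f unfolding smooth_def by (metis times_differentiable.simps(2))
    show "smooth (ddir v f)" for v
      using f unfolding smooth_def by (metis times_differentiable.simps(2))
  qed
next
  assume f: "(\<forall>x. f differentiable (at x)) \<and> (\<forall>v. smooth (ddir v f))"
  then have "times_differentiable (Suc n) f" for n
    unfolding smooth_def by simp
  then show "smooth f"
    unfolding smooth_def using times_differentiable_Suc_D by blast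
qed

lemma smooth_differentiable: "smooth f \<Longrightarrow> f differentiable (at x)"
  using smooth_iff_ddir by blast

lemma smooth_has_derivative:
  "smooth f \<Longrightarrow> (f has_derivative (\<lambda>v. ddir v f x)) (at x)"
  using frechet_derivative_works smooth_differentiable by blast

lemma smooth_ddir: "smooth f \<Longrightarrow> smooth (ddir v f)"
  using smooth_iff_ddir by blast

lemma smooth_continuous: "smooth f \<Longrightarrow> continuous_on S f"
  unfolding smooth_def
  using times_differentiable_imp_continuous continuous_on_subset by blast

lemma times_differentiable_const: "times_differentiable n (\<lambda>x. c)"
proof (induction n arbitrary: c)
  case (Suc n)
  have "ddir v (\<lambda>x::'a. c) = (\<lambda>x. 0)" for v
    by (rule ext, rule ddir_eqI[of _ "\<lambda>_. 0"]) (simp)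
  with Suc show ?case by simp
qed simp

lemma times_differentiable_add:
  "times_differentiable n f \<Longrightarrow> times_differentiable n g \<Longrightarrow> times_differentiable n (\<lambda>x. f x + g x)"
proof (induction n arbitrary: f g)
  case 0 then show ?case by (auto intro: continuous_intros)
next
  case (Suc n)
  then have d: "f differentiable at x" "g differentiable at x" for x by auto
  have "ddir v (\<lambda>x. f x + g x) = (\<lambda>x. ddir v f x + ddir v g x)" for v
    by (rule ext, rule ddir_eqI)
      (intro has_derivative_add; use d frechet_derivative_works in blast)
  with Suc d show ?case by auto
qed

lemma times_differentiable_linear_image:
  assumes L: "bounded_linear L"
  shows "times_differentiable n f \<Longrightarrow> times_differentiable n (\<lambda>x. L (f x))"
proof (induction n arbitrary: f)
  case 0 then show ?case
    by (auto intro: bounded_linear.continuous_on[OF L])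
next
  case (Suc n)
  then have d: "f differentiable at x" for x by auto
  have D: "((\<lambda>x. L (f x)) has_derivative (\<lambda>v. L (ddir v f x))) (at x)" for x
    by (rule bounded_linear.has_derivative[OF L]) (use d frechet_derivative_works in blast)
  then have "ddir v (\<lambda>x. L (f x)) = (\<lambda>x. L (ddir v f x))" for v
    by (intro ext ddir_eqI)
  with Suc D show ?case by (auto simp: differentiable_def)
qed

lemma times_differentiable_bilinear:
  assumes B: "bounded_bilinear B"
  shows "times_differentiable n f \<Longrightarrow> times_differentiable n g \<Longrightarrow>
    times_differentiable n (\<lambda>x. B (f x) (g x))"
proof (induction n arbitrary: f g)
  case 0 then show ?case
    by (auto intro: bounded_bilinear.continuous_on[OF B])
next
  case (Suc n)
  then have d: "f differentiable at x" "g differentiable at x" for x by auto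
  have D: "((\<lambda>x. B (f x) (g x)) has_derivative
      (\<lambda>v. B (f x) (ddir v g x) + B (ddir v f x) (g x))) (at x)" for x
    by (rule bounded_bilinear.FDERIV[OF B]) (use d frechet_derivative_works in blast)+
  then have "ddir v (\<lambda>x. B (f x) (g x)) = (\<lambda>x. B (f x) (ddir v g x) + B (ddir v f x) (g x))" for v
    by (intro ext ddir_eqI)
  moreover have "times_differentiable n (\<lambda>x. B (f x) (ddir v g x) + B (ddir v f x) (g x))" for v
    by (intro times_differentiable_add Suc.IH times_differentiable_Suc_D[OF Suc.prems(1)]
        times_differentiable_Suc_D[OF Suc.prems(2)]) (use Suc.prems in auto)
  ultimately show ?case using D by (auto simp: differentiable_def)
qed

lemma times_differentiable_sum:
  "(\<And>i. i \<in> I \<Longrightarrow> times_differentiable n (f i)) \<Longrightarrow> times_differentiable n (\<lambda>x. \<Sum>i\<in>I. f i x)"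
  by (induction I rule: infinite_finite_induct)
    (auto intro: times_differentiable_const times_differentiable_add)

text \<open>The chain rule expresses a directional derivative of \<open>f \<circ> g\<close> through the partial derivatives
  of \<open>f\<close> along a basis, which is why the intermediate space has to be Euclidean.\<close>

lemma times_differentiable_compose:
  fixes f :: "'b::euclidean_space \<Rightarrow> 'c::real_normed_vector"
  shows "times_differentiable n f \<Longrightarrow> times_differentiable n g \<Longrightarrow> times_differentiable n (\<lambda>x. f (g x))"
proof (induction n arbitrary: f)
  case 0 then show ?case
    by (auto intro: continuous_on_compose2)
next
  case (Suc n)
  then have d: "f differentiable at x" "g differentiable at y" for x y by auto
  have D: "((\<lambda>x. f (g x)) has_derivative (\<lambda>v. ddir (ddir v g x) f (g x))) (at x)" for x
    by (rule has_derivative_compose) (use d frechet_derivative_works in blast)+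
  then have 1: "ddir v (\<lambda>x. f (g x)) = (\<lambda>x. ddir (ddir v g x) f (g x))" for v
    by (intro ext ddir_eqI)
  have lin: "linear (frechet_derivative f (at y))" for y
    using d linear_frechet_derivative by blast
  have "ddir w f y = (\<Sum>b\<in>Basis. (w \<bullet> b) *\<^sub>R ddir b f y)" for w y
  proof -
    have "ddir w f y = ddir (\<Sum>b\<in>Basis. (w \<bullet> b) *\<^sub>R b) f y" by (simp add: euclidean_representation)
    also have "\<dots> = (\<Sum>b\<in>Basis. (w \<bullet> b) *\<^sub>R ddir b f y)"
      using lin by (simp add: linear_sum linear_cmul)
    finally show ?thesis .
  qed
  then have 2: "ddir v (\<lambda>x. f (g x)) = (\<lambda>x. \<Sum>b\<in>Basis. (ddir v g x \<bullet> b) *\<^sub>R ddir b f (g x))" for v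
    using 1 by metis
  have "times_differentiable n (\<lambda>x. \<Sum>b\<in>Basis. (ddir v g x \<bullet> b) *\<^sub>R ddir b f (g x))" for v
  proof (intro times_differentiable_sum times_differentiable_bilinear[OF bounded_bilinear_scaleR])
    fix b :: 'b
    show "times_differentiable n (\<lambda>x. ddir v g x \<bullet> b)"
      using Suc.prems by (intro times_differentiable_linear_image[OF bounded_linear_inner_left]) auto
    show "times_differentiable n (\<lambda>x. ddir b f (g x))"
      by (intro Suc.IH times_differentiable_Suc_D[OF Suc.prems(2)]) (use Suc.prems in auto)
  qed
  then show ?case using D 2 by (auto simp: differentiable_def)
qed

lemma times_differentiable_inverse:
  fixes f :: "'a::real_normed_vector \<Rightarrow> real"
  assumes nz: "\<And>x. f x \<noteq> 0"
  shows "times_differentiable n f \<Longrightarrow> times_differentiable n (\<lambda>x. inverse (f x))"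
proof (induction n)
  case 0 then show ?case using nz by (auto intro!: continuous_intros)
next
  case (Suc n)
  then have d: "(f has_derivative (\<lambda>v. ddir v f x)) (at x)" for x
    using frechet_derivative_works by auto
  have D: "((\<lambda>x. inverse (f x)) has_derivative
      (\<lambda>v. - (inverse (f x) * ddir v f x * inverse (f x)))) (at x)" for x
    using Deriv.has_derivative_inverse[OF nz d] .
  then have 1: "ddir v (\<lambda>x. inverse (f x)) = (\<lambda>x. - (inverse (f x) * ddir v f x * inverse (f x)))" for v
    by (intro ext ddir_eqI)
  have i: "times_differentiable n (\<lambda>x. inverse (f x))" using Suc times_differentiable_Suc_D by blast
  have "times_differentiable n (\<lambda>x. - (inverse (f x) * ddir v f x * inverse (f x)))" for v
    using Suc.prems by (intro times_differentiable_linear_image[OF bounded_linear_minus[OF bounded_linear_ident]]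
      times_differentiable_bilinear[OF bounded_bilinear_mult] i) auto
  then show ?case using D 1 by (auto simp: differentiable_def)
qed

lemma times_differentiable_sqrt:
  fixes f :: "'a::real_normed_vector \<Rightarrow> real"
  assumes pos: "\<And>x. f x > 0"
  shows "times_differentiable n f \<Longrightarrow> times_differentiable n (\<lambda>x. sqrt (f x))"
proof (induction n)
  case 0 then show ?case by (auto intro!: continuous_intros)
next
  case (Suc n)
  then have d: "(f has_derivative (\<lambda>v. ddir v f x)) (at x)" for x
    using frechet_derivative_works by auto
  have D: "((\<lambda>x. sqrt (f x)) has_derivative
      (\<lambda>v. ddir v f x * ((1/2) * inverse (sqrt (f x))))) (at x)" for x
    by (rule has_derivative_eq_rhs, rule has_derivative_real_sqrt[OF pos d]) (auto simp: field_simps)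
  then have 1: "ddir v (\<lambda>x. sqrt (f x)) = (\<lambda>x. ddir v f x * ((1/2) * inverse (sqrt (f x))))" for v
    by (intro ext ddir_eqI)
  have i: "times_differentiable n (\<lambda>x. sqrt (f x))" using Suc times_differentiable_Suc_D by blast
  have nz: "sqrt (f x) \<noteq> 0" for x using pos[of x] by auto
  have "times_differentiable n (\<lambda>x. ddir v f x * ((1/2) * inverse (sqrt (f x))))" for v
    using Suc.prems by (intro times_differentiable_linear_image[OF bounded_linear_mult_right]
      times_differentiable_bilinear[OF bounded_bilinear_mult] times_differentiable_inverse i nz) auto
  then show ?case using D 1 by (auto simp: differentiable_def)
qed

lemma times_differentiable_sin_cos:
  "times_differentiable n (sin :: real \<Rightarrow> real) \<and> times_differentiable n (cos :: real \<Rightarrow> real)"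
proof (induction n)
  case 0 then show ?case by (auto intro!: continuous_intros)
next
  case (Suc n)
  have s: "ddir v (sin :: real \<Rightarrow> real) = (\<lambda>x. v * cos x)" for v
    by (intro ext ddir_eqI) (auto intro!: derivative_eq_intros)
  have c: "ddir v (cos :: real \<Rightarrow> real) = (\<lambda>x. v * - sin x)" for v
    by (intro ext ddir_eqI) (auto intro!: derivative_eq_intros)
  have d: "(sin :: real \<Rightarrow> real) differentiable at x" "(cos :: real \<Rightarrow> real) differentiable at x" for x
    by (auto intro!: derivative_intros simp: field_differentiable_imp_differentiable field_differentiable_at_sin field_differentiable_at_cos)
  have "times_differentiable n (\<lambda>x. v * cos x)" for v :: real
    using Suc by (intro times_differentiable_linear_image[OF bounded_linear_mult_right]) auto
  moreover have "times_differentiable n (\<lambda>x. v * - sin x)" for v :: real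
    using Suc by (intro times_differentiable_linear_image[OF bounded_linear_mult_right]
      times_differentiable_linear_image[OF bounded_linear_minus[OF bounded_linear_ident]]) auto
  ultimately show ?case using d by (simp add: s c)
qed

lemma smooth_const: "smooth (\<lambda>x. c)"
  by (simp add: smooth_def times_differentiable_const)

lemma smooth_bounded_linear: 
  assumes L: "bounded_linear L" shows "smooth L"
proof -
  have 1: "(L has_derivative L) (at x)" for x
    by (rule bounded_linear_imp_has_derivative[OF L])
  then have "ddir v L = (\<lambda>x. L v)" for v by (intro ext ddir_eqI)
  then show ?thesis 
    using 1 by (subst smooth_iff_ddir) (auto simp: differentiable_def smooth_const)
qed

lemma smooth_id: "smooth (\<lambda>x. x)"
  by (rule smooth_bounded_linear[OF bounded_linear_ident])

lemma smooth_linear_image: "bounded_linear L \<Longrightarrow> smooth f \<Longrightarrow> smooth (\<lambda>x. L (f x))"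
  by (simp add: smooth_def times_differentiable_linear_image)

lemma smooth_bilinear: "bounded_bilinear B \<Longrightarrow> smooth f \<Longrightarrow> smooth g \<Longrightarrow> smooth (\<lambda>x. B (f x) (g x))"
  by (simp add: smooth_def times_differentiable_bilinear)

lemma smooth_add: "smooth f \<Longrightarrow> smooth g \<Longrightarrow> smooth (\<lambda>x. f x + g x)"
  by (simp add: smooth_def times_differentiable_add)

lemma smooth_minus: "smooth f \<Longrightarrow> smooth (\<lambda>x. - f x)"
  by (rule smooth_linear_image[OF bounded_linear_minus[OF bounded_linear_ident]])

lemma smooth_diff: "smooth f \<Longrightarrow> smooth g \<Longrightarrow> smooth (\<lambda>x. f x - g x)"
  using smooth_add[OF _ smooth_minus, of f g] by simp

lemma smooth_sum: "(\<And>i. i \<in> I \<Longrightarrow> smooth (f i)) \<Longrightarrow> smooth (\<lambda>x. \<Sum>i\<in>I. f i x)"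
  by (simp add: smooth_def times_differentiable_sum)

lemma smooth_compose:
  fixes f :: "'b::euclidean_space \<Rightarrow> 'c::real_normed_vector"
  shows "smooth f \<Longrightarrow> smooth g \<Longrightarrow> smooth (\<lambda>x. f (g x))"
  by (simp add: smooth_def times_differentiable_compose)

lemma smooth_inverse:
  fixes f :: "'a::real_normed_vector \<Rightarrow> real"
  shows "smooth f \<Longrightarrow> (\<And>x. f x \<noteq> 0) \<Longrightarrow> smooth (\<lambda>x. inverse (f x))"
  by (simp add: smooth_def times_differentiable_inverse)

lemma smooth_sqrt:
  fixes f :: "'a::real_normed_vector \<Rightarrow> real"
  shows "smooth f \<Longrightarrow> (\<And>x. f x > 0) \<Longrightarrow> smooth (\<lambda>x. sqrt (f x))"
  by (simp add: smooth_def times_differentiable_sqrt)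

lemma smooth_sin: "smooth f \<Longrightarrow> smooth (\<lambda>x. sin (f x :: real))"
  by (rule smooth_compose) (simp_all add: smooth_def times_differentiable_sin_cos)

lemma smooth_cos: "smooth f \<Longrightarrow> smooth (\<lambda>x. cos (f x :: real))"
  by (rule smooth_compose) (simp_all add: smooth_def times_differentiable_sin_cos)

lemma bounded_bilinear_cross3: "bounded_bilinear cross3"
  using bilinear_conv_bounded_bilinear bilinear_cross by blast

lemmas smooth_mult = smooth_bilinear[OF bounded_bilinear_mult]
lemmas smooth_inner = smooth_bilinear[OF bounded_bilinear_inner]
lemmas smooth_scaleR = smooth_bilinear[OF bounded_bilinear_scaleR]
lemmas smooth_cross3 = smooth_bilinear[OF bounded_bilinear_cross3]

lemma smooth_norm:
  fixes f :: "'a::real_normed_vector \<Rightarrow> 'b::euclidean_space"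
  assumes "smooth f" "\<And>x. f x \<noteq> 0"
  shows "smooth (\<lambda>x. norm (f x))"
  unfolding norm_eq_sqrt_inner using assms by (intro smooth_sqrt smooth_inner) auto

lemma smooth_Pair: 
  assumes "smooth f" "smooth g" shows "smooth (\<lambda>x. (f x, g x))"
proof -
  have "smooth (\<lambda>x. (f x, 0) + (0, g x))"
    by (intro smooth_add smooth_linear_image[OF _ assms(1)] smooth_linear_image[OF _ assms(2)]
      bounded_linear_Pair bounded_linear_ident bounded_linear_zero)
  then show ?thesis by simp
qed

lemma smooth_fst: "smooth (fst :: 'a::real_normed_vector \<times> 'b::real_normed_vector \<Rightarrow> 'a)"
  by (rule smooth_bounded_linear[OF bounded_linear_fst])

lemma smooth_snd: "smooth (snd :: 'a::real_normed_vector \<times> 'b::real_normed_vector \<Rightarrow> 'b)"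
  by (rule smooth_bounded_linear[OF bounded_linear_snd])

lemma smooth_power: "smooth f \<Longrightarrow> smooth (\<lambda>x. f x ^ n :: real)"
  by (induction n) (auto intro: smooth_const smooth_mult)

lemmas smooth_intros = smooth_const smooth_id smooth_add smooth_minus smooth_diff smooth_sum
  smooth_inverse smooth_mult smooth_inner smooth_scaleR smooth_cross3 smooth_Pair smooth_fst smooth_snd
  smooth_ddir smooth_sin smooth_cos smooth_power

lemma ddir_const: "ddir v (\<lambda>x. c) x = 0"
  by (rule ddir_eqI[of _ "\<lambda>_. 0"]) simp

lemma ddir_add: "smooth f \<Longrightarrow> smooth g \<Longrightarrow> ddir v (\<lambda>x. f x + g x) x = ddir v f x + ddir v g x"
  by (rule ddir_eqI) (intro has_derivative_add smooth_has_derivative)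

lemma ddir_diff: "smooth f \<Longrightarrow> smooth g \<Longrightarrow> ddir v (\<lambda>x. f x - g x) x = ddir v f x - ddir v g x"
  by (rule ddir_eqI) (intro has_derivative_diff smooth_has_derivative)

lemma ddir_sum: "(\<And>i. i \<in> I \<Longrightarrow> smooth (f i)) \<Longrightarrow> ddir v (\<lambda>x. \<Sum>i\<in>I. f i x) x = (\<Sum>i\<in>I. ddir v (f i) x)"
  by (rule ddir_eqI) (intro has_derivative_sum smooth_has_derivative)

lemma ddir_bilinear:
  assumes "bounded_bilinear B" "smooth f" "smooth g"
  shows "ddir v (\<lambda>x. B (f x) (g x)) x = B (f x) (ddir v g x) + B (ddir v f x) (g x)"
  by (rule ddir_eqI, rule bounded_bilinear.FDERIV[OF assms(1)]) (intro smooth_has_derivative assms)+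

lemmas ddir_mult = ddir_bilinear[OF bounded_bilinear_mult]
lemmas ddir_inner = ddir_bilinear[OF bounded_bilinear_inner]
lemmas ddir_scaleR = ddir_bilinear[OF bounded_bilinear_scaleR]

section \<open>Functions of two variables\<close>

abbreviation "Ds \<equiv> ddir (1::real, 0::real)"
abbreviation "Dt \<equiv> ddir (0::real, 1::real)"

lemma smooth_has_vector_derivative:
  "smooth f \<Longrightarrow> (f has_vector_derivative ddir 1 f t) (at t)"
  using smooth_differentiable[of f t] vector_derivative_works
  by (metis differentiableI_vector frechet_derivative_eq_vector_derivative scaleR_one)

lemma has_vector_derivative_along_line:
  assumes F: "smooth F"
  shows "((\<lambda>h. F (x + h *\<^sub>R v)) has_vector_derivative ddir v F (x + h *\<^sub>R v)) (at h)"
proof -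
  have "((\<lambda>h. F (x + h *\<^sub>R v)) has_derivative (\<lambda>k. ddir (k *\<^sub>R v) F (x + h *\<^sub>R v))) (at h)"
    by (rule has_derivative_compose[where f="\<lambda>h. x + h *\<^sub>R v"])
      (auto intro!: derivative_eq_intros smooth_has_derivative[OF F])
  moreover have "linear (frechet_derivative F (at y))" for y
    using F smooth_differentiable linear_frechet_derivative by blast
  ultimately show ?thesis
    by (simp add: has_vector_derivative_def linear_cmul)
qed

lemma has_vector_derivative_slice_s:
  "smooth F \<Longrightarrow> ((\<lambda>s. F (s, t)) has_vector_derivative Ds F (s, t)) (at s)"
  using has_vector_derivative_along_line[of F "(0,t)" "(1,0)" s] by simp

lemma has_vector_derivative_slice_t:
  "smooth F \<Longrightarrow> ((\<lambda>t. F (s, t)) has_vector_derivative Dt F (s, t)) (at t)"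
  using has_vector_derivative_along_line[of F "(s,0)" "(0,1)" t] by simp

lemma smooth_slice: 
  fixes F :: "real \<times> real \<Rightarrow> 'b::real_normed_vector"
  shows "smooth F \<Longrightarrow> smooth (\<lambda>t. F (s, t))"
  by (rule smooth_compose[of F]) (auto intro: smooth_intros)

text \<open>Here and below the first argument is the parameter \<open>s\<close> of a
  family and the second the parameter \<open>t\<close> along the curve.\<close>

lemma has_vector_derivative_integral_parameter:
  fixes F :: "real \<times> real \<Rightarrow> 'b::banach"
  assumes F: "smooth F"
  shows "((\<lambda>s. integral (cbox a b) (\<lambda>t. F (s, t))) has_vector_derivative
           integral (cbox a b) (\<lambda>t. Ds F (s, t))) (at s)"
  by (rule leibniz_rule_vector_derivative[where U=UNIV, simplified])
    (auto intro: has_vector_derivative_slice_s F integrable_continuous_interval smooth_continuous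
        smooth_slice smooth_ddir simp: split_beta)

text \<open>For functions of class \<open>C\<^sup>2\<close> the symmetry of second derivatives follows by differentiating the
  fundamental theorem of calculus in \<open>t\<close> under the integral sign with respect to \<open>s\<close>.\<close>

lemma mixed_partials:
  fixes F :: "real \<times> real \<Rightarrow> 'b::banach"
  assumes F: "smooth F"
  shows "Dt (Ds F) x = Ds (Dt F) x"
proof -
  obtain s t0 where x: "x = (s, t0)" by (cases x)
  let ?a = "t0 - 1"
  have eq: "Ds F (s, t) - Ds F (s, ?a) = integral {?a..t} (\<lambda>u. Ds (Dt F) (s, u))" if "t \<ge> ?a" for t
  proof -
    have "F (r, t) - F (r, ?a) = integral {?a..t} (\<lambda>u. Dt F (r, u))" for r
      by (rule sym, rule integral_unique, rule fundamental_theorem_of_calculus[OF that])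
        (auto intro: has_vector_derivative_at_within has_vector_derivative_slice_t F)
    then have "((\<lambda>r. F (r, t) - F (r, ?a)) has_vector_derivative
        integral {?a..t} (\<lambda>u. Ds (Dt F) (s, u))) (at s)"
      using has_vector_derivative_integral_parameter[OF smooth_ddir[OF F], of ?a t "(0,1)" s] by simp
    moreover have "((\<lambda>r. F (r, t) - F (r, ?a)) has_vector_derivative Ds F (s, t) - Ds F (s, ?a)) (at s)"
      by (intro has_vector_derivative_diff has_vector_derivative_slice_s F)
    ultimately show ?thesis using vector_derivative_unique_at by blast
  qed
  have "((\<lambda>t. integral {?a..t} (\<lambda>u. Ds (Dt F) (s, u))) has_vector_derivative Ds (Dt F) (s, t0))
      (at t0 within {?a..t0+1})"
    by (rule integral_has_vector_derivative) (auto intro: smooth_continuous[OF smooth_slice[OF smooth_ddir[OF smooth_ddir[OF F]]]])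
  then have "((\<lambda>t. Ds F (s, t) - Ds F (s, ?a)) has_vector_derivative Ds (Dt F) (s, t0))
      (at t0 within {?a..t0+1})"
    by (rule has_vector_derivative_transform[rotated 2]) (auto simp: eq)
  moreover have "((\<lambda>t. Ds F (s, t) - Ds F (s, ?a)) has_vector_derivative Dt (Ds F) (s, t0) - 0)
      (at t0 within {?a..t0+1})"
    by (rule has_vector_derivative_at_within[OF has_vector_derivative_diff[OF
          has_vector_derivative_slice_t[OF smooth_ddir[OF F]] has_vector_derivative_const]])
  ultimately show ?thesis
    using vector_derivative_unique_within_closed_interval[of ?a "t0+1" t0] by (auto simp: x)
qed

lemma has_real_derivative_integral_parameter:
  fixes F :: "real \<times> real \<Rightarrow> real"
  assumes F: "smooth F"
  shows "((\<lambda>s. integral (closed_segment a b) (\<lambda>t. F (s, t))) has_real_derivative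
           integral (closed_segment a b) (\<lambda>t. Ds F (s, t))) (at s)"
  using has_vector_derivative_integral_parameter[OF F, of _ _ s]
  by (simp add: closed_segment_eq_real_ivl has_real_derivative_iff_has_vector_derivative)

lemma integral_derivative_eq_0:
  fixes f :: "real \<Rightarrow> real"
  assumes "\<And>t. (f has_vector_derivative f' t) (at t)" and "f a = f b"
  shows "integral (closed_segment a b) f' = 0"
proof -
  have "integral {u..v} f' = f v - f u" if "u \<le> v" for u v
    by (rule integral_unique, rule fundamental_theorem_of_calculus[OF that])
      (auto intro: has_vector_derivative_at_within assms)
  then show ?thesis using assms(2) by (auto simp: closed_segment_eq_real_ivl)
qed

section \<open>Formal power series depending smoothly on parameters\<close>

text \<open>Coefficientwise notions. No convergence is involved, so the product rule, the symmetry of second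
  derivatives and the smoothness of inverses are inherited from the finitely many functions that enter
  each coefficient.\<close>

definition fps_smooth :: "('a::real_normed_vector \<Rightarrow> real fps) \<Rightarrow> bool" where
  "fps_smooth F \<longleftrightarrow> (\<forall>n. smooth (\<lambda>x. fps_nth (F x) n))"

definition fps_ddir :: "'a::real_normed_vector \<Rightarrow> ('a \<Rightarrow> real fps) \<Rightarrow> 'a \<Rightarrow> real fps" where
  "fps_ddir v F x = Abs_fps (\<lambda>n. ddir v (\<lambda>x. fps_nth (F x) n) x)"

lemma fps_ddir_nth: "fps_nth (fps_ddir v F x) n = ddir v (\<lambda>x. fps_nth (F x) n) x"
  by (simp add: fps_ddir_def)

lemma fps_smooth_nth: "fps_smooth F \<Longrightarrow> smooth (\<lambda>x. fps_nth (F x) n)"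
  by (simp add: fps_smooth_def)

lemma fps_smooth_add: "fps_smooth F \<Longrightarrow> fps_smooth G \<Longrightarrow> fps_smooth (\<lambda>x. F x + G x)"
  and fps_smooth_diff: "fps_smooth F \<Longrightarrow> fps_smooth G \<Longrightarrow> fps_smooth (\<lambda>x. F x - G x)"
  and fps_smooth_mult: "fps_smooth F \<Longrightarrow> fps_smooth G \<Longrightarrow> fps_smooth (\<lambda>x. F x * G x)"
  and fps_smooth_const: "fps_smooth (\<lambda>x. C)"
  and fps_smooth_ddir: "fps_smooth F \<Longrightarrow> fps_smooth (fps_ddir v F)"
  by (auto simp: fps_smooth_def fps_mult_nth fps_ddir_def intro!: smooth_intros)

lemma fps_smooth_fps_const: "smooth f \<Longrightarrow> fps_smooth (\<lambda>x. fps_const (f x))"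
  unfolding fps_smooth_def
proof
  show "smooth (\<lambda>x. fps_nth (fps_const (f x)) n)" if "smooth f" for n
    using that by (cases n) (auto intro: smooth_const)
qed

lemma fps_ddir_add: "fps_smooth F \<Longrightarrow> fps_smooth G \<Longrightarrow>
    fps_ddir v (\<lambda>x. F x + G x) x = fps_ddir v F x + fps_ddir v G x"
  by (rule fps_ext) (simp add: fps_ddir_nth ddir_add fps_smooth_nth)

lemma fps_ddir_diff: "fps_smooth F \<Longrightarrow> fps_smooth G \<Longrightarrow>
    fps_ddir v (\<lambda>x. F x - G x) x = fps_ddir v F x - fps_ddir v G x"
  by (rule fps_ext) (simp add: fps_ddir_nth ddir_diff fps_smooth_nth)

lemma fps_ddir_mult: 
  assumes "fps_smooth F" "fps_smooth G"
  shows "fps_ddir v (\<lambda>x. F x * G x) x = F x * fps_ddir v G x + fps_ddir v F x * G x"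
proof (rule fps_ext)
  fix n
  have "ddir v (\<lambda>x. fps_nth (F x * G x) n) x =
      (\<Sum>i=0..n. fps_nth (F x) i * ddir v (\<lambda>x. fps_nth (G x) (n-i)) x
         + ddir v (\<lambda>x. fps_nth (F x) i) x * fps_nth (G x) (n-i))"
    unfolding fps_mult_nth
    by (subst ddir_sum) (auto intro!: assms smooth_mult fps_smooth_nth sum.cong ddir_mult)
  then show "fps_nth (fps_ddir v (\<lambda>x. F x * G x) x) n
      = fps_nth (F x * fps_ddir v G x + fps_ddir v F x * G x) n"
    by (simp add: fps_ddir_nth fps_mult_nth sum.distrib)
qed

lemma fps_ddir_const: "fps_ddir v (\<lambda>x. C) x = 0"
  by (rule fps_ext) (simp add: fps_ddir_nth ddir_const)

lemma fps_ddir_fps_const: "fps_ddir v (\<lambda>x. fps_const (f x)) x = fps_const (ddir v f x)"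
proof (rule fps_ext)
  show "fps_nth (fps_ddir v (\<lambda>x. fps_const (f x)) x) n = fps_nth (fps_const (ddir v f x)) n" for n
    by (cases n) (simp_all add: fps_ddir_nth ddir_const)
qed

lemma fps_ddir_commute:
  fixes F :: "real \<times> real \<Rightarrow> real fps"
  assumes "fps_smooth F"
  shows "fps_ddir (0, 1) (fps_ddir (1, 0) F) x = fps_ddir (1, 0) (fps_ddir (0, 1) F) x"
  by (rule fps_ext) (simp add: fps_ddir_nth mixed_partials[OF fps_smooth_nth[OF assms]])

lemma fps_smooth_inverse:
  assumes F: "fps_smooth F" and nz: "\<And>x. fps_nth (F x) 0 \<noteq> 0"
  shows "fps_smooth (\<lambda>x. inverse (F x))"
  unfolding fps_smooth_def
proof
  fix n show "smooth (\<lambda>x. fps_nth (inverse (F x)) n)"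
  proof (induction n rule: less_induct)
    case (less n)
    show ?case
    proof (cases "n = 0")
      case True
      then show ?thesis using nz F by (auto intro!: smooth_intros fps_smooth_nth)
    next
      case False
      \<comment> \<open>The coefficients of the inverse satisfy a recursion that divides by the constant term only.\<close>
      have "fps_nth (inverse (F x)) n
          = - inverse (fps_nth (F x) 0) * (\<Sum>i=1..n. fps_nth (F x) i * fps_nth (inverse (F x)) (n - i))" for x
      proof -
        have "0 = fps_nth (F x * inverse (F x)) n"
          using False inverse_mult_eq_1'[OF nz[of x]] by simp
        also have "\<dots> = fps_nth (F x) 0 * fps_nth (inverse (F x)) n
            + (\<Sum>i=1..n. fps_nth (F x) i * fps_nth (inverse (F x)) (n - i))"
          by (simp add: fps_mult_nth sum.atLeast_Suc_atMost)
        finally show ?thesis using nz[of x] by (simp add: field_simps)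
      qed
      then show ?thesis
        using less F nz False
        by (auto intro!: smooth_minus smooth_mult smooth_sum smooth_inverse fps_smooth_nth[OF F])
    qed
  qed
qed

section \<open>The algebra of a rotating unit vector\<close>

text \<open>After multiplication by the square of \<open>1 + y0\<close>, the two sides differ by
  \<open>p2 * (1 - \<bar>y\<bar>\<^sup>2) + y2 * (y \<bullet> p)\<close>, which vanishes since \<open>y\<close> is a unit vector and \<open>p\<close> is tangent to the
  unit sphere at \<open>y\<close>.\<close>

lemma unit_triple_identity:
  fixes y0 y1 y2 :: "'a::comm_ring_1"
  assumes q: "q * (1 + y0) = 1"
    and unit: "y0 * y0 + y1 * y1 + y2 * y2 = 1"
    and orth: "y0 * p0 + y1 * p1 + y2 * p2 = 0"
  shows "p2 * q - y2 * q * q * p0 = (y0 * p2 - y2 * p0) * q - (y2 * p1 - y1 * p2) * q * q * y1"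
proof -
  have "p2 * (1 + y0) - y2 * p0 - ((y0 * p2 - y2 * p0) * (1 + y0) - (y2 * p1 - y1 * p2) * y1)
      = p2 * (1 - (y0 * y0 + y1 * y1 + y2 * y2)) + y2 * (y0 * p0 + y1 * p1 + y2 * p2)"
    by (simp add: algebra_simps)
  then have 1: "p2 * (1 + y0) - y2 * p0 = (y0 * p2 - y2 * p0) * (1 + y0) - (y2 * p1 - y1 * p2) * y1"
    by (simp add: unit orth)
  have 2: "z * q = z * q * (q * (1 + y0))" for z
    by (simp add: q)
  have "p2 * q - y2 * q * q * p0 = q * q * (p2 * (1 + y0) - y2 * p0)"
    using 2[of p2] by (simp add: algebra_simps)
  also have "\<dots> = (y0 * p2 - y2 * p0) * q * (q * (1 + y0)) - (y2 * p1 - y1 * p2) * q * q * y1"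
    unfolding 1 by (simp add: algebra_simps)
  also have "\<dots> = (y0 * p2 - y2 * p0) * q - (y2 * p1 - y1 * p2) * q * q * y1"
    using 2[of "y0 * p2 - y2 * p0"] by simp
  finally show ?thesis .
qed

text \<open>Let \<open>y\<close> be a unit vector that is parallel, in direction \<open>t\<close>, for the connection with coefficients
  \<open>(a, b, m / X)\<close>, and let the data vary with \<open>s\<close>: here \<open>r\<close> stands for the \<open>t\<close>-derivative of \<open>y\<close>, \<open>p\<close> for its
  \<open>s\<close>-derivative, \<open>P\<close> for the mixed derivative, and \<open>as\<close>, \<open>bs\<close>, \<open>ms\<close> for the \<open>s\<close>-derivatives of \<open>a\<close>, \<open>b\<close>, \<open>m\<close>. The
  left-hand side is the \<open>s\<close>-derivative of \<open>m + X * (a * y2 - b * y1) * q\<close>, which is \<open>X\<close> times the rate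
  of rotation of the frame obtained by turning the first basis vector into \<open>y\<close> along a great circle.
  The identity says that it equals the pairing of the varied coefficients with \<open>y\<close>, up to the \<open>t\<close>-derivative of
  \<open>(y2 * p1 - y1 * p2) * q\<close>; the latter is the rate of rotation of the same frame in direction \<open>s\<close>. The
  factor \<open>X\<close>, the inverse of the spectral parameter, keeps all terms in the ring of power series.\<close>

lemma rotating_frame_identity:
  fixes y0 y1 y2 :: "'a::comm_ring_1"
  assumes q: "q * (1 + y0) = 1"
    and unit: "y0 * y0 + y1 * y1 + y2 * y2 = 1"
    and orth: "y0 * p0 + y1 * p1 + y2 * p2 = 0"
    and r0: "X * r0 = X * (a * y1 + b * y2)"
    and r1: "X * r1 = m * y2 - X * a * y0"
    and r2: "X * r2 = - (X * b * y0) - m * y1"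
    and rs1: "X * P1 = ms * y2 + m * p2 - X * (as * y0 + a * p0)"
    and rs2: "X * P2 = - (X * (bs * y0 + b * p0)) - (ms * y1 + m * p1)"
  shows "X * ((a * p2 + as * y2 - (b * p1 + bs * y1)) * q - (a * y2 - b * y1) * (q * q * p0)) + ms
    = X * ((r2 * p1 + y2 * P1 - (r1 * p2 + y1 * P2)) * q - (y2 * p1 - y1 * p2) * (q * q * r0))
      + ms * y0 + X * as * y2 - X * bs * y1"
proof -
  have unit': "(y1 * y1 + y2 * y2) * q + y0 = 1"
  proof -
    have "y1 * y1 + y2 * y2 = (1 - y0) * (1 + y0)"
      using unit by (simp add: algebra_simps)
    then have "(y1 * y1 + y2 * y2) * q = (1 - y0) * (q * (1 + y0))" by (simp add: mult_ac)
    then show ?thesis by (simp add: q)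
  qed
  have A: "z * q = z - y0 * z * q" for z
    using arg_cong[OF q, of "\<lambda>u. z * u"] by (simp add: algebra_simps)
  have B2: "p2 * q - y2 * q * q * p0 = (y0 * p2 - y2 * p0) * q - (y2 * p1 - y1 * p2) * q * q * y1"
    using unit_triple_identity[OF q unit orth] .
  have B1: "p1 * q - y1 * q * q * p0 = (y0 * p1 - y1 * p0) * q + (y2 * p1 - y1 * p2) * q * q * y2"
    using unit_triple_identity[OF q, of y2 y1 p0 p2 p1] unit orth by (simp add: algebra_simps)
  have "X * ((r2 * p1 + y2 * P1 - (r1 * p2 + y1 * P2)) * q - (y2 * p1 - y1 * p2) * (q * q * r0))
      = ((X * r2) * p1 + y2 * (X * P1) - ((X * r1) * p2 + y1 * (X * P2))) * q
        - (y2 * p1 - y1 * p2) * (q * q * (X * r0))"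
    by (simp add: algebra_simps)
  also have "\<dots> = X * a * ((y0 * p2 - y2 * p0) * q - (y2 * p1 - y1 * p2) * q * q * y1)
      - X * b * ((y0 * p1 - y1 * p0) * q + (y2 * p1 - y1 * p2) * q * q * y2)
      - X * as * (y0 * y2 * q) + X * bs * (y0 * y1 * q) + ms * ((y1 * y1 + y2 * y2) * q)"
    unfolding r0 r1 r2 rs1 rs2 by (simp add: algebra_simps)
  also have "\<dots> = X * a * (p2 * q - y2 * q * q * p0) - X * b * (p1 * q - y1 * q * q * p0)
      - X * as * (y2 - y2 * q) + X * bs * (y1 - y1 * q) + ms * (1 - y0)"
  proof -
    have "(y1 * y1 + y2 * y2) * q = 1 - y0" "y0 * y2 * q = y2 - y2 * q" "y0 * y1 * q = y1 - y1 * q"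
      using unit' A[of y1] A[of y2] by (simp_all add: algebra_simps)
    then show ?thesis by (simp only: B1 B2)
  qed
  finally show ?thesis by (simp add: algebra_simps)
qed

section \<open>Arclength calculus and the vector fields\<close>

lemma vector_derivative_eq_ddir: "smooth f \<Longrightarrow> vector_derivative f (at t) = ddir 1 f t"
  by (simp add: smooth_has_vector_derivative vector_derivative_at)

text \<open>As a rewrite rule the recursion for \<open>Y\<close> does not stop at the intended step: the indices \<open>k - i + 1\<close>
  inside the sum are successors again.\<close>

declare Y.simps [simp del]

locale immersed_curve =
  fixes \<gamma> :: "real \<Rightarrow> real^3"
  assumes smooth_curve: "smooth \<gamma>" and immersed: "\<And>t. vector_derivative \<gamma> (at t) \<noteq> 0"
begin

abbreviation "dx \<equiv> arc_deriv \<gamma>"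
abbreviation "T \<equiv> tangent \<gamma>"

lemma speed_eq: "speed \<gamma> = (\<lambda>t. norm (ddir 1 \<gamma> t))"
  by (simp add: fun_eq_iff speed_def vector_derivative_eq_ddir smooth_curve)

lemma speed_pos: "speed \<gamma> t > 0"
  by (simp add: speed_def immersed)

lemma smooth_speed: "smooth (speed \<gamma>)"
  unfolding speed_eq
  using smooth_curve immersed vector_derivative_eq_ddir[OF smooth_curve]
  by (auto intro!: smooth_norm smooth_ddir)

lemma arc_eq: "smooth f \<Longrightarrow> dx f = (\<lambda>t. inverse (speed \<gamma> t) *\<^sub>R ddir 1 f t)"
  by (simp add: fun_eq_iff arc_deriv_def vector_derivative_eq_ddir)

lemma smooth_arc: "smooth f \<Longrightarrow> smooth (dx f)"
  unfolding arc_eq using speed_pos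
  by (auto intro!: smooth_intros smooth_speed simp: order_less_imp_not_eq2)

lemma arc_has_vector_derivative:
  "smooth f \<Longrightarrow> (f has_vector_derivative speed \<gamma> t *\<^sub>R dx f t) (at t)"
  using smooth_has_vector_derivative[of f t] speed_pos[of t] by (simp add: arc_eq)

lemma arc_eqI:
  assumes "(f has_vector_derivative speed \<gamma> t *\<^sub>R d) (at t)" shows "dx f t = d"
  using assms speed_pos[of t] by (simp add: arc_deriv_def vector_derivative_at)

lemma arc_const: "dx (\<lambda>t. c) t = 0"
  by (rule arc_eqI) simp

lemma arc_add: "smooth f \<Longrightarrow> smooth g \<Longrightarrow> dx (\<lambda>t. f t + g t) t = dx f t + dx g t"
  by (rule arc_eqI) (simp add: scaleR_add_right has_vector_derivative_add arc_has_vector_derivative)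

lemma arc_diff: "smooth f \<Longrightarrow> smooth g \<Longrightarrow> dx (\<lambda>t. f t - g t) t = dx f t - dx g t"
  by (rule arc_eqI) (simp add: scaleR_diff_right has_vector_derivative_diff arc_has_vector_derivative)

lemma arc_minus: "smooth f \<Longrightarrow> dx (\<lambda>t. - f t) t = - dx f t"
  by (rule arc_eqI) (simp add: has_vector_derivative_minus arc_has_vector_derivative)

lemma arc_sum: "(\<And>i. i \<in> I \<Longrightarrow> smooth (f i)) \<Longrightarrow> dx (\<lambda>t. \<Sum>i\<in>I. f i t) t = (\<Sum>i\<in>I. dx (f i) t)"
  by (rule arc_eqI) (simp add: scaleR_sum_right has_vector_derivative_sum arc_has_vector_derivative)

lemma arc_bilinear:
  assumes B: "bounded_bilinear B" and fg: "smooth f" "smooth g"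
  shows "dx (\<lambda>t. B (f t) (g t)) t = B (f t) (dx g t) + B (dx f t) (g t)"
  using bounded_bilinear.has_vector_derivative[OF B arc_has_vector_derivative[OF fg(1)]
      arc_has_vector_derivative[OF fg(2)], of t]
  by (intro arc_eqI) (simp add: bounded_bilinear.scaleR_left[OF B] bounded_bilinear.scaleR_right[OF B] scaleR_add_right)

lemmas arc_mult = arc_bilinear[OF bounded_bilinear_mult]
lemmas arc_inner = arc_bilinear[OF bounded_bilinear_inner]
lemmas arc_scaleR = arc_bilinear[OF bounded_bilinear_scaleR]
lemmas arc_cross3 = arc_bilinear[OF bounded_bilinear_cross3]

lemma smooth_tangent: "smooth T"
  unfolding tangent_def by (rule smooth_arc[OF smooth_curve])

lemma tangent_unit: "T t \<bullet> T t = 1"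
  using immersed[of t]
  by (simp add: tangent_def arc_deriv_def speed_def dot_square_norm power2_eq_square)

lemma smooth_Y: "smooth (Y k \<gamma>)"
proof (induction k rule: less_induct)
  case (less k)
  show ?case
  proof (cases k)
    case 0
    have "Y 0 \<gamma> = T" by (simp add: fun_eq_iff Y.simps)
    then show ?thesis using 0 smooth_tangent by simp
  next
    case (Suc n)
    have Y_eq: "Y k \<gamma> = (\<lambda>t. cross3 (T t) (dx (Y n \<gamma>) t)
        - ((1/2) * (\<Sum>i=1..n. Y i \<gamma> t \<bullet> Y (n - i + 1) \<gamma> t)) *\<^sub>R T t)"
      by (rule ext) (simp only: Suc Y.simps)
    show ?thesis
      unfolding Y_eq using less Suc by (intro smooth_intros smooth_tangent smooth_arc) auto
  qed
qed

text \<open>The tangential part in the recursion cancels the contribution of the fields of lower index, so that the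
  generating series of the fields \<open>Y k\<close> has formal length one.\<close>

lemma Y_formal_unit: "(\<Sum>i\<le>k. Y i \<gamma> t \<bullet> Y (k - i) \<gamma> t) = (if k = 0 then 1 else 0)"
proof (cases k)
  case 0
  then show ?thesis by (simp add: tangent_unit Y.simps(1))
next
  case (Suc n)
  let ?S = "\<Sum>i=1..n. Y i \<gamma> t \<bullet> Y (n - i + 1) \<gamma> t"
  have "(\<Sum>i\<le>Suc n. Y i \<gamma> t \<bullet> Y (Suc n - i) \<gamma> t)
      = Y 0 \<gamma> t \<bullet> Y (Suc n) \<gamma> t + (\<Sum>i=1..n. Y i \<gamma> t \<bullet> Y (Suc n - i) \<gamma> t) + Y (Suc n) \<gamma> t \<bullet> Y 0 \<gamma> t"
    by (simp add: atMost_atLeast0 sum.atLeast_Suc_atMost)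
  also have "(\<Sum>i=1..n. Y i \<gamma> t \<bullet> Y (Suc n - i) \<gamma> t) = ?S"
    by (rule sum.cong) (auto simp: Suc_diff_le)
  also have "Y (Suc n) \<gamma> t \<bullet> Y 0 \<gamma> t = - (1/2) * ?S"
    by (subst Y.simps(2)) (simp add: inner_diff_left tangent_unit dot_cross_self Y.simps(1))
  also have "Y 0 \<gamma> t \<bullet> Y (Suc n) \<gamma> t = - (1/2) * ?S"
    by (subst Y.simps(2)) (simp add: inner_diff_right tangent_unit dot_cross_self Y.simps(1))
  finally show ?thesis by (simp add: Suc)
qed

text \<open>The generating series is parallel for the connection \<open>d/dx + \<lambda> T \<times>\<close>. The recursion alone gives
  this up to a tangential term \<open>T \<bullet> (Y k)'\<close>. Differentiating the formal unit length expresses this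
  term through the lower fields, and by the induction hypothesis it becomes a sum of determinants
  \<open>det (Y (k - i), T, Y (i + 1))\<close> that changes sign when the order of summation is reversed.\<close>

lemma Y_transport: "dx (Y k \<gamma>) t = - cross3 (T t) (Y (Suc k) \<gamma> t)"
proof (induction k arbitrary: t rule: less_induct)
  case (less k)
  have "0 = dx (\<lambda>t. \<Sum>i\<le>k. Y i \<gamma> t \<bullet> Y (k - i) \<gamma> t) t"
    by (simp add: Y_formal_unit arc_const)
  also have "\<dots> = (\<Sum>i\<le>k. Y i \<gamma> t \<bullet> dx (Y (k - i) \<gamma>) t) + (\<Sum>i\<le>k. Y (k - i) \<gamma> t \<bullet> dx (Y i \<gamma>) t)"
    by (simp add: arc_sum arc_inner smooth_inner smooth_Y sum.distrib inner_commute)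
  also have "(\<Sum>i\<le>k. Y i \<gamma> t \<bullet> dx (Y (k - i) \<gamma>) t) = (\<Sum>i\<le>k. Y (k - i) \<gamma> t \<bullet> dx (Y i \<gamma>) t)"
    by (rule sum.reindex_bij_witness[of _ "\<lambda>i. k - i" "\<lambda>i. k - i"]) auto
  finally have "0 = (\<Sum>i\<le>k. Y (k - i) \<gamma> t \<bullet> dx (Y i \<gamma>) t)" by simp
  also have "\<dots> = T t \<bullet> dx (Y k \<gamma>) t + (\<Sum>i<k. Y (k - i) \<gamma> t \<bullet> dx (Y i \<gamma>) t)"
    by (simp add: lessThan_Suc_atMost[symmetric] Y.simps(1))
  also have "(\<Sum>i<k. Y (k - i) \<gamma> t \<bullet> dx (Y i \<gamma>) t)
      = (\<Sum>i<k. - (Y (k - i) \<gamma> t \<bullet> cross3 (T t) (Y (Suc i) \<gamma> t)))"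
    by (rule sum.cong) (auto simp: less.IH)
  also have "\<dots> = 0"
  proof -
    let ?f = "\<lambda>i. - (Y (k - i) \<gamma> t \<bullet> cross3 (T t) (Y (Suc i) \<gamma> t))"
    have "sum ?f {..<k} = (\<Sum>i<k. ?f (k - Suc i))" by (rule sum.nat_diff_reindex[symmetric])
    also have "\<dots> = (\<Sum>i<k. - ?f i)"
    proof (rule sum.cong)
      fix i assume "i \<in> {..<k}"
      then have "k - (k - Suc i) = Suc i" "Suc (k - Suc i) = k - i" by auto
      moreover have "x \<bullet> cross3 y z = - (z \<bullet> cross3 y x)" for x y z
        by (simp add: cross3_simps)
      ultimately show "?f (k - Suc i) = - ?f i" by metis
    qed simp
    finally show ?thesis by (simp add: sum_negf)
  qed
  finally have orth: "T t \<bullet> dx (Y k \<gamma>) t = 0" by simp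
  have "cross3 u (cross3 u w - c *\<^sub>R u) = (u \<bullet> w) *\<^sub>R u - (u \<bullet> u) *\<^sub>R w" for u w :: "real^3" and c
    by (simp add: Cross3.right_diff_distrib Lagrange cross_mult_right)
  then show ?case
    by (simp only: Y.simps(2) orth tangent_unit) simp
qed

lemma integral_arc_eq_0:
  fixes f :: "real \<Rightarrow> real"
  assumes "smooth f" "f a = f b"
  shows "arc_integral (closed_segment a b) \<gamma> (dx f) = 0"
  unfolding arc_integral_def
  by (rule integral_derivative_eq_0[of f]) (use arc_has_vector_derivative[OF assms(1)] assms(2) in \<open>auto simp: mult.commute\<close>)

end

section \<open>Equivariance\<close>

lemma rotation_inner:
  fixes A :: "real^3^3"
  assumes "rotation_matrix A" shows "(A *v x) \<bullet> (A *v y) = x \<bullet> y"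
  using assms orthogonal_transformation_matrix[of "(*v) A"]
  by (simp add: rotation_matrix_def orthogonal_transformation_def)

lemma rotation_norm:
  fixes A :: "real^3^3"
  assumes "rotation_matrix A" shows "norm (A *v x) = norm x"
  by (simp add: norm_eq_sqrt_inner rotation_inner assms)

text \<open>A fixed-point-free diffeomorphism of the line preserves the orientation: a decreasing one would have
  a fixed point between \<open>0\<close> and the image of \<open>0\<close>.\<close>

lemma deck_transformation_derivative_pos:
  assumes deck: "deck_transformation \<tau>"
  shows "ddir 1 \<tau> t > 0"
proof -
  have s: "smooth \<tau>" "smooth (inv \<tau>)" and bij: "bij \<tau>" and fp: "\<And>t. \<tau> t \<noteq> t"
    using deck by (auto simp: deck_transformation_def)
  have D: "(\<tau> has_real_derivative ddir 1 \<tau> t) (at t)" for t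
    using smooth_has_vector_derivative[OF s(1)] by (simp add: has_real_derivative_iff_has_vector_derivative)
  have Di: "(inv \<tau> has_real_derivative ddir 1 (inv \<tau>) t) (at t)" for t
    using smooth_has_vector_derivative[OF s(2)] by (simp add: has_real_derivative_iff_has_vector_derivative)
  have nz: "ddir 1 \<tau> t \<noteq> 0" for t
  proof
    assume "ddir 1 \<tau> t = 0"
    then have "((\<lambda>t. inv \<tau> (\<tau> t)) has_real_derivative 0) (at t)"
      using DERIV_chain2[OF Di D, of t] by simp
    moreover have "(\<lambda>t. inv \<tau> (\<tau> t)) = (\<lambda>t. t)" using bij by (simp add: bij_is_inj)
    ultimately show False using DERIV_unique[OF DERIV_ident, of 0 t] by simp
  qed
  have cont: "continuous_on S (ddir 1 \<tau>)" for S
    by (intro smooth_continuous smooth_ddir s)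
  show ?thesis
  proof (rule ccontr)
    assume "\<not> ddir 1 \<tau> t > 0"
    then have neg_t: "ddir 1 \<tau> t < 0" using nz[of t] by linarith
    have neg: "ddir 1 \<tau> u < 0" for u
    proof (rule ccontr)
      assume "\<not> ddir 1 \<tau> u < 0"
      then have "ddir 1 \<tau> u > 0" using nz[of u] by linarith
      then have "\<exists>x. ddir 1 \<tau> x = 0"
        using neg_t IVT'[OF _ _ _ cont, of t 0 u] IVT2'[OF _ _ _ cont, of t 0 u]
        by (meson linear less_imp_le)
      then show False using nz by blast
    qed
    let ?g = "\<lambda>t. \<tau> t - t"
    have dec: "\<tau> y \<le> \<tau> x" if "x \<le> y" for x y
      using DERIV_nonpos_imp_nonincreasing[OF that, of \<tau>] D neg by (metis less_imp_le)
    have cg: "continuous_on S ?g" for S by (intro continuous_intros smooth_continuous s)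
    show False
    proof (cases "\<tau> 0 \<ge> 0")
      case True
      have "\<exists>x\<ge>0. x \<le> \<tau> 0 \<and> ?g x = 0"
        using True dec[of 0 "\<tau> 0"] by (intro IVT2' cg) auto
      then show False using fp by auto
    next
      case False
      have "\<exists>x\<ge>\<tau> 0. x \<le> 0 \<and> ?g x = 0"
        using False dec[of "\<tau> 0" 0] by (intro IVT2' cg) auto
      then show False using fp by auto
    qed
  qed
qed

locale equivariant_curve =
  fixes A :: "real^3^3" and a :: "real^3" and \<tau> :: "real \<Rightarrow> real" and \<gamma> :: "real \<Rightarrow> real^3"
  assumes rot: "rotation_matrix A" and deck: "deck_transformation \<tau>"
    and in_curve_space: "\<gamma> \<in> curve_space A a \<tau>"

sublocale equivariant_curve \<subseteq> immersed_curve \<gamma>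
  using in_curve_space by unfold_locales (auto simp: curve_space_def)

context equivariant_curve
begin

lemma smooth_deck: "smooth \<tau>"
  using deck by (simp add: deck_transformation_def)

lemma has_vector_derivative_deck:
  assumes "smooth f"
  shows "((\<lambda>t. f (\<tau> t)) has_vector_derivative ddir 1 \<tau> t *\<^sub>R ddir 1 f (\<tau> t)) (at t)"
proof -
  have "(\<tau> has_real_derivative ddir 1 \<tau> t) (at t)"
    using smooth_has_vector_derivative[OF smooth_deck] by (simp add: has_real_derivative_iff_has_vector_derivative)
  then show ?thesis
    using vector_derivative_diff_chain_within[of \<tau> "ddir 1 \<tau> t" t UNIV f "\<lambda>k. k *\<^sub>R ddir 1 f (\<tau> t)"]
      smooth_has_vector_derivative[OF assms, of "\<tau> t"]
    by (simp add: has_real_derivative_iff_has_vector_derivative o_def has_vector_derivative_def has_derivative_at_withinI)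
qed

lemma matrix_has_vector_derivative:
  "(f has_vector_derivative d) F \<Longrightarrow> ((\<lambda>t. A *v f t) has_vector_derivative A *v d) F"
  by (rule bounded_linear.has_vector_derivative[OF matrix_vector_mul_bounded_linear])

text \<open>Since \<open>h\<close> is an isometry, the arclength form is invariant under \<open>\<tau>\<close>.\<close>

lemma speed_deck: "speed \<gamma> (\<tau> t) * ddir 1 \<tau> t = speed \<gamma> t"
proof -
  have "((\<lambda>t. A *v \<gamma> t + a) has_vector_derivative A *v ddir 1 \<gamma> t) (at t)"
    by (simp add: has_vector_derivative_add_const matrix_has_vector_derivative smooth_has_vector_derivative smooth_curve)
  moreover have "(\<lambda>t. A *v \<gamma> t + a) = (\<lambda>t. \<gamma> (\<tau> t))"
    using in_curve_space by (simp add: curve_space_def)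
  ultimately have "A *v ddir 1 \<gamma> t = ddir 1 \<tau> t *\<^sub>R ddir 1 \<gamma> (\<tau> t)"
    using has_vector_derivative_deck[OF smooth_curve, of t] vector_derivative_unique_at by metis
  then have "norm (A *v ddir 1 \<gamma> t) = \<bar>ddir 1 \<tau> t\<bar> * norm (ddir 1 \<gamma> (\<tau> t))" by simp
  then show ?thesis
    using deck_transformation_derivative_pos[OF deck, of t] by (simp add: speed_eq rotation_norm[OF rot] mult.commute)
qed

text \<open>The additive constant covers the curve itself, which is equivariant only up to a translation.\<close>

lemma arc_deck_general:
  assumes f: "smooth f" and L: "bounded_linear L" and eq: "\<And>t. f (\<tau> t) = L (f t) + c"
  shows "dx f (\<tau> t) = L (dx f t)"
proof -
  have "((\<lambda>t. L (f t) + c) has_vector_derivative L (ddir 1 f t)) (at t)"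
    by (simp add: has_vector_derivative_add_const bounded_linear.has_vector_derivative[OF L smooth_has_vector_derivative[OF f]])
  then have "L (ddir 1 f t) = ddir 1 \<tau> t *\<^sub>R ddir 1 f (\<tau> t)"
    using has_vector_derivative_deck[OF f, of t] vector_derivative_unique_at unfolding eq by metis
  moreover have "inverse (speed \<gamma> t) = inverse (speed \<gamma> (\<tau> t)) * inverse (ddir 1 \<tau> t)"
    by (metis speed_deck inverse_mult_distrib)
  ultimately show ?thesis
    using deck_transformation_derivative_pos[OF deck, of t]
    by (simp add: arc_eq f linear_cmul bounded_linear.linear[OF L])
qed

lemma arc_deck: "smooth f \<Longrightarrow> (\<And>t. f (\<tau> t) = A *v f t) \<Longrightarrow> dx f (\<tau> t) = A *v dx f t"
  using arc_deck_general[of f "(*v) A" 0] matrix_vector_mul_bounded_linear by simp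

lemma tangent_deck: "T (\<tau> t) = A *v T t"
  unfolding tangent_def using in_curve_space
  by (intro arc_deck_general[OF smooth_curve matrix_vector_mul_bounded_linear]) (auto simp: curve_space_def)

lemma Y_deck: "Y k \<gamma> (\<tau> t) = A *v Y k \<gamma> t"
proof (induction k arbitrary: t rule: less_induct)
  case (less k)
  show ?case
  proof (cases k)
    case 0
    then show ?thesis by (simp add: tangent_deck Y.simps(1))
  next
    case (Suc n)
    have "(\<Sum>i=1..n. Y i \<gamma> (\<tau> t) \<bullet> Y (n - i + 1) \<gamma> (\<tau> t)) = (\<Sum>i=1..n. Y i \<gamma> t \<bullet> Y (n - i + 1) \<gamma> t)"
      by (rule sum.cong) (use less Suc in \<open>auto simp: rotation_inner[OF rot]\<close>)
    moreover have "dx (Y n \<gamma>) (\<tau> t) = A *v dx (Y n \<gamma>) t"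
      using less Suc by (intro arc_deck smooth_Y) auto
    ultimately show ?thesis
      unfolding Suc Y.simps(2)
      by (simp add: tangent_deck cross_rotation_matrix[OF rot] matrix_vector_mult_diff_distrib
          matrix_vector_mult_scaleR)
  qed
qed

end

section \<open>Families of curves\<close>

lemma ddir_slice_t: "smooth F \<Longrightarrow> ddir 1 (\<lambda>t. F (s, t)) t = Dt F (s, t)"
  by (metis has_vector_derivative_slice_t smooth_slice vector_derivative_eq_ddir vector_derivative_at)

text \<open>The part of \<open>w\<close> orthogonal to \<open>e\<close> and \<open>n\<close> has vanishing cross product with \<open>e \<times> n\<close>, hence is a multiple
  of it.\<close>

lemma orthonormal_expansion:
  fixes e n :: "real^3"
  assumes e: "e \<bullet> e = 1" and n: "n \<bullet> n = 1" and orth: "e \<bullet> n = 0"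
  shows "u \<bullet> w = (u \<bullet> e) * (w \<bullet> e) + (u \<bullet> n) * (w \<bullet> n) + (u \<bullet> cross3 e n) * (w \<bullet> cross3 e n)"
proof -
  define b where "b = cross3 e n"
  define w' where "w' = w - (w \<bullet> e) *\<^sub>R e - (w \<bullet> n) *\<^sub>R n"
  have b: "b \<bullet> b = 1" "e \<bullet> b = 0" "n \<bullet> b = 0"
    using e n orth by (simp_all add: b_def dot_cross dot_cross_self inner_commute[of n e])
  have "w' \<bullet> e = 0" "w' \<bullet> n = 0" and wb: "w' \<bullet> b = w \<bullet> b"
    using e n orth b by (simp_all add: w'_def inner_diff_left inner_commute[of n e])
  then have "cross3 w' b = 0"
    by (simp add: b_def Lagrange)
  then have "cross3 b (cross3 w' b) = 0" by simp
  then have "w' = (w' \<bullet> b) *\<^sub>R b"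
    by (simp add: Lagrange b inner_commute)
  note this[unfolded wb, unfolded w'_def]
  then have "w = (w \<bullet> e) *\<^sub>R e + (w \<bullet> n) *\<^sub>R n + (w \<bullet> b) *\<^sub>R b"
    by (simp only: diff_eq_eq add_ac)
  then have "u \<bullet> w = u \<bullet> ((w \<bullet> e) *\<^sub>R e + (w \<bullet> n) *\<^sub>R n + (w \<bullet> b) *\<^sub>R b)" by simp
  then show ?thesis by (simp add: inner_add_right mult.commute b_def)
qed

locale curve_family =
  fixes A :: "real^3^3" and a :: "real^3" and \<tau> :: "real \<Rightarrow> real"
    and \<Gamma> :: "real \<times> real \<Rightarrow> real^3"
  assumes rot: "rotation_matrix A" and deck: "deck_transformation \<tau>"
    and smooth_family: "smooth \<Gamma>"
    and family_in_curve_space: "\<And>s. (\<lambda>t. \<Gamma> (s, t)) \<in> curve_space A a \<tau>"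

sublocale curve_family \<subseteq> curve: equivariant_curve A a \<tau> "\<lambda>t. \<Gamma> (s, t)" for s
  by unfold_locales (auto intro: rot deck family_in_curve_space)

context curve_family
begin

text \<open>Speed, unit tangent and the fields \<open>Y k\<close> as functions of \<open>(s, t)\<close>, to which partial derivatives in both
  directions apply.\<close>

definition v :: "real \<times> real \<Rightarrow> real" where "v x = norm (Dt \<Gamma> x)"
definition T :: "real \<times> real \<Rightarrow> real^3" where "T x = inverse (v x) *\<^sub>R Dt \<Gamma> x"
definition Yf :: "nat \<Rightarrow> real \<times> real \<Rightarrow> real^3" where
  "Yf k x = Y k (\<lambda>t. \<Gamma> (fst x, t)) (snd x)"

lemma speed_family: "speed (\<lambda>t. \<Gamma> (s, t)) t = v (s, t)"
  by (simp add: curve.speed_eq v_def ddir_slice_t smooth_family)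

lemma v_pos: "v x > 0"
  using curve.speed_pos[of "fst x" "snd x"] by (simp add: speed_family)

lemma smooth_v: "smooth v"
  unfolding v_def using v_pos
  by (intro smooth_norm smooth_ddir smooth_family) (metis less_irrefl norm_zero v_def)

lemma smooth_T: "smooth T"
  unfolding T_def using v_pos
  by (intro smooth_scaleR smooth_inverse smooth_v smooth_ddir smooth_family) (metis less_irrefl)

lemma arc_family: "smooth F \<Longrightarrow> arc_deriv (\<lambda>t. \<Gamma> (s, t)) (\<lambda>t. F (s, t)) t = inverse (v (s, t)) *\<^sub>R Dt F (s, t)"
  by (simp add: curve.arc_eq smooth_slice speed_family ddir_slice_t)

lemma tangent_family: "tangent (\<lambda>t. \<Gamma> (s, t)) t = T (s, t)"
  by (simp add: tangent_def arc_family smooth_family T_def)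

lemma Y_family: "Y k (\<lambda>t. \<Gamma> (s, t)) = (\<lambda>t. Yf k (s, t))"
  by (simp add: Yf_def)

lemma Dt_Gamma: "Dt \<Gamma> x = v x *\<^sub>R T x"
  using v_pos[of x] by (simp add: T_def)

lemma Yf_0: "Yf 0 = T"
  by (auto simp: fun_eq_iff Yf_def Y.simps(1) tangent_family)

lemma smooth_Yf: "smooth (Yf k)"
proof (induction k rule: less_induct)
  case (less k)
  show ?case
  proof (cases k)
    case 0
    then show ?thesis by (simp add: Yf_0 smooth_T)
  next
    case (Suc n)
    have "Yf k x = cross3 (T x) (inverse (v x) *\<^sub>R Dt (Yf n) x)
        - ((1/2) * (\<Sum>i=1..n. Yf i x \<bullet> Yf (n - i + 1) x)) *\<^sub>R T x" for x
    proof (cases x)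
      case (Pair s t)
      show ?thesis
        unfolding Suc Yf_def[of "Suc n"] Y.simps(2) Pair fst_conv snd_conv
        by (subst (1 2 3) Y_family) (simp add: tangent_family arc_family less.IH Suc)
    qed
    then have Y_eq: "Yf k = (\<lambda>x. cross3 (T x) (inverse (v x) *\<^sub>R Dt (Yf n) x)
        - ((1/2) * (\<Sum>i=1..n. Yf i x \<bullet> Yf (n - i + 1) x)) *\<^sub>R T x)" by (rule ext)
    show ?thesis
      unfolding Y_eq using less Suc v_pos
      by (intro smooth_intros smooth_T smooth_v) (auto simp: less_imp_neq[symmetric] dest: less_imp_neq)
  qed
qed

lemma Dt_Yf: "Dt (Yf k) x = - (v x *\<^sub>R cross3 (T x) (Yf (Suc k) x))"
proof (cases x)
  case (Pair s t)
  have "inverse (v x) *\<^sub>R Dt (Yf k) x = - cross3 (T x) (Yf (Suc k) x)"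
    using curve.Y_transport[of s k t] by (simp add: Pair Y_family arc_family smooth_Yf tangent_family)
  then have "v x *\<^sub>R inverse (v x) *\<^sub>R Dt (Yf k) x = - (v x *\<^sub>R cross3 (T x) (Yf (Suc k) x))" by simp
  then show ?thesis using v_pos[of x] by simp
qed

lemma T_unit: "T x \<bullet> T x = 1"
  using curve.tangent_unit[of "fst x" "snd x"] by (simp add: tangent_family)

lemma T_deck: "T (s, \<tau> t) = A *v T (s, t)"
  using curve.tangent_deck[of s t] by (simp add: tangent_family)

lemma Yf_deck: "Yf k (s, \<tau> t) = A *v Yf k (s, t)"
  using curve.Y_deck[of k s t] by (simp add: Y_family)

lemma Ds_Gamma_deck: "Ds \<Gamma> (s, \<tau> t) = A *v Ds \<Gamma> (s, t)"
proof -
  have "((\<lambda>s. A *v \<Gamma> (s, t) + a) has_vector_derivative A *v Ds \<Gamma> (s, t)) (at s)"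
    by (simp add: has_vector_derivative_add_const curve.matrix_has_vector_derivative
        has_vector_derivative_slice_s smooth_family)
  moreover have "(\<lambda>s. A *v \<Gamma> (s, t) + a) = (\<lambda>s. \<Gamma> (s, \<tau> t))"
    using family_in_curve_space by (auto simp: curve_space_def)
  ultimately show ?thesis
    using has_vector_derivative_slice_s[OF smooth_family, of "\<tau> t" s] vector_derivative_unique_at by metis
qed

end

section \<open>Framed families and the first variation\<close>

locale framed_family = curve_family +
  fixes N :: "real \<times> real \<Rightarrow> real^3"
  assumes smooth_N: "smooth N"
    and normal: "\<And>s. unit_normal_field A \<tau> (\<lambda>t. \<Gamma> (s, t)) (\<lambda>t. N (s, t))"
begin

definition B :: "real \<times> real \<Rightarrow> real^3" where "B x = cross3 (T x) (N x)"

lemma smooth_B: "smooth B"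
  unfolding B_def by (intro smooth_cross3 smooth_T smooth_N)

lemma frame: "N x \<bullet> N x = 1" "T x \<bullet> N x = 0" "B x \<bullet> B x = 1" "T x \<bullet> B x = 0" "N x \<bullet> B x = 0"
proof -
  have n: "norm (N x) = 1" and o: "N x \<bullet> T x = 0"
    using normal[of "fst x"] by (auto simp: unit_normal_field_def tangent_family dest!: spec[of _ "snd x"])
  show 1: "N x \<bullet> N x = 1" "T x \<bullet> N x = 0" using n o by (auto simp: dot_square_norm inner_commute)
  show "B x \<bullet> B x = 1" by (simp add: B_def dot_cross 1 T_unit inner_commute[of "N x" "T x"])
  show "T x \<bullet> B x = 0" "N x \<bullet> B x = 0" by (simp_all add: B_def dot_cross_self)
qed

lemma frame_expansion:
  "u \<bullet> w = (u \<bullet> T x) * (w \<bullet> T x) + (u \<bullet> N x) * (w \<bullet> N x) + (u \<bullet> B x) * (w \<bullet> B x)"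
  unfolding B_def by (rule orthonormal_expansion[OF T_unit frame(1,2)])

lemma frame_expansion':
  "u \<bullet> w = (u \<bullet> T x) * (T x \<bullet> w) + (u \<bullet> N x) * (N x \<bullet> w) + (u \<bullet> B x) * (B x \<bullet> w)"
  by (subst frame_expansion[of _ _ x]) (simp add: inner_commute)

lemma frame_derivatives:
  "ddir u T x \<bullet> T x = 0" "ddir u N x \<bullet> N x = 0" "ddir u B x \<bullet> B x = 0"
  "ddir u N x \<bullet> T x = - (ddir u T x \<bullet> N x)"
  "ddir u B x \<bullet> T x = - (ddir u T x \<bullet> B x)"
  "ddir u B x \<bullet> N x = - (ddir u N x \<bullet> B x)"
proof -
  have *: "f x \<bullet> ddir u g x + ddir u f x \<bullet> g x = 0" if "smooth f" "smooth g" "\<And>x. f x \<bullet> g x = k" for f g :: "real \<times> real \<Rightarrow> real^3" and k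
    using ddir_inner[OF that(1,2), where v=u and x=x] by (simp add: that(3) ddir_const)
  show "ddir u T x \<bullet> T x = 0" using *[OF smooth_T smooth_T T_unit] by (simp add: inner_commute)
  show "ddir u N x \<bullet> N x = 0" using *[OF smooth_N smooth_N frame(1)] by (simp add: inner_commute)
  show "ddir u B x \<bullet> B x = 0" using *[OF smooth_B smooth_B frame(3)] by (simp add: inner_commute)
  show "ddir u N x \<bullet> T x = - (ddir u T x \<bullet> N x)" using *[OF smooth_T smooth_N frame(2)] by (simp add: inner_commute)
  show "ddir u B x \<bullet> T x = - (ddir u T x \<bullet> B x)" using *[OF smooth_T smooth_B frame(4)] by (simp add: inner_commute)
  show "ddir u B x \<bullet> N x = - (ddir u N x \<bullet> B x)" using *[OF smooth_N smooth_B frame(5)] by (simp add: inner_commute)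
qed

text \<open>In direction \<open>u\<close> the orthonormal frame \<open>(T, N, B)\<close> moves by \<open>T' = ca N + cb B\<close> and
  \<open>N' = - ca T + cc B\<close>.\<close>

definition "ca u x = ddir u T x \<bullet> N x"
definition "cb u x = ddir u T x \<bullet> B x"
definition "cc u x = ddir u N x \<bullet> B x"

lemma smooth_connection: "smooth (ca u)" "smooth (cb u)" "smooth (cc u)"
  unfolding ca_def cb_def cc_def by (intro smooth_inner smooth_ddir smooth_T smooth_N smooth_B)+

text \<open>The moving frame lives in a fixed Euclidean space, so its connection is flat. Each equation compares the
  two mixed derivatives of one pair of frame vectors.\<close>

lemma flatness:
  shows "Ds (ca (0,1)) x = Dt (ca (1,0)) x + cb (0,1) x * cc (1,0) x - cb (1,0) x * cc (0,1) x"
    and "Ds (cb (0,1)) x = Dt (cb (1,0)) x + ca (1,0) x * cc (0,1) x - ca (0,1) x * cc (1,0) x"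
    and "Ds (cc (0,1)) x = Dt (cc (1,0)) x + ca (0,1) x * cb (1,0) x - ca (1,0) x * cb (0,1) x"
proof -
  have *: "Ds (\<lambda>x. Dt f x \<bullet> g x) x = Dt (\<lambda>x. Ds f x \<bullet> g x) x + Dt f x \<bullet> Ds g x - Ds f x \<bullet> Dt g x"
    if "smooth f" "smooth g" for f g :: "real \<times> real \<Rightarrow> real^3"
    by (simp add: ddir_inner smooth_ddir that mixed_partials[OF that(1)])
  note e = frame_expansion[where x=x and u="Dt f x" and w="Ds g x" for f g]
      frame_expansion[where x=x and u="Ds f x" and w="Dt g x" for f g]
  show "Ds (ca (0,1)) x = Dt (ca (1,0)) x + cb (0,1) x * cc (1,0) x - cb (1,0) x * cc (0,1) x"
    using *[OF smooth_T smooth_N] by (simp add: ca_def[abs_def] cb_def cc_def e frame_derivatives)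
  show "Ds (cb (0,1)) x = Dt (cb (1,0)) x + ca (1,0) x * cc (0,1) x - ca (0,1) x * cc (1,0) x"
    using *[OF smooth_T smooth_B] by (simp add: cb_def[abs_def] ca_def cc_def e frame_derivatives)
  show "Ds (cc (0,1)) x = Dt (cc (1,0)) x + ca (0,1) x * cb (1,0) x - ca (1,0) x * cb (0,1) x"
    using *[OF smooth_N smooth_B] by (simp add: cc_def[abs_def] cb_def ca_def e frame_derivatives)
qed

text \<open>The components of the generating series of the fields \<open>Y k\<close> in the frame; \<open>q\<close> is
  \<open>1 / (1 + (T, Y))\<close>, half of the geometric series in the generating function of the Hamiltonians.\<close>

definition "y0 x = Abs_fps (\<lambda>k. T x \<bullet> Yf k x)"
definition "y1 x = Abs_fps (\<lambda>k. N x \<bullet> Yf k x)"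
definition "y2 x = Abs_fps (\<lambda>k. B x \<bullet> Yf k x)"
definition "q x = inverse (1 + y0 x)"

lemma fps_smooth_y: "fps_smooth y0" "fps_smooth y1" "fps_smooth y2"
  by (auto simp: fps_smooth_def y0_def y1_def y2_def intro!: smooth_inner smooth_T smooth_N smooth_B smooth_Yf)

lemma y_nth_0: "fps_nth (y0 x) 0 = 1" "fps_nth (y1 x) 0 = 0" "fps_nth (y2 x) 0 = 0"
  using frame[of x] by (simp_all add: y0_def y1_def y2_def Yf_0 T_unit inner_commute)

lemma q_eq: "q x * (1 + y0 x) = 1"
  unfolding q_def by (rule inverse_mult_eq_1) (simp add: y_nth_0)

lemma fps_smooth_q: "fps_smooth q"
  unfolding q_def by (intro fps_smooth_inverse fps_smooth_add fps_smooth_const fps_smooth_y) (simp add: y_nth_0)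

lemma y_unit: "y0 x * y0 x + y1 x * y1 x + y2 x * y2 x = 1"
proof (rule fps_ext)
  fix n
  have Yf: "Yf i x \<bullet> Yf j x = (T x \<bullet> Yf i x) * (T x \<bullet> Yf j x) + (N x \<bullet> Yf i x) * (N x \<bullet> Yf j x)
      + (B x \<bullet> Yf i x) * (B x \<bullet> Yf j x)" for i j
    by (subst frame_expansion[of _ _ x]) (simp add: inner_commute)
  have "fps_nth (y0 x * y0 x + y1 x * y1 x + y2 x * y2 x) n = (\<Sum>i\<le>n. Yf i x \<bullet> Yf (n - i) x)"
    by (simp add: fps_mult_nth y0_def y1_def y2_def sum.distrib[symmetric] atMost_atLeast0
      Yf)
  also have "\<dots> = (if n = 0 then 1 else 0)"
    using curve.Y_formal_unit[where k=n and s="fst x" and t="snd x"] by (simp add: Yf_def)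
  finally show "fps_nth (y0 x * y0 x + y1 x * y1 x + y2 x * y2 x) n = fps_nth 1 n" by simp
qed

abbreviation "fc f x \<equiv> fps_const (f x)"

text \<open>\<open>X\<close> times the \<open>(N, B)\<close>-coefficient of the connection \<open>d/dt + \<lambda> \<Gamma>' \<times>\<close>, where \<open>\<lambda> = 1 / X\<close>.\<close>

definition "m x = fps_X * fc (cc (0,1)) x + fc v x"

text \<open>The parallelism of the generating series, read in the frame and multiplied by \<open>X\<close> to clear the
  spectral parameter.\<close>

lemma y_transport:
  shows "fps_X * fps_ddir (0,1) y0 x = fps_X * (fc (ca (0,1)) x * y1 x + fc (cb (0,1)) x * y2 x)"
    and "fps_X * fps_ddir (0,1) y1 x = m x * y2 x - fps_X * fc (ca (0,1)) x * y0 x"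
    and "fps_X * fps_ddir (0,1) y2 x = - (fps_X * fc (cb (0,1)) x * y0 x) - m x * y1 x"
proof -
  have c: "u \<bullet> cross3 w z = z \<bullet> cross3 u w" for u w z
    by (simp add: cross3_simps)
  have D: "Dt (\<lambda>x. f x \<bullet> Yf k x) x = Dt f x \<bullet> Yf k x - v x * (cross3 (f x) (T x) \<bullet> Yf (Suc k) x)"
    if "smooth f" for f k
    using ddir_inner[OF that smooth_Yf, where v="(0,1)" and x=x] c[of "f x" "T x"]
    by (simp add: Dt_Yf inner_commute)
  have TN: "cross3 (N x) (T x) = - B x" by (simp add: B_def cross_skew[of "N x"])
  have TB: "cross3 (B x) (T x) = N x"
    using frame[of x] T_unit[of x] by (simp add: B_def cross_skew[of _ "T x"] Lagrange)
  note e = frame_expansion'[where x=x and u="Dt f x" and w="Yf k x" for f k]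
  have z: "B x \<bullet> Yf 0 x = 0" "N x \<bullet> Yf 0 x = 0"
    using frame[of x] by (simp_all add: Yf_0 inner_commute)
  have X: "fps_nth (fps_X * F) n = (case n of 0 \<Rightarrow> 0 | Suc k \<Rightarrow> fps_nth F k)" for F :: "real fps" and n
    by (cases n) auto
  show "fps_X * fps_ddir (0,1) y0 x = fps_X * (fc (ca (0,1)) x * y1 x + fc (cb (0,1)) x * y2 x)"
    by (rule fps_ext) (simp add: X fps_ddir_nth y0_def y1_def y2_def D smooth_T e frame_derivatives
        ca_def cb_def cc_def split: nat.split)
  show "fps_X * fps_ddir (0,1) y1 x = m x * y2 x - fps_X * fc (ca (0,1)) x * y0 x"
    by (rule fps_ext) (simp add: m_def distrib_right mult.assoc X y_nth_0 fps_ddir_nth y0_def y1_def y2_def D smooth_N e frame_derivatives TN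
        ca_def cb_def cc_def z split: nat.split)
  show "fps_X * fps_ddir (0,1) y2 x = - (fps_X * fc (cb (0,1)) x * y0 x) - m x * y1 x"
    by (rule fps_ext) (simp add: m_def distrib_right mult.assoc X y_nth_0 fps_ddir_nth y0_def y1_def y2_def D smooth_B e frame_derivatives TB
        ca_def cb_def cc_def z split: nat.split)
qed

lemma smooth_rates: "fps_smooth m" "fps_smooth (fc (ca u))" "fps_smooth (fc (cb u))" "fps_smooth (fc (cc u))" "fps_smooth (fc v)"
  unfolding m_def
  by (intro fps_smooth_add fps_smooth_mult fps_smooth_const fps_smooth_fps_const smooth_connection smooth_v)+

text \<open>\<open>X\<close> times the rate of rotation, with respect to the connection \<open>d/dt + \<lambda> \<Gamma>' \<times>\<close>, of the frame
  of the normal plane of \<open>Y\<close> that arises from \<open>(N, B)\<close> by the smallest rotation taking \<open>T\<close> to \<open>Y\<close>. The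
  integral of its \<open>k\<close>-th coefficient is the Hamiltonian with index \<open>k + 1\<close>, modulo \<open>2 * pi\<close> if \<open>k = 1\<close>.\<close>

definition "G x = m x + fps_X * ((fc (ca (0,1)) x * y2 x - fc (cb (0,1)) x * y1 x) * q x)"

definition "p0 = fps_ddir (1,0) y0"
definition "p1 = fps_ddir (1,0) y1"
definition "p2 = fps_ddir (1,0) y2"

text \<open>Boundary terms of the variation: \<open>H\<close> comes from turning \<open>T\<close> into \<open>Y\<close>, and \<open>K\<close> is the pairing of \<open>Y\<close> with
  the motion of the frame in direction \<open>s\<close>. Their sum is the rate of rotation of the turned frame in
  direction \<open>s\<close>.\<close>

definition "H x = (y2 x * p1 x - y1 x * p2 x) * q x"
definition "K x = fc (cc (1,0)) x * y0 x + fc (ca (1,0)) x * y2 x - fc (cb (1,0)) x * y1 x"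

lemma fps_smooth_p: "fps_smooth p0" "fps_smooth p1" "fps_smooth p2"
  unfolding p0_def p1_def p2_def by (intro fps_smooth_ddir fps_smooth_y)+

lemma fps_smooth_HK: "fps_smooth H" "fps_smooth K" "fps_smooth G"
  unfolding H_def K_def G_def
  by (intro fps_smooth_add fps_smooth_diff fps_smooth_mult fps_smooth_const fps_smooth_q fps_smooth_y fps_smooth_p smooth_rates)+

lemmas fps_smooth_rules = fps_smooth_add fps_smooth_diff fps_smooth_mult fps_smooth_const fps_smooth_q
  fps_smooth_y fps_smooth_p smooth_rates fps_smooth_ddir

lemma fps_ddir_q: "fps_ddir u q x = - (q x * q x * fps_ddir u y0 x)"
proof -
  have "fps_ddir u (\<lambda>x. q x * (1 + y0 x)) x = 0"
    by (simp add: q_eq fps_ddir_const)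
  then have "q x * fps_ddir u y0 x + fps_ddir u q x * (1 + y0 x) = 0"
    by (simp add: fps_ddir_mult fps_ddir_add fps_smooth_rules fps_ddir_const)
  then have "q x * (q x * fps_ddir u y0 x + fps_ddir u q x * (1 + y0 x)) = 0" by simp
  then have "q x * q x * fps_ddir u y0 x + fps_ddir u q x * (q x * (1 + y0 x)) = 0"
    by (simp add: algebra_simps)
  then show ?thesis by (simp add: q_eq eq_neg_iff_add_eq_0 add.commute)
qed

lemma p_orth: "y0 x * p0 x + y1 x * p1 x + y2 x * p2 x = 0"
proof -
  have "fps_ddir (1,0) (\<lambda>x. y0 x * y0 x + y1 x * y1 x + y2 x * y2 x) x = 0"
    by (simp add: y_unit fps_ddir_const)
  then have "2 * (y0 x * p0 x + y1 x * p1 x + y2 x * p2 x) = 0"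
    by (simp add: fps_ddir_mult fps_ddir_add fps_smooth_rules p0_def p1_def p2_def algebra_simps)
  then show ?thesis by (metis mult_eq_0_iff zero_neq_numeral)
qed

lemma p_transport:
  shows "fps_X * fps_ddir (0,1) p1 x = fps_ddir (1,0) m x * y2 x + m x * p2 x
      - fps_X * (fc (Ds (ca (0,1))) x * y0 x + fc (ca (0,1)) x * p0 x)"
    and "fps_X * fps_ddir (0,1) p2 x = - (fps_X * (fc (Ds (cb (0,1))) x * y0 x + fc (cb (0,1)) x * p0 x))
      - (fps_ddir (1,0) m x * y1 x + m x * p1 x)"
proof -
  have X: "fps_ddir (1,0) (\<lambda>x. fps_X * F x) x = fps_X * fps_ddir (1,0) F x" if "fps_smooth F" for F
    by (simp add: fps_ddir_mult fps_smooth_const that fps_ddir_const)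
  have "fps_X * fps_ddir (0,1) p1 x = fps_ddir (1,0) (\<lambda>x. fps_X * fps_ddir (0,1) y1 x) x"
    by (simp add: X fps_smooth_rules p1_def fps_ddir_commute)
  also have "\<dots> = fps_ddir (1,0) (\<lambda>x. m x * y2 x - fps_X * fc (ca (0,1)) x * y0 x) x"
    by (simp only: y_transport)
  also have "\<dots> = fps_ddir (1,0) m x * y2 x + m x * p2 x
      - fps_X * (fc (Ds (ca (0,1))) x * y0 x + fc (ca (0,1)) x * p0 x)"
    by (simp add: mult.assoc fps_ddir_diff X fps_ddir_mult fps_smooth_rules fps_ddir_fps_const fps_ddir_const p0_def p2_def algebra_simps)
  finally show "fps_X * fps_ddir (0,1) p1 x = \<dots>" .
  have "fps_X * fps_ddir (0,1) p2 x = fps_ddir (1,0) (\<lambda>x. fps_X * fps_ddir (0,1) y2 x) x"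
    by (simp add: X fps_smooth_rules p2_def fps_ddir_commute)
  also have "\<dots> = fps_ddir (1,0) (\<lambda>x. (0 - fps_X * (fc (cb (0,1)) x * y0 x)) - m x * y1 x) x"
    by (simp add: y_transport mult.assoc)
  also have "\<dots> = - (fps_X * (fc (Ds (cb (0,1))) x * y0 x + fc (cb (0,1)) x * p0 x))
      - (fps_ddir (1,0) m x * y1 x + m x * p1 x)"
    by (simp only: mult.assoc fps_ddir_diff X fps_ddir_mult fps_smooth_rules fps_ddir_fps_const fps_ddir_const p0_def p1_def)
      (simp add: algebra_simps)
  finally show "fps_X * fps_ddir (0,1) p2 x = \<dots>" .
qed

lemma variation_of_G:
  "fps_ddir (1,0) G x = fps_X * fps_ddir (0,1) H x + fps_ddir (1,0) m x * y0 x
     + fps_X * fc (Ds (ca (0,1))) x * y2 x - fps_X * fc (Ds (cb (0,1))) x * y1 x"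
proof -
  have G: "fps_ddir (1,0) G x = fps_X * ((fc (ca (0,1)) x * p2 x + fc (Ds (ca (0,1))) x * y2 x
      - (fc (cb (0,1)) x * p1 x + fc (Ds (cb (0,1))) x * y1 x)) * q x
      - (fc (ca (0,1)) x * y2 x - fc (cb (0,1)) x * y1 x) * (q x * q x * p0 x)) + fps_ddir (1,0) m x"
    unfolding G_def[abs_def]
    by (simp add: fps_ddir_add fps_ddir_diff fps_ddir_mult fps_smooth_rules fps_ddir_const fps_ddir_fps_const
      fps_ddir_q p0_def p1_def p2_def)
  have H: "fps_ddir (0,1) H x = (fps_ddir (0,1) y2 x * p1 x + y2 x * fps_ddir (0,1) p1 x
        - (fps_ddir (0,1) y1 x * p2 x + y1 x * fps_ddir (0,1) p2 x)) * q x
        - (y2 x * p1 x - y1 x * p2 x) * (q x * q x * fps_ddir (0,1) y0 x)"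
    unfolding H_def[abs_def]
    by (simp add: fps_ddir_diff fps_ddir_mult fps_smooth_rules fps_ddir_q)
  show ?thesis
    unfolding G H
    by (rule rotating_frame_identity[OF q_eq y_unit p_orth y_transport p_transport])
qed

definition "W x = Abs_fps (\<lambda>k. Dt (Ds \<Gamma>) x \<bullet> Yf k x)"

text \<open>Varying the curve changes the connection \<open>d/dt + \<lambda> \<Gamma>' \<times>\<close> only through \<open>\<Gamma>'\<close>, because the frame itself
  is flat. Hence the pairing of the varied connection coefficients with \<open>Y\<close> is, up to a \<open>t\<close>-derivative,
  the pairing of \<open>Y\<close> with the derivative of the variation field.\<close>

lemma curvature_term:
  "fps_ddir (1,0) m x * y0 x + fps_X * fc (Ds (ca (0,1))) x * y2 x - fps_X * fc (Ds (cb (0,1))) x * y1 x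
    = fps_X * fps_ddir (0,1) K x + W x"
proof -
  have W: "W x = fc (Ds v) x * y0 x + fc v x * (fc (ca (1,0)) x * y1 x + fc (cb (1,0)) x * y2 x)"
  proof (rule fps_ext)
    fix k
    have "Dt (Ds \<Gamma>) x = Ds (\<lambda>x. v x *\<^sub>R T x) x"
      using mixed_partials[OF smooth_family] Dt_Gamma by presburger
    also have "\<dots> = v x *\<^sub>R Ds T x + Ds v x *\<^sub>R T x"
      by (rule ddir_scaleR[OF smooth_v smooth_T])
    finally show "fps_nth (W x) k = fps_nth (fc (Ds v) x * y0 x + fc v x * (fc (ca (1,0)) x * y1 x + fc (cb (1,0)) x * y2 x)) k"
      by (simp add: W_def y0_def y1_def y2_def inner_add_left frame_expansion'[where x=x and u="Ds T x" and w="Yf k x"]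
        frame_derivatives ca_def cb_def algebra_simps)
  qed
  have m: "fps_ddir (1,0) m x = fps_X * fc (Ds (cc (0,1))) x + fc (Ds v) x"
    unfolding m_def[abs_def]
    by (simp add: fps_ddir_add fps_ddir_mult fps_smooth_rules fps_ddir_const fps_ddir_fps_const)
  have "fps_X * fps_ddir (0,1) K x
      = fc (cc (1,0)) x * (fps_X * fps_ddir (0,1) y0 x) + fc (ca (1,0)) x * (fps_X * fps_ddir (0,1) y2 x)
      - fc (cb (1,0)) x * (fps_X * fps_ddir (0,1) y1 x)
      + fps_X * (fc (Dt (cc (1,0))) x * y0 x + fc (Dt (ca (1,0))) x * y2 x - fc (Dt (cb (1,0))) x * y1 x)"
    unfolding K_def[abs_def]
    by (simp add: fps_ddir_add fps_ddir_diff fps_ddir_mult fps_smooth_rules fps_ddir_fps_const algebra_simps)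
  then show ?thesis
    unfolding W m y_transport flatness m_def
    by (simp add: algebra_simps flip: fps_const_mult fps_const_add fps_const_sub)
qed

text \<open>A final integration by parts moves the \<open>t\<close>-derivative from the variation field \<open>Ds \<Gamma>\<close> to \<open>Y k\<close>, and the
  transport equation turns it into \<open>Y (Suc k)\<close>. This is where the index shift between the coefficient
  and the field comes from.\<close>

lemma variation_of_density:
  "Ds (\<lambda>x. fps_nth (G x) k) (s, t) =
     Dt (\<lambda>x. fps_nth (fps_X * (H x + K x)) k + Ds \<Gamma> x \<bullet> Yf k x) (s, t)
     + det3 (T (s, t)) (Yf (Suc k) (s, t)) (Ds \<Gamma> (s, t)) * v (s, t)"
proof -
  let ?x = "(s, t)"
  have "fps_ddir (1,0) G ?x = fps_X * (fps_ddir (0,1) H ?x + fps_ddir (0,1) K ?x) + W ?x"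
    using variation_of_G[of ?x] curvature_term[of ?x] by (simp add: algebra_simps)
  also have "fps_X * (fps_ddir (0,1) H ?x + fps_ddir (0,1) K ?x) = fps_ddir (0,1) (\<lambda>x. fps_X * (H x + K x)) ?x"
    by (simp add: fps_ddir_mult fps_ddir_add fps_ddir_const fps_smooth_rules fps_smooth_HK)
  finally have eq: "fps_ddir (1,0) G ?x = fps_ddir (0,1) (\<lambda>x. fps_X * (H x + K x)) ?x + W ?x" .
  have 1: "Ds (\<lambda>x. fps_nth (G x) k) ?x
      = Dt (\<lambda>x. fps_nth (fps_X * (H x + K x)) k) ?x + Dt (Ds \<Gamma>) ?x \<bullet> Yf k ?x"
    using arg_cong[OF eq, of "\<lambda>F. fps_nth F k"] unfolding W_def fps_ddir_nth fps_add_nth fps_nth_Abs_fps .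
  have "Dt (\<lambda>x. Ds \<Gamma> x \<bullet> Yf k x) ?x = Dt (Ds \<Gamma>) ?x \<bullet> Yf k ?x
      - v ?x * (Ds \<Gamma> ?x \<bullet> cross3 (T ?x) (Yf (Suc k) ?x))"
    by (simp add: ddir_inner smooth_ddir smooth_family smooth_Yf Dt_Yf)
  moreover have "Ds \<Gamma> ?x \<bullet> cross3 (T ?x) (Yf (Suc k) ?x) = det3 (T ?x) (Yf (Suc k) ?x) (Ds \<Gamma> ?x)"
    by (simp add: det3_def dot_cross_det[symmetric]) (metis cross_triple inner_commute)
  moreover have "smooth (\<lambda>x. fps_nth (fps_X * (H x + K x)) k)"
    by (intro fps_smooth_nth fps_smooth_rules fps_smooth_HK)
  ultimately show ?thesis
    using 1 by (simp add: ddir_add smooth_inner smooth_ddir smooth_family smooth_Yf)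
qed

lemma ddir_deck_invariant:
  fixes F :: "real \<times> real \<Rightarrow> 'b::real_normed_vector"
  assumes "smooth F" "\<And>s. F (s, t') = F (s, t)"
  shows "Ds F (s, t') = Ds F (s, t)"
  using has_vector_derivative_slice_s[OF assms(1), of t' s] has_vector_derivative_slice_s[OF assms(1), of t s]
  by (simp add: assms(2) vector_derivative_unique_at)

lemma N_deck: "N (s, \<tau> t) = A *v N (s, t)"
  using normal[of s] by (simp add: unit_normal_field_def)

lemma B_deck: "B (s, \<tau> t) = A *v B (s, t)"
  by (simp add: B_def N_deck T_deck cross_rotation_matrix[OF rot])

lemma Ds_deck: 
  fixes F :: "real \<times> real \<Rightarrow> real^3"
  assumes "smooth F" "\<And>s. F (s, \<tau> t) = A *v F (s, t)"
  shows "Ds F (s, \<tau> t) = A *v Ds F (s, t)"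
  using has_vector_derivative_slice_s[OF assms(1), of "\<tau> t" s]
    curve.matrix_has_vector_derivative[OF has_vector_derivative_slice_s[OF assms(1), of t s]]
  by (simp add: assms(2) vector_derivative_unique_at)

text \<open>The boundary terms are built from inner products of equivariant vectors, so they agree at the two ends
  of a fundamental domain.\<close>

lemma HK_deck: "H (s, \<tau> t) = H (s, t)" "K (s, \<tau> t) = K (s, t)"
proof -
  have y: "y0 (s, \<tau> t) = y0 (s, t)" "y1 (s, \<tau> t) = y1 (s, t)" "y2 (s, \<tau> t) = y2 (s, t)" for s
    by (simp_all add: y0_def y1_def y2_def T_deck N_deck B_deck Yf_deck rotation_inner[OF rot])
  have p: "p1 (s, \<tau> t) = p1 (s, t)" "p2 (s, \<tau> t) = p2 (s, t)"
    unfolding p1_def p2_def fps_ddir_def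
    by (rule arg_cong[where f=Abs_fps], rule ext, rule ddir_deck_invariant; simp add: y fps_smooth_nth fps_smooth_y)+
  show "H (s, \<tau> t) = H (s, t)"
    by (simp add: H_def q_def y p)
  have "Ds T (s, \<tau> t) = A *v Ds T (s, t)" "Ds N (s, \<tau> t) = A *v Ds N (s, t)"
    by (simp_all add: Ds_deck smooth_T smooth_N T_deck N_deck)
  then show "K (s, \<tau> t) = K (s, t)"
    by (simp add: K_def y ca_def cb_def cc_def N_deck B_deck rotation_inner[OF rot])
qed

lemma integral_variation:
  fixes t0 :: real
  defines "I \<equiv> fundamental_domain \<tau> t0"
  shows "((\<lambda>s. integral I (\<lambda>t. fps_nth (G (s, t)) k)) has_real_derivative
    MW_form I (\<lambda>t. \<Gamma> (s, t)) (Y (Suc k) (\<lambda>t. \<Gamma> (s, t))) (\<lambda>t. Ds \<Gamma> (s, t))) (at s)"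
proof -
  let ?J = "closed_segment t0 (\<tau> t0)"
  let ?F = "\<lambda>x. fps_nth (fps_X * (H x + K x)) k + Ds \<Gamma> x \<bullet> Yf k x"
  have I: "I = ?J" by (simp add: I_def fundamental_domain_def)
  have F: "smooth ?F"
    by (intro smooth_add smooth_inner smooth_ddir smooth_family smooth_Yf fps_smooth_nth fps_smooth_rules fps_smooth_HK)
  have G: "smooth (\<lambda>x. fps_nth (G x) k)" by (intro fps_smooth_nth fps_smooth_HK)
  have "?F (s, \<tau> t0) = ?F (s, t0)"
    by (simp add: HK_deck Ds_Gamma_deck Yf_deck rotation_inner[OF rot])
  then have zero: "integral ?J (\<lambda>t. Dt ?F (s, t)) = 0"
    by (intro integral_derivative_eq_0[of "\<lambda>t. ?F (s, t)"] has_vector_derivative_slice_t F) simp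
  have cont: "continuous_on ?J (\<lambda>t. Dt ?F (s, t))" "continuous_on ?J (\<lambda>t. Ds (\<lambda>x. fps_nth (G x) k) (s, t))"
    by (rule smooth_continuous[OF smooth_slice[OF smooth_ddir[OF F]]],
        rule smooth_continuous[OF smooth_slice[OF smooth_ddir[OF G]]])
  have int: "h integrable_on ?J" if "continuous_on ?J h" for h :: "real \<Rightarrow> real"
    using that by (auto simp: closed_segment_eq_real_ivl intro: integrable_continuous_interval split: if_splits)
  have MW: "MW_form I (\<lambda>t. \<Gamma> (s, t)) (Y (Suc k) (\<lambda>t. \<Gamma> (s, t))) (\<lambda>t. Ds \<Gamma> (s, t))
      = integral ?J (\<lambda>t. Ds (\<lambda>x. fps_nth (G x) k) (s, t) - Dt ?F (s, t))"
    unfolding MW_form_def arc_integral_def I variation_of_density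
    by (simp add: tangent_family speed_family Y_family)
  show ?thesis
    using has_real_derivative_integral_parameter[OF G, of t0 "\<tau> t0" s]
    unfolding MW integral_diff[OF int[OF cont(2)] int[OF cont(1)]] zero by (simp add: I)
qed

end

section \<open>The Hamiltonians as coefficients of the frame density\<close>

text \<open>The partial sums differ from the limit by multiples of \<open>w ^ n\<close>, whose coefficients below \<open>n\<close> vanish.\<close>

lemma fps_geometric_suminf:
  fixes P w :: "real fps"
  assumes w: "fps_nth w 0 = 0"
  shows "(\<Sum>j. P * (- 1) ^ j * w ^ j) = P * inverse (1 + w)"
proof -
  have inv: "(1 + w) * inverse (1 + w) = 1"
    by (rule inverse_mult_eq_1') (simp add: w)
  have partial: "(\<Sum>j<n. P * (- 1) ^ j * w ^ j) = P * inverse (1 + w) - P * inverse (1 + w) * (- w) ^ n" for n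
  proof -
    have "(\<Sum>j<n. P * (- 1) ^ j * w ^ j) = P * (\<Sum>j<n. (- w) ^ j)"
      by (simp add: sum_distrib_left power_minus[of w] mult.assoc)
    also have "(\<Sum>j<n. (- w) ^ j) = (1 - (- w) ^ n) * inverse (1 + w)"
    proof -
      have "(1 - (- w) ^ n) = (1 + w) * (\<Sum>j<n. (- w) ^ j)"
        using one_diff_power_eq[of "- w" n] by simp
      then have "(1 - (- w) ^ n) * inverse (1 + w) = (\<Sum>j<n. (- w) ^ j) * ((1 + w) * inverse (1 + w))"
        by (simp only: mult_ac)
      then show ?thesis by (simp add: inv)
    qed
    finally show ?thesis by (simp add: algebra_simps)
  qed
  have "(\<lambda>n. \<Sum>j<n. P * (- 1) ^ j * w ^ j) \<longlonglongrightarrow> P * inverse (1 + w)"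
  proof (rule tendsto_fpsI)
    fix k
    show "eventually (\<lambda>n. fps_nth (\<Sum>j<n. P * (- 1) ^ j * w ^ j) k = fps_nth (P * inverse (1 + w)) k) sequentially"
    proof (rule eventually_sequentiallyI[of "Suc k"])
      fix n assume "Suc k \<le> n"
      then have "fps_nth ((- w) ^ n) i = 0" if "i \<le> k" for i
        using startsby_zero_power_prefix[of "- w"] that by (simp add: w)
      then have "fps_nth (P * inverse (1 + w) * (- w) ^ n) k = 0"
        by (simp add: fps_mult_nth[of _ "(-w) ^ n"])
      then show "fps_nth (\<Sum>j<n. P * (- 1) ^ j * w ^ j) k = fps_nth (P * inverse (1 + w)) k"
        by (simp add: partial)
    qed
  qed
  then have "(\<lambda>j. P * (- 1) ^ j * w ^ j) sums (P * inverse (1 + w))"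
    unfolding sums_def .
  then show ?thesis by (rule sums_unique[symmetric])
qed

lemma fps_nth_double: "fps_nth (2 * F) n = 2 * fps_nth F n" for F :: "real fps"
  by (simp only: mult_2 fps_add_nth)

definition energy_numerator :: "(real \<Rightarrow> real^3) \<Rightarrow> real \<Rightarrow> real fps" where
  "energy_numerator \<gamma> t = Abs_fps (\<lambda>i. if i \<ge> 1 then Y i \<gamma> t \<bullet> Y 1 \<gamma> t else 0)"

definition energy_denominator :: "(real \<Rightarrow> real^3) \<Rightarrow> real \<Rightarrow> real fps" where
  "energy_denominator \<gamma> t = 1 + Abs_fps (\<lambda>l. if l \<ge> 2 then 1/2 * (tangent \<gamma> t \<bullet> Y l \<gamma> t) else 0)"

lemma hamiltonian_density_eq:
  "hamiltonian_density \<gamma> t = energy_numerator \<gamma> t * inverse (energy_denominator \<gamma> t)"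
  unfolding hamiltonian_density_def energy_numerator_def energy_denominator_def
  by (rule fps_geometric_suminf) simp

lemma hamiltonian_density_nth_0: "fps_nth (hamiltonian_density \<gamma> t) 0 = 0"
  by (simp add: hamiltonian_density_eq energy_numerator_def)

lemma hamiltonian_nth:
  "hamiltonian A \<tau> t0 0 \<gamma> = 0"
  "hamiltonian A \<tau> t0 (Suc 0) \<gamma> = curve_length (fundamental_domain \<tau> t0) \<gamma>"
  "hamiltonian A \<tau> t0 (Suc (Suc 0)) \<gamma> = total_torsion A \<tau> t0 \<gamma>"
  "hamiltonian A \<tau> t0 (Suc (Suc (Suc k))) \<gamma>
     = 1/2 * arc_integral (fundamental_domain \<tau> t0) \<gamma> (\<lambda>t. fps_nth (hamiltonian_density \<gamma> t) (Suc k))"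
  by (simp_all add: hamiltonian_def hamiltonian_series_def arc_integral_fps_def hamiltonian_density_nth_0
      arc_integral_def fps_X_power_mult_nth mult.assoc)

context framed_family
begin

text \<open>Since \<open>Y 1 = T \<times> T'\<close>, it is \<open>T'\<close> turned by a right angle in the normal plane.\<close>

lemma Y1_frame: "v x * (Yf i x \<bullet> Yf 1 x) = ca (0,1) x * (B x \<bullet> Yf i x) - cb (0,1) x * (N x \<bullet> Yf i x)"
proof -
  obtain s t where x: "x = (s, t)" by (cases x)
  have "Yf 1 x = cross3 (T x) (inverse (v x) *\<^sub>R Dt T x)"
    unfolding x One_nat_def Yf_def[of "Suc 0"] Y.simps(2)
    by (simp add: Y_family Yf_0 arc_family smooth_T tangent_family)
  then have Y1: "v x *\<^sub>R Yf 1 x = cross3 (T x) (Dt T x)"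
    using v_pos[of x] by (simp add: cross_mult_right)
  have "cross3 (T x) (Dt T x) \<bullet> T x = 0" by (simp add: dot_cross_self)
  moreover have "cross3 (T x) (Dt T x) \<bullet> B x = ca (0,1) x"
    by (simp add: B_def ca_def dot_cross T_unit frame)
  moreover have "cross3 (T x) (Dt T x) \<bullet> N x = - cb (0,1) x"
  proof -
    have "cross3 u w \<bullet> n = - (w \<bullet> cross3 u n)" for u w n :: "real^3"
      by (simp add: cross3_simps)
    then show ?thesis by (simp add: B_def cb_def)
  qed
  ultimately have "cross3 (T x) (Dt T x) \<bullet> Yf i x = ca (0,1) x * (B x \<bullet> Yf i x) - cb (0,1) x * (N x \<bullet> Yf i x)"
    by (subst frame_expansion'[of _ _ x]) simp
  moreover have "v x * (Yf i x \<bullet> Yf 1 x) = (v x *\<^sub>R Yf 1 x) \<bullet> Yf i x"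
    by (simp add: inner_commute)
  ultimately show ?thesis by (simp only: Y1)
qed

text \<open>The factor \<open>2\<close> appears because \<open>1 + y0\<close> is twice \<open>energy_denominator\<close>; it cancels the factor \<open>1/2\<close> in
  front of the integral in the generating function.\<close>

lemma density_frame:
  "fps_const (v (s, t)) * hamiltonian_density (\<lambda>t. \<Gamma> (s, t)) t
     = 2 * ((fc (ca (0,1)) (s, t) * y2 (s, t) - fc (cb (0,1)) (s, t) * y1 (s, t)) * q (s, t))"
proof -
  let ?x = "(s, t)"
  have "fps_const (v ?x) * energy_numerator (\<lambda>t. \<Gamma> (s, t)) t = fc (ca (0,1)) ?x * y2 ?x - fc (cb (0,1)) ?x * y1 ?x"
  proof (rule fps_ext)
    fix n show "fps_nth (fps_const (v ?x) * energy_numerator (\<lambda>t. \<Gamma> (s, t)) t) n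
        = fps_nth (fc (ca (0,1)) ?x * y2 ?x - fc (cb (0,1)) ?x * y1 ?x) n"
      using Y1_frame[of ?x n] y_nth_0[of ?x]
      by (cases n) (auto simp: energy_numerator_def Y_family y1_def y2_def)
  qed
  moreover have "inverse (energy_denominator (\<lambda>t. \<Gamma> (s, t)) t) = 2 * q ?x"
  proof (rule fps_inverse_unique)
    have "T ?x \<bullet> Yf (Suc 0) ?x = 0"
      unfolding Yf_def[of "Suc 0"] Y.simps(2) by (simp add: dot_cross_self tangent_family)
    then have "2 * energy_denominator (\<lambda>t. \<Gamma> (s, t)) t = 1 + y0 ?x"
    proof (intro fps_ext)
      fix n :: nat
      assume Y1: "T ?x \<bullet> Yf (Suc 0) ?x = 0"
      consider "n = 0" | "n = 1" | "(2::nat) \<le> n" by linarith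
      then show "fps_nth (2 * energy_denominator (\<lambda>t. \<Gamma> (s, t)) t) n = fps_nth (1 + y0 ?x) n"
        unfolding fps_nth_double
        by cases (simp_all add: energy_denominator_def Y_family tangent_family y_nth_0, simp_all add: y0_def Y1)
    qed
    moreover have "energy_denominator (\<lambda>t. \<Gamma> (s, t)) t * (2 * q ?x)
        = q ?x * (2 * energy_denominator (\<lambda>t. \<Gamma> (s, t)) t)"
      by (simp only: mult_ac)
    ultimately show "energy_denominator (\<lambda>t. \<Gamma> (s, t)) t * (2 * q ?x) = 1"
      using q_eq[of ?x] by simp
  qed
  ultimately show ?thesis
    by (simp add: hamiltonian_density_eq mult.assoc[symmetric])
qed

text \<open>The coefficient \<open>1\<close> is excluded because it is the torsion density of the particular normal field \<open>N\<close>, while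
  the second Hamiltonian is defined by a choice of normal field that is unrelated to \<open>N\<close>.\<close>

lemma hamiltonian_eq_integral_G:
  assumes "k \<noteq> 1"
  shows "hamiltonian A \<tau> t0 (Suc k) (\<lambda>t. \<Gamma> (s, t))
    = integral (fundamental_domain \<tau> t0) (\<lambda>t. fps_nth (G (s, t)) k)"
proof -
  consider "k = 0" | n where "k = Suc (Suc n)" using assms by (metis One_nat_def not0_implies_Suc)
  then show ?thesis
  proof cases
    case 1
    then show ?thesis
      by (simp add: hamiltonian_nth curve_length_def arc_integral_def speed_family G_def m_def)
  next
    case 2
    have "1/2 * (fps_nth (hamiltonian_density (\<lambda>t. \<Gamma> (s, t)) t) (Suc n) * v (s, t)) = fps_nth (G (s, t)) k" for t
    proof -
      have "v (s, t) * fps_nth (hamiltonian_density (\<lambda>t. \<Gamma> (s, t)) t) (Suc n)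
        = fps_nth (2 * ((fc (ca (0,1)) (s, t) * y2 (s, t) - fc (cb (0,1)) (s, t) * y1 (s, t)) * q (s, t))) (Suc n)"
        by (simp add: density_frame[symmetric])
      also have "\<dots> = 2 * fps_nth (G (s, t)) k"
        unfolding fps_nth_double by (simp add: G_def m_def 2)
      finally show ?thesis by (simp add: mult.commute)
    qed
    then show ?thesis
      unfolding 2 hamiltonian_nth arc_integral_def speed_family 
      by (simp flip: 2 integral_mult_right) 
  qed
qed

lemma torsion_eq_integral_G:
  "torsion_integral (fundamental_domain \<tau> t0) (\<lambda>t. \<Gamma> (s, t)) (\<lambda>t. N (s, t))
    = integral (fundamental_domain \<tau> t0) (\<lambda>t. fps_nth (G (s, t)) 1)"
proof -
  have "arc_deriv (\<lambda>t. \<Gamma> (s, t)) (\<lambda>t. N (s, t)) t \<bullet> cross3 (T (s, t)) (N (s, t)) * v (s, t)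
      = fps_nth (G (s, t)) 1" for t
    using v_pos[of "(s, t)"] y_nth_0[of "(s,t)"]
    by (simp add: G_def m_def arc_family smooth_N cc_def B_def)
  then show ?thesis
    by (simp add: torsion_integral_def arc_integral_def speed_family tangent_family)
qed

end

section \<open>Total torsion modulo full turns\<close>

context equivariant_curve
begin

lemma unit_normal_field_D:
  assumes "unit_normal_field A \<tau> \<gamma> \<nu>"
  shows "smooth \<nu>" "\<nu> t \<bullet> \<nu> t = 1" "T t \<bullet> \<nu> t = 0" "\<nu> (\<tau> t) = A *v \<nu> t"
  using assms by (auto simp: unit_normal_field_def dot_square_norm inner_commute)

text \<open>Let \<open>c\<close> and \<open>d\<close> be the components of \<open>\<nu>2\<close> along \<open>\<nu>1\<close> and \<open>T \<times> \<nu>1\<close>. The difference of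
  the torsion densities is minus the angular velocity of the point \<open>(c, d)\<close> of the unit circle, which
  returns to its initial position after one period.\<close>

lemma torsion_integral_mod:
  assumes n1: "unit_normal_field A \<tau> \<gamma> \<nu>1" and n2: "unit_normal_field A \<tau> \<gamma> \<nu>2"
  shows "\<exists>n::int. torsion_integral (fundamental_domain \<tau> t0) \<gamma> \<nu>1
      = torsion_integral (fundamental_domain \<tau> t0) \<gamma> \<nu>2 + 2 * pi * of_int n"
proof -
  note [simp] = unit_normal_field_D[OF n1] unit_normal_field_D[OF n2] tangent_unit
  note s = smooth_tangent unit_normal_field_D(1)[OF n1] unit_normal_field_D(1)[OF n2]
  define c where "c t = \<nu>2 t \<bullet> \<nu>1 t" for t
  define d where "d t = \<nu>2 t \<bullet> cross3 (T t) (\<nu>1 t)" for t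
  define g where "g \<nu> t = dx \<nu> t \<bullet> cross3 (T t) (\<nu> t)" for \<nu> t
  define h where "h t = (g \<nu>1 t - g \<nu>2 t) * speed \<gamma> t" for t
  have sg: "smooth (g \<nu>1)" "smooth (g \<nu>2)"
    unfolding g_def by (intro smooth_inner smooth_cross3 smooth_arc s)+
  have sh: "smooth h" unfolding h_def by (intro smooth_mult smooth_diff sg smooth_speed)
  have scd: "smooth c" "smooth d"
    unfolding c_def d_def by (intro smooth_inner smooth_cross3 s)+
  have dot0: "dx \<nu> t \<bullet> \<nu> t = 0" if "smooth \<nu>" "\<And>t. \<nu> t \<bullet> \<nu> t = 1" for \<nu> :: "real \<Rightarrow> real^3" and t
    using arc_inner[OF that(1,1), of t] by (simp add: that arc_const inner_commute)
  have c': "dx c t = (g \<nu>1 t - g \<nu>2 t) * d t" for t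
  proof -
    have "dx c t = \<nu>2 t \<bullet> dx \<nu>1 t + dx \<nu>2 t \<bullet> \<nu>1 t"
      unfolding c_def[abs_def] by (rule arc_inner[OF s(3,2)])
    also have "\<nu>2 t \<bullet> dx \<nu>1 t = d t * g \<nu>1 t"
      using orthonormal_expansion[of "T t" "\<nu>1 t" "\<nu>2 t" "dx \<nu>1 t"]
      by (simp add: dot0[OF s(2)] d_def g_def inner_commute[of "\<nu>2 t" "T t"])
    also have "dx \<nu>2 t \<bullet> \<nu>1 t = - g \<nu>2 t * d t"
      using orthonormal_expansion[of "T t" "\<nu>2 t" "dx \<nu>2 t" "\<nu>1 t"]
      by (simp add: dot0[OF s(3)] d_def g_def inner_commute[of "\<nu>1 t" "T t"])
        (simp add: cross3_simps)
    finally show ?thesis by (simp add: algebra_simps)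
  qed
  have d': "dx d t = (g \<nu>2 t - g \<nu>1 t) * c t" for t
  proof -
    let ?b = "\<lambda>t. cross3 (T t) (\<nu>1 t)"
    have sb: "smooth ?b" by (intro smooth_cross3 s)
    have bb: "?b t \<bullet> ?b t = 1" for t
      by (simp add: dot_cross inner_commute[of "\<nu>1 t" "T t"])
    have "?b t \<bullet> dx \<nu>1 t + dx ?b t \<bullet> \<nu>1 t = 0"
      using arc_inner[OF sb s(2), of t] by (simp add: dot_cross_self arc_const)
    then have bn: "dx ?b t \<bullet> \<nu>1 t = - g \<nu>1 t" by (simp add: g_def inner_commute)
    have "dx d t = \<nu>2 t \<bullet> dx ?b t + dx \<nu>2 t \<bullet> ?b t"
      unfolding d_def[abs_def] by (rule arc_inner[OF s(3) sb])
    also have "\<nu>2 t \<bullet> dx ?b t = - c t * g \<nu>1 t"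
      using orthonormal_expansion[of "T t" "\<nu>1 t" "\<nu>2 t" "dx ?b t"]
      by (simp add: dot0[OF sb bb] bn c_def inner_commute[of "\<nu>2 t" "T t"])
    also have "dx \<nu>2 t \<bullet> ?b t = g \<nu>2 t * c t"
      using orthonormal_expansion[of "T t" "\<nu>2 t" "dx \<nu>2 t" "?b t"]
      by (simp add: dot0[OF s(3)] c_def g_def dot_cross dot_cross_self inner_commute[of "\<nu>2 t" "T t"]
          inner_commute[of "\<nu>1 t" "T t"] inner_commute[of "\<nu>1 t" "\<nu>2 t"])
    finally show ?thesis by (simp add: algebra_simps)
  qed
  have cd1: "c t * c t + d t * d t = 1" for t
    using orthonormal_expansion[of "T t" "\<nu>1 t" "\<nu>2 t" "\<nu>2 t"]
    by (simp add: c_def d_def inner_commute[of "\<nu>2 t" "T t"])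
  have per: "c (\<tau> t0) = c t0" "d (\<tau> t0) = d t0"
    by (simp_all add: c_def d_def tangent_deck cross_rotation_matrix[OF rot] rotation_inner[OF rot])
  define l where "l = min t0 (\<tau> t0)"
  define r where "r = max t0 (\<tau> t0)"
  have J: "fundamental_domain \<tau> t0 = {l..r}" and lr: "l \<le> r"
    by (auto simp: fundamental_domain_def closed_segment_eq_real_ivl l_def r_def)
  have per': "c l = c r" "d l = d r" using per by (auto simp: l_def r_def min_def max_def)
  have int: "f integrable_on {l..r}" if "smooth f" for f :: "real \<Rightarrow> real"
    by (rule integrable_continuous_interval) (rule smooth_continuous[OF that])
  obtain \<phi> where \<phi>: "\<And>t. t \<in> {l..r} \<Longrightarrow> (\<phi> has_vector_derivative h t) (at t within {l..r})"
    using antiderivative_continuous[of l r h] smooth_continuous[OF sh] by blast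
  \<comment> \<open>Turning \<open>(c, d)\<close> by the accumulated difference \<open>\<phi>\<close> of the torsions stops its motion.\<close>
  define z where "z t = Complex (c t) (d t) * cis (\<phi> t)" for t
  have c_der: "(c has_real_derivative (h t * d t)) (at t within {l..r})"
   and d_der: "(d has_real_derivative (- h t * c t)) (at t within {l..r})" for t
    using arc_has_vector_derivative[OF scd(1), of t] arc_has_vector_derivative[OF scd(2), of t]
    by (auto simp: c' d' h_def has_real_derivative_iff_has_vector_derivative algebra_simps
      intro: has_vector_derivative_at_within)
  have z_alt: "z t = of_real (c t * cos (\<phi> t) - d t * sin (\<phi> t)) + \<i> * of_real (c t * sin (\<phi> t) + d t * cos (\<phi> t))" for t
    by (simp add: z_def complex_eq_iff)
  have const: "\<exists>k. \<forall>t\<in>{l..r}. f t = k" if "\<And>t. t \<in> {l..r} \<Longrightarrow> (f has_real_derivative 0) (at t within {l..r})" for f :: "real \<Rightarrow> real"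
    using has_field_derivative_zero_constant[of "{l..r}" f] that by (metis convex_real_interval(5))
  have \<phi>': "(\<phi> has_real_derivative h t) (at t within {l..r})" if "t \<in> {l..r}" for t
    using \<phi>[OF that] by (simp add: has_real_derivative_iff_has_vector_derivative)
  have "\<exists>k. \<forall>t\<in>{l..r}. c t * cos (\<phi> t) - d t * sin (\<phi> t) = k"
    by (rule const) (auto intro!: derivative_eq_intros c_der d_der \<phi>' simp: algebra_simps)
  moreover have "\<exists>k. \<forall>t\<in>{l..r}. c t * sin (\<phi> t) + d t * cos (\<phi> t) = k"
    by (rule const) (auto intro!: derivative_eq_intros c_der d_der \<phi>' simp: algebra_simps)
  ultimately have "z l = z r"
    unfolding z_alt using lr by (metis atLeastAtMost_iff order_refl)
  moreover have "Complex (c l) (d l) \<noteq> 0"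
    using cd1[of l] by (auto simp: Complex_eq_0)
  ultimately have "cis (\<phi> l) = cis (\<phi> r)"
    by (simp add: z_def per')
  then have "cos (\<phi> r) = cos (\<phi> l) \<and> sin (\<phi> r) = sin (\<phi> l)"
    by (simp add: complex_eq_iff)
  then obtain n :: int where n: "\<phi> r = \<phi> l + 2 * pi * of_int n"
    using sin_cos_eq_iff by metis
  have "integral {l..r} h = \<phi> r - \<phi> l"
    by (rule integral_unique, rule fundamental_theorem_of_calculus[OF lr \<phi>])
  then have "integral {l..r} h = 2 * pi * of_int n" using n by simp
  moreover have "integral {l..r} h = integral {l..r} (\<lambda>t. g \<nu>1 t * speed \<gamma> t) - integral {l..r} (\<lambda>t. g \<nu>2 t * speed \<gamma> t)"
    unfolding h_def left_diff_distrib by (intro integral_diff int smooth_mult sg smooth_speed)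
  ultimately show ?thesis
    by (intro exI[of _ n]) (simp add: torsion_integral_def arc_integral_def J g_def)
qed

end

section \<open>Equivariant unit normal fields\<close>

text \<open>In odd dimension \<open>A - 1 = - A (A - 1)\<^sup>T\<close> forces the determinant of \<open>A - 1\<close> to be its own negative.\<close>

lemma rotation_axis:
  fixes A :: "real^3^3"
  assumes "rotation_matrix A"
  obtains e where "e \<bullet> e = 1" "A *v e = e"
proof -
  let ?B = "A - mat 1"
  have orth: "A ** transpose A = mat 1" and det: "det A = 1"
    using assms by (auto simp: rotation_matrix_def orthogonal_matrix_def)
  have "transpose ?B = transpose A - mat 1"
    by (simp add: transpose_def vec_eq_iff mat_def)
  then have "?B = - (A ** transpose ?B)"
    using orth by (simp add: matrix_matrix_mult_def vec_eq_iff sum_subtractf right_diff_distrib)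
      (simp add: mat_def if_distrib cong: if_cong)
  then have "det ?B = det (- (A ** transpose ?B))" by simp
  also have "\<dots> = - det (A ** transpose ?B)" by (simp add: det_3)
  also have "\<dots> = - det ?B" by (simp only: det_mul det det_transpose mult_1)
  finally have "det ?B = 0" by simp
  then obtain x where x: "x \<noteq> 0" "?B *v x = 0"
    by (metis invertible_det_nz invertible_left_inverse matrix_left_invertible_ker)
  then have "A *v x = x"
    by (simp add: matrix_vector_mult_diff_rdistrib)
  then have "A *v (x /\<^sub>R norm x) = x /\<^sub>R norm x"
    by (simp add: matrix_vector_mult_scaleR)
  moreover have "(x /\<^sub>R norm x) \<bullet> (x /\<^sub>R norm x) = 1"
    using x(1) by (simp add: dot_square_norm power2_eq_square)
  ultimately show ?thesis using that by blast
qed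

lemma rotation_plane:
  fixes A :: "real^3^3"
  assumes rot: "rotation_matrix A"
  obtains e u \<theta> where "e \<bullet> e = 1" "u \<bullet> u = 1" "e \<bullet> u = 0" "A *v e = e"
    "A *v u = cos \<theta> *\<^sub>R u + sin \<theta> *\<^sub>R cross3 e u"
    "A *v cross3 e u = cos \<theta> *\<^sub>R cross3 e u - sin \<theta> *\<^sub>R u"
proof -
  obtain e where e: "e \<bullet> e = 1" "A *v e = e" using rotation_axis[OF rot] by blast
  then have "e \<noteq> 0" by auto
  then obtain k where k: "cross3 e (axis k 1) \<noteq> 0" using cross_basis_nonzero by blast
  define u where "u = cross3 e (axis k 1) /\<^sub>R norm (cross3 e (axis k 1))"
  have u: "u \<bullet> u = 1" "e \<bullet> u = 0"
    using k by (simp_all add: u_def dot_square_norm power2_eq_square dot_cross_self)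
  define c where "c = (A *v u) \<bullet> u"
  define s where "s = (A *v u) \<bullet> cross3 e u"
  have Aue: "(A *v u) \<bullet> e = 0"
    by (metis e(2) inner_commute rotation_inner[OF rot] u(2))
  have Au_dot: "(A *v u) \<bullet> w = c * (w \<bullet> u) + s * (w \<bullet> cross3 e u)" for w
    using orthonormal_expansion[OF e(1) u, of "A *v u" w] by (simp add: Aue c_def s_def)
  have Au: "A *v u = c *\<^sub>R u + s *\<^sub>R cross3 e u"
    by (rule vector_eq_ldot[THEN iffD1]) (simp add: Au_dot inner_add_right inner_commute[of _ "A *v u"])
  have "c\<^sup>2 + s\<^sup>2 = 1"
    using Au_dot[of "A *v u"] by (simp add: rotation_inner[OF rot] u c_def s_def power2_eq_square inner_commute)
  then obtain \<theta> where \<theta>: "c = cos \<theta>" "s = sin \<theta>" using sincos_total_2pi by metis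
  have "A *v cross3 e u = cross3 e (A *v u)"
    using cross_rotation_matrix[OF rot, of e u] by (simp add: e)
  also have "\<dots> = c *\<^sub>R cross3 e u - s *\<^sub>R u"
    by (simp add: Au cross_add_right cross_mult_right Lagrange e u)
  finally show ?thesis using that e u Au \<theta> by blast
qed

lemma normalized_projection:
  fixes w e :: "'a::real_normed_vector \<Rightarrow> real^3"
  assumes "smooth w" "smooth e" and e: "\<And>x. e x \<bullet> e x = 1" and np: "\<And>x. w x \<noteq> (w x \<bullet> e x) *\<^sub>R e x"
  defines "n \<equiv> \<lambda>x. w x - (w x \<bullet> e x) *\<^sub>R e x"
  shows "smooth (\<lambda>x. inverse (norm (n x)) *\<^sub>R n x)"
    and "norm (inverse (norm (n x)) *\<^sub>R n x) = 1"
    and "(inverse (norm (n x)) *\<^sub>R n x) \<bullet> e x = 0"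
proof -
  have nz: "n x \<noteq> 0" for x using np[of x] by (simp add: n_def)
  have sn: "smooth n" unfolding n_def by (intro smooth_diff smooth_scaleR smooth_inner assms)
  show "smooth (\<lambda>x. inverse (norm (n x)) *\<^sub>R n x)"
    by (intro smooth_scaleR smooth_inverse smooth_norm sn nz) (simp add: nz)
  show "norm (inverse (norm (n x)) *\<^sub>R n x) = 1" using nz by simp
  show "(inverse (norm (n x)) *\<^sub>R n x) \<bullet> e x = 0" by (simp add: n_def inner_diff_left e)
qed

text \<open>The domain is the whole line, so the integral from \<open>0\<close> has to be oriented.\<close>

lemma smooth_antiderivative:
  fixes g :: "real \<Rightarrow> real"
  assumes g: "smooth g"
  obtains f where "smooth f" "\<And>t. (f has_real_derivative g t) (at t)"
proof -
  define f where "f t = (LBINT y=0..t. g y)" for t :: real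
  have f: "(f has_vector_derivative g t) (at t)" for t
  proof -
    have "((\<lambda>u. LBINT y=0..u. g y) has_vector_derivative g t) (at t within {- \<bar>t\<bar> - 1..\<bar>t\<bar> + 1})"
      using interval_integral_FTC2[of "- \<bar>t\<bar> - 1" 0 "\<bar>t\<bar> + 1" g t] smooth_continuous[OF g]
      by (simp add: zero_ereal_def)
    moreover have "at t within {- \<bar>t\<bar> - 1..\<bar>t\<bar> + 1} = at t"
      by (rule at_within_interior) (simp add: interior_atLeastAtMost_real, linarith)
    ultimately show ?thesis by (simp add: f_def[abs_def])
  qed
  have "ddir v f t = v * g t" for v t
    using ddir_eqI[of f "\<lambda>v. v * g t" t v] f[of t] by (simp add: has_vector_derivative_def)
  then have "ddir v f = (\<lambda>t. v * g t)" for v by blast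
  then have "smooth f"
    using f g by (subst smooth_iff_ddir) (auto intro!: smooth_intros simp: has_vector_derivative_def differentiable_def)
  then show ?thesis using that f by (auto simp: has_real_derivative_iff_has_vector_derivative)
qed

context equivariant_curve
begin

text \<open>Arclength divided by its increment over one period, which is negative if \<open>\<tau>\<close> moves points to the left.\<close>

lemma equivariant_parameter:
  obtains f where "smooth f" "\<And>t. f (\<tau> t) = f t + (1::real)" "inj f"
proof -
  obtain x where x: "smooth x" and x': "\<And>t. (x has_real_derivative speed \<gamma> t) (at t)"
    using smooth_antiderivative[OF smooth_speed] by blast
  have ddx: "ddir 1 x t = speed \<gamma> t" for t
    using smooth_has_vector_derivative[OF x] x'[of t] vector_derivative_unique_at
    by (metis has_real_derivative_iff_has_vector_derivative)
  have "((\<lambda>t. x (\<tau> t) - x t) has_vector_derivative 0) (at t)" for t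
    using has_vector_derivative_diff[OF has_vector_derivative_deck[OF x] smooth_has_vector_derivative[OF x], of t]
    by (simp add: ddx mult.commute speed_deck)
  then have "\<exists>C. \<forall>t. x (\<tau> t) - x t = C"
    using has_vector_derivative_zero_constant[of UNIV "\<lambda>t. x (\<tau> t) - x t", OF convex_UNIV] by (metis UNIV_I)
  then obtain C where C: "x (\<tau> t) = x t + C" for t by (metis diff_add_cancel add.commute)
  have "x s < x t" if "s < t" for s t
    using DERIV_pos_imp_increasing[OF that] x' speed_pos by blast
  then have inj: "inj x" by (metis injI less_irrefl linorder_neqE_linordered_idom)
  then have "x (\<tau> 0) \<noteq> x 0"
    using deck by (metis deck_transformation_def injD)
  then have "C \<noteq> 0" using C[of 0] by auto
  show ?thesis
  proof (rule that[of "\<lambda>t. x t * inverse C"])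
    show "smooth (\<lambda>t. x t * inverse C)" by (intro smooth_mult smooth_const x)
    show "x (\<tau> t) * inverse C = x t * inverse C + 1" for t
      using \<open>C \<noteq> 0\<close> by (simp add: C field_simps)
    show "inj (\<lambda>t. x t * inverse C)"
      using inj \<open>C \<noteq> 0\<close> by (auto simp: inj_def)
  qed
qed

text \<open>With the axis \<open>e\<close> of \<open>A\<close> and an equivariant parameter \<open>f\<close> one gets an equivariant orthonormal frame
  \<open>(e, E2, E3)\<close> by rotating about \<open>e\<close> through the angle \<open>f \<theta>\<close>. Any fixed linear combination \<open>w\<close> of this
  frame is equivariant, and its orthogonal projection to the normal planes is a normal field unless \<open>w\<close> is
  tangent somewhere. The coefficient vectors of tangent vectors form the image of the smooth map
  \<open>\<Phi>\<close> of a plane into three-space, which is negligible, so a good choice of coefficients exists.\<close>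

lemma unit_normal_field_exists: "\<exists>\<nu>. unit_normal_field A \<tau> \<gamma> \<nu>"
proof -
  obtain f where f: "smooth f" "\<And>t. f (\<tau> t) = f t + (1::real)" using equivariant_parameter by blast
  obtain e u \<theta> where o: "e \<bullet> e = 1" "u \<bullet> u = 1" "e \<bullet> u = 0" and Ae: "A *v e = e"
    and Au: "A *v u = cos \<theta> *\<^sub>R u + sin \<theta> *\<^sub>R cross3 e u"
    and Ab: "A *v cross3 e u = cos \<theta> *\<^sub>R cross3 e u - sin \<theta> *\<^sub>R u"
    using rotation_plane[OF rot] by blast
  define b where "b = cross3 e u"
  have b: "b \<bullet> b = 1" "e \<bullet> b = 0" "u \<bullet> b = 0"
    using o by (simp_all add: b_def dot_cross dot_cross_self inner_commute[of u e])
  define E2 where "E2 t = cos (f t * \<theta>) *\<^sub>R u + sin (f t * \<theta>) *\<^sub>R b" for t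
  define E3 where "E3 t = cos (f t * \<theta>) *\<^sub>R b - sin (f t * \<theta>) *\<^sub>R u" for t
  have sE: "smooth E2" "smooth E3"
    unfolding E2_def E3_def by (intro smooth_add smooth_diff smooth_scaleR smooth_cos smooth_sin smooth_mult smooth_const f)+
  have E_deck: "E2 (\<tau> t) = A *v E2 t" "E3 (\<tau> t) = A *v E3 t" for t
    by (simp_all add: E2_def E3_def f(2) distrib_right cos_add sin_add matrix_vector_mult_scaleR
        matrix_vector_right_distrib matrix_vector_mult_diff_distrib Au[folded b_def] Ab[folded b_def] algebra_simps)
  have orth: "e \<bullet> E2 t = 0" "e \<bullet> E3 t = 0" "E2 t \<bullet> E2 t = 1" "E3 t \<bullet> E3 t = 1" "E2 t \<bullet> E3 t = 0" for t
    using o b sin_cos_squared_add[of "f t * \<theta>"]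
    by (simp_all add: E2_def E3_def inner_add_left inner_add_right inner_diff_left inner_diff_right
        inner_commute[of u e] inner_commute[of b e] inner_commute[of b u] power2_eq_square algebra_simps)
  define \<Phi> :: "real \<times> real \<Rightarrow> real^3" where
    "\<Phi> = (\<lambda>(r, t). r *\<^sub>R vector [T t \<bullet> e, T t \<bullet> E2 t, T t \<bullet> E3 t])"
  have \<Phi>: "\<Phi> = (\<lambda>x. fst x *\<^sub>R ((T (snd x) \<bullet> e) *\<^sub>R axis 1 1 + (T (snd x) \<bullet> E2 (snd x)) *\<^sub>R axis 2 1
      + (T (snd x) \<bullet> E3 (snd x)) *\<^sub>R axis 3 1))"
    by (auto simp: \<Phi>_def fun_eq_iff vec_eq_iff forall_3 axis_def)
  have "smooth \<Phi>" unfolding \<Phi>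
    by (intro smooth_add smooth_scaleR smooth_inner smooth_fst smooth_const smooth_compose[OF smooth_tangent smooth_snd]
        smooth_compose[OF sE(1) smooth_snd] smooth_compose[OF sE(2) smooth_snd])
  then have "\<Phi> differentiable_on UNIV"
    by (simp add: differentiable_on_def smooth_differentiable)
  then have "negligible (range \<Phi>)"
    by (intro negligible_differentiable_image_lowdim) auto
  then obtain p where p: "p \<notin> range \<Phi>"
    by (metis UNIV_eq_I non_negligible_UNIV)
  define w where "w t = (p$1) *\<^sub>R e + (p$2) *\<^sub>R E2 t + (p$3) *\<^sub>R E3 t" for t
  have sw: "smooth w" unfolding w_def by (intro smooth_add smooth_scaleR smooth_const sE)
  have wE: "w t \<bullet> e = p$1" "w t \<bullet> E2 t = p$2" "w t \<bullet> E3 t = p$3" for t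
    using o orth[of t] by (simp_all add: w_def inner_add_left inner_commute[of "E2 t" e] inner_commute[of "E3 t" e] inner_commute[of "E3 t" "E2 t"])
  have np: "w t \<noteq> r *\<^sub>R T t" for t r
  proof
    assume eq: "w t = r *\<^sub>R T t"
    have "p = \<Phi> (r, t)"
      using wE[of t] unfolding eq by (simp add: \<Phi>_def vec_eq_iff forall_3)
    then show False using p by blast
  qed
  have w_deck: "w (\<tau> t) = A *v w t" for t
    by (simp add: w_def E_deck matrix_vector_right_distrib matrix_vector_mult_scaleR Ae)
  let ?n = "\<lambda>t. w t - (w t \<bullet> T t) *\<^sub>R T t"
  let ?\<nu> = "\<lambda>t. inverse (norm (?n t)) *\<^sub>R ?n t"
  have n_deck: "?n (\<tau> t) = A *v ?n t" for t
    by (simp add: w_deck tangent_deck rotation_inner[OF rot] matrix_vector_mult_diff_distrib matrix_vector_mult_scaleR)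
  note P = normalized_projection[OF sw smooth_tangent tangent_unit np]
  have "unit_normal_field A \<tau> \<gamma> ?\<nu>"
    unfolding unit_normal_field_def
  proof (intro conjI allI)
    show "smooth ?\<nu>" by (rule P(1))
    show "norm (?\<nu> t) = 1" "?\<nu> t \<bullet> T t = 0" for t by (rule P(2), rule P(3))
    show "?\<nu> (\<tau> t) = A *v ?\<nu> t" for t
      unfolding n_deck rotation_norm[OF rot] by (simp add: matrix_vector_mult_scaleR)
  qed
  then show ?thesis by blast
qed

lemma total_torsion_mod:
  assumes "unit_normal_field A \<tau> \<gamma> \<nu>"
  shows "\<exists>n::int. total_torsion A \<tau> t0 \<gamma> = torsion_integral (fundamental_domain \<tau> t0) \<gamma> \<nu> + 2 * pi * of_int n"
  unfolding total_torsion_def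
  by (rule torsion_integral_mod[OF someI_ex[OF unit_normal_field_exists] assms])

end

section \<open>Variations\<close>

context equivariant_curve
begin

text \<open>The equivariant parameter increases by one under \<open>\<tau>\<close>, so every orbit has a point with parameter between
  those of \<open>t0\<close> and \<open>\<tau> t0\<close>; by injectivity and the intermediate value theorem it lies in the segment.\<close>

lemma fundamental_domain_covers:
  assumes I: "\<And>t. t \<in> fundamental_domain \<tau> t0 \<Longrightarrow> P t" and P: "\<And>t. P (\<tau> t) \<longleftrightarrow> P t"
  shows "P t"
proof -
  obtain f where f: "smooth f" "\<And>t. f (\<tau> t) = f t + (1::real)" "inj f"
    using equivariant_parameter by blast
  have fn: "f ((\<tau> ^^ n) t) = f t + real n" and Pn: "P ((\<tau> ^^ n) t) \<longleftrightarrow> P t" for n t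
    by (induction n) (auto simp: f(2) P)
  have "surj \<tau>" using deck by (simp add: deck_transformation_def bij_is_surj)
  then have surj: "surj (\<tau> ^^ n)" for n by (rule surj_fn)
  have "\<exists>t'. f t0 \<le> f t' \<and> f t' < f t0 + 1 \<and> (P t' \<longleftrightarrow> P t)"
  proof (cases "f t0 \<le> f t")
    case True
    define n where "n = nat \<lfloor>f t - f t0\<rfloor>"
    obtain t' where t': "(\<tau> ^^ n) t' = t" using surj by (metis surjD)
    have "real n \<le> f t - f t0" "f t - f t0 < real n + 1" using True by (simp_all add: n_def)
    then show ?thesis using fn[of n t'] Pn[of n t'] t' by (intro exI[of _ t']) auto
  next
    case False
    define n where "n = nat \<lceil>f t0 - f t\<rceil>"
    have "f t0 - f t \<le> real n" "real n < f t0 - f t + 1"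
      using False ceiling_correct[of "f t0 - f t"] by (simp_all add: n_def)
    then show ?thesis using fn[of n t] Pn[of n t] by (intro exI[of _ "(\<tau> ^^ n) t"]) auto
  qed
  then obtain t' where "f t0 \<le> f t'" "f t' < f t0 + 1" and Pt': "P t' \<longleftrightarrow> P t" by blast
  then have t': "f t' \<in> {f t0..f (\<tau> t0)}" by (simp add: f(2))
  have "connected (f ` closed_segment t0 (\<tau> t0))"
    by (intro connected_continuous_image smooth_continuous f connected_segment)
  then have "{f t0..f (\<tau> t0)} \<subseteq> f ` closed_segment t0 (\<tau> t0)"
    by (rule connected_contains_Icc) auto
  then have "f t' \<in> f ` closed_segment t0 (\<tau> t0)"
    using t' by blast
  then have "t' \<in> closed_segment t0 (\<tau> t0)"
    by (simp add: inj_image_mem_iff[OF f(3)])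
  then show ?thesis using I Pt' by (auto simp: fundamental_domain_def)
qed

end

text \<open>A tube lemma: uniform continuity near the compact slice \<open>s = 0\<close>.\<close>

lemma eventually_positive_near_slice:
  fixes D :: "real \<times> real \<Rightarrow> real"
  assumes D: "continuous_on UNIV D" and I: "compact I" and pos: "\<And>t. t \<in> I \<Longrightarrow> D (0, t) > 0"
  obtains \<delta> where "\<delta> > 0" "\<And>s t. \<bar>s\<bar> < \<delta> \<Longrightarrow> t \<in> I \<Longrightarrow> D (s, t) > 0"
proof (cases "I = {}")
  case True
  then show ?thesis using that[of 1] by auto
next
  case False
  let ?K = "{-1..1::real} \<times> I"
  have cD: "continuous_on S D" for S using D continuous_on_subset by blast
  have "continuous_on I (\<lambda>t. D (0, t))"
    by (rule continuous_on_compose2[OF D]) (auto intro!: continuous_intros)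
  then obtain m where m: "m \<in> I" "\<And>t. t \<in> I \<Longrightarrow> D (0, m) \<le> D (0, t)"
    using continuous_attains_inf[OF I False] by blast
  have "compact ?K" by (intro compact_Times compact_Icc I)
  then have "uniformly_continuous_on ?K D"
    by (intro compact_uniformly_continuous cD)
  then obtain d where d: "d > 0" "\<And>x y. x \<in> ?K \<Longrightarrow> y \<in> ?K \<Longrightarrow> dist y x < d \<Longrightarrow> dist (D y) (D x) < D (0, m)"
    unfolding uniformly_continuous_on_def using pos[OF m(1)] by meson
  show ?thesis
  proof (rule that[of "min d 1"])
    show "min d 1 > 0" using d by simp
    fix s t :: real assume st: "\<bar>s\<bar> < min d 1" "t \<in> I"
    have "dist (s, t) (0, t) < d" using st by (simp add: dist_Pair_Pair dist_real_def)
    then have "dist (D (s, t)) (D (0, t)) < D (0, m)"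
      using st by (intro d(2)) auto
    then show "D (s, t) > 0" using m(2)[OF st(2)] by (simp add: dist_real_def)
  qed
qed

lemma MW_form_scale: "MW_form I \<gamma> \<xi> (\<lambda>t. c *\<^sub>R \<eta> t) = c * MW_form I \<gamma> \<xi> \<eta>"
proof -
  have d: "det3 x y (c *\<^sub>R z) = c * det3 x y z" for x y z
    by (simp add: det3_def det_3 algebra_simps)
  have "MW_form I \<gamma> \<xi> (\<lambda>t. c *\<^sub>R \<eta> t) = integral I (\<lambda>t. c * (det3 (tangent \<gamma> t) (\<xi> t) (\<eta> t) * speed \<gamma> t))"
    by (simp add: MW_form_def arc_integral_def d mult.assoc)
  then show ?thesis by (simp add: MW_form_def arc_integral_def)
qed

text \<open>The curves \<open>\<Gamma> s\<close> lie in the curve space only for small \<open>s\<close>, and a normal field \<open>\<nu>\<close> of \<open>\<gamma>\<close> can be projected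
  to a normal field of \<open>\<Gamma> s\<close> only while \<open>\<nu>\<close> is nowhere tangent to \<open>\<Gamma> s\<close>. Replacing \<open>s\<close> by \<open>c * sin s\<close> with
  small \<open>c\<close> confines the parameter to the good range, so that the family is defined for all real parameters,
  without losing the first-order information at \<open>s = 0\<close>.\<close>

lemma variation_framed_family:
  assumes rot: "rotation_matrix A" and deck: "deck_transformation \<tau>"
    and var: "variation (curve_space A a \<tau>) \<gamma> \<xi> \<Gamma>"
  obtains c N where "c > 0" "framed_family A a \<tau> (\<lambda>x. \<Gamma> (c * sin (fst x)) (snd x)) N"
proof -
  let ?M = "curve_space A a \<tau>"
  have sm: "smooth (\<lambda>(s, t). \<Gamma> s t)" and ev: "\<forall>\<^sub>F s in nhds 0. \<Gamma> s \<in> ?M" and G0: "\<Gamma> 0 = \<gamma>"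
    using var by (auto simp: variation_def)
  obtain d where d: "d > 0" "\<And>s. \<bar>s\<bar> < d \<Longrightarrow> \<Gamma> s \<in> ?M"
    using ev by (auto simp: eventually_nhds_metric dist_real_def)
  define F where "F = (\<lambda>x. \<Gamma> (fst x) (snd x))"
  have F: "smooth F" using sm by (simp add: F_def case_prod_beta')
  have curve: "equivariant_curve A a \<tau> (\<Gamma> s)" if "\<bar>s\<bar> < d" for s
    by (intro equivariant_curve.intro rot deck d(2) that)
  interpret g: equivariant_curve A a \<tau> \<gamma> using curve[of 0] d(1) by (simp add: G0)
  obtain \<nu> where \<nu>: "unit_normal_field A \<tau> \<gamma> \<nu>" using g.unit_normal_field_exists by blast
  note n = g.unit_normal_field_D[OF \<nu>]
  have Dt_F: "Dt F (s, t) = speed (\<Gamma> s) t *\<^sub>R tangent (\<Gamma> s) t" if "\<bar>s\<bar> < d" for s t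
  proof -
    interpret c: equivariant_curve A a \<tau> "\<Gamma> s" by (rule curve[OF that])
    have "Dt F (s, t) = ddir 1 (\<Gamma> s) t" using ddir_slice_t[OF F, of s t] by (simp add: F_def)
    then show ?thesis
      using c.speed_pos[of t] by (simp add: tangent_def c.arc_eq c.smooth_curve)
  qed
  \<comment> \<open>\<open>D\<close> is the squared length of the part of the velocity orthogonal to \<open>\<nu>\<close>, so it vanishes exactly where
     the velocity is a multiple of \<open>\<nu>\<close>. Written with the velocity, not the unit tangent, it is continuous even for those
     \<open>s\<close> for which \<open>\<Gamma> s\<close> fails to be immersed.\<close>
  define D where "D x = Dt F x \<bullet> Dt F x - (\<nu> (snd x) \<bullet> Dt F x)\<^sup>2" for x
  have "smooth D"
    unfolding D_def by (intro smooth_diff smooth_inner smooth_power smooth_ddir F smooth_compose[OF n(1) smooth_snd])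
  have D_eq: "D (s, t) = (speed (\<Gamma> s) t)\<^sup>2 * (1 - (\<nu> t \<bullet> tangent (\<Gamma> s) t)\<^sup>2)" if "\<bar>s\<bar> < d" for s t
  proof -
    interpret c: equivariant_curve A a \<tau> "\<Gamma> s" by (rule curve[OF that])
    show ?thesis
      by (simp add: D_def Dt_F[OF that] c.tangent_unit power2_eq_square algebra_simps)
  qed
  have "D (0, t) > 0" for t
    using d(1) g.speed_pos[of t] n(3)[of t] by (simp add: D_eq G0 inner_commute)
  moreover have "compact (fundamental_domain \<tau> 0)"
    by (simp add: fundamental_domain_def)
  ultimately obtain \<delta> where \<delta>: "\<delta> > 0"
      "\<And>s t. \<bar>s\<bar> < \<delta> \<Longrightarrow> t \<in> fundamental_domain \<tau> 0 \<Longrightarrow> D (s, t) > 0"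
    using eventually_positive_near_slice[OF smooth_continuous[OF \<open>smooth D\<close>]] by metis
  define c where "c = min d \<delta> / 2"
  have c: "c > 0" "c < d" "c < \<delta>" using d(1) \<delta>(1) by (auto simp: c_def min_def)
  define \<rho> where "\<rho> s = c * sin s" for s
  have \<rho>: "\<bar>\<rho> s\<bar> < d" "\<bar>\<rho> s\<bar> < \<delta>" for s
  proof -
    have "\<bar>\<rho> s\<bar> \<le> c"
      using mult_left_mono[OF abs_sin_le_one[of s], of c] c by (simp add: \<rho>_def abs_mult)
    then show "\<bar>\<rho> s\<bar> < d" "\<bar>\<rho> s\<bar> < \<delta>" using c by auto
  qed
  have np: "(\<nu> t \<bullet> tangent (\<Gamma> (\<rho> s)) t)\<^sup>2 < 1" for s t
  proof -
    interpret k: equivariant_curve A a \<tau> "\<Gamma> (\<rho> s)" by (rule curve[OF \<rho>(1)])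
    let ?Q = "\<lambda>t. (\<nu> t \<bullet> tangent (\<Gamma> (\<rho> s)) t)\<^sup>2 < 1"
    have "?Q t" if "t \<in> fundamental_domain \<tau> 0" for t
    proof -
      have "D (\<rho> s, t) > 0" using \<delta>(2) \<rho>(2) that by blast
      then show ?thesis
        using k.speed_pos[of t] by (simp add: D_eq \<rho>(1) zero_less_mult_iff)
    qed
    moreover have "?Q (\<tau> t) \<longleftrightarrow> ?Q t" for t
      by (simp add: n(4) k.tangent_deck rotation_inner[OF rot])
    ultimately show ?thesis
      using k.fundamental_domain_covers[of 0 ?Q t] by simp
  qed
  let ?\<Gamma> = "\<lambda>x. \<Gamma> (c * sin (fst x)) (snd x)"
  have s\<Gamma>: "smooth ?\<Gamma>"
    using smooth_compose[OF F smooth_Pair[OF smooth_mult[OF smooth_const smooth_sin[OF smooth_fst]] smooth_snd], of c]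
    by (simp add: F_def)
  interpret f: curve_family A a \<tau> ?\<Gamma>
    by unfold_locales (use rot deck s\<Gamma> d(2) \<rho>(1) in \<open>auto simp: \<rho>_def\<close>)
  have Tf: "f.T (s, t) = tangent (\<Gamma> (\<rho> s)) t" for s t
    using f.tangent_family[of s t] by (simp add: \<rho>_def)
  have ne: "\<nu> (snd x) \<noteq> (\<nu> (snd x) \<bullet> f.T x) *\<^sub>R f.T x" for x
  proof
    obtain s t where x: "x = (s, t)" by (cases x)
    assume eq: "\<nu> (snd x) = (\<nu> (snd x) \<bullet> f.T x) *\<^sub>R f.T x"
    have "\<nu> (snd x) \<bullet> \<nu> (snd x) = (\<nu> (snd x) \<bullet> f.T x)\<^sup>2"
      using arg_cong[OF eq, of "inner (\<nu> (snd x))"] unfolding inner_scaleR_right power2_eq_square .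
    then show False using np[of t s] n(2)[of t] by (simp add: x Tf)
  qed
  note P = normalized_projection[OF smooth_compose[OF n(1) smooth_snd] f.smooth_T f.T_unit ne]
  let ?n = "\<lambda>x. \<nu> (snd x) - (\<nu> (snd x) \<bullet> f.T x) *\<^sub>R f.T x"
  let ?N = "\<lambda>x. inverse (norm (?n x)) *\<^sub>R ?n x"
  have n_deck: "?n (s, \<tau> t) = A *v ?n (s, t)" for s t
    by (simp add: n(4) f.T_deck rotation_inner[OF rot] matrix_vector_mult_diff_distrib matrix_vector_mult_scaleR)
  have "framed_family A a \<tau> ?\<Gamma> ?N"
  proof (unfold_locales)
    show "smooth ?N" by (rule P(1))
    show "unit_normal_field A \<tau> (\<lambda>t. ?\<Gamma> (s, t)) (\<lambda>t. ?N (s, t))" for s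
      unfolding unit_normal_field_def
    proof (intro conjI allI)
      show "smooth (\<lambda>t. ?N (s, t))" by (rule smooth_slice[OF P(1)])
      show "norm (?N (s, t)) = 1" for t by (rule P(2))
      show "?N (s, t) \<bullet> tangent (\<lambda>t. ?\<Gamma> (s, t)) t = 0" for t
        unfolding f.tangent_family by (rule P(3))
      show "?N (s, \<tau> t) = A *v ?N (s, t)" for t
        unfolding n_deck rotation_norm[OF rot] by (simp add: matrix_vector_mult_scaleR)
    qed
  qed
  then show ?thesis using that c(1) by blast
qed

text \<open>The reparametrisation \<open>s \<mapsto> c * sin s\<close> is undone near \<open>0\<close> by \<open>arcsin (s / c)\<close>. For \<open>k = 2\<close> the local lift
  of the total torsion is the torsion of the normal fields of the framed family, which vary smoothly with
  \<open>s\<close>, unlike those chosen in the definition.\<close>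

lemma hamiltonian_derivative:
  fixes t0 :: real
  assumes rot: "rotation_matrix A" and deck: "deck_transformation \<tau>"
    and var: "variation (curve_space A a \<tau>) \<gamma> \<xi> \<Gamma>"
  defines "I \<equiv> fundamental_domain \<tau> t0"
  shows "\<exists>e. (\<forall>\<^sub>F s in nhds 0. \<exists>n::int. e s = hamiltonian A \<tau> t0 k (\<Gamma> s) + (if k = 2 then 2 * pi else 0) * of_int n)
    \<and> (e has_real_derivative MW_form I \<gamma> (Y k \<gamma>) \<xi>) (at 0)"
proof (cases k)
  case 0
  have "MW_form I \<gamma> (Y 0 \<gamma>) \<xi> = 0"
    by (simp add: MW_form_def Y.simps(1) det3_def det_3 arc_integral_def)
  then show ?thesis
    by (intro exI[of _ "\<lambda>_. 0"]) (simp add: 0 hamiltonian_nth)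
next
  case (Suc j)
  obtain c N where c: "c > 0" and fam: "framed_family A a \<tau> (\<lambda>x. \<Gamma> (c * sin (fst x)) (snd x)) N"
    using variation_framed_family[OF rot deck var] by blast
  interpret framed_family A a \<tau> "\<lambda>x. \<Gamma> (c * sin (fst x)) (snd x)" N by (rule fam)
  have G0: "\<Gamma> 0 = \<gamma>" and vel: "\<And>t. ((\<lambda>s. \<Gamma> s t) has_vector_derivative \<xi> t) (at 0)"
    using var by (auto simp: variation_def)
  define E where "E s = integral I (\<lambda>t. fps_nth (G (s, t)) j)" for s
  have "Ds (\<lambda>x. \<Gamma> (c * sin (fst x)) (snd x)) (0, t) = c *\<^sub>R \<xi> t" for t
  proof -
    have "((\<lambda>s. c * sin s) has_vector_derivative c) (at 0)"
      by (auto intro!: derivative_eq_intros simp: has_real_derivative_iff_has_vector_derivative[symmetric])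
    then have "((\<lambda>s. \<Gamma> (c * sin s) t) has_vector_derivative c *\<^sub>R \<xi> t) (at 0)"
      using vector_diff_chain_at[of "\<lambda>s. c * sin s" c 0 "\<lambda>s. \<Gamma> s t" "\<xi> t"] vel by (simp add: o_def)
    then show ?thesis
      using has_vector_derivative_slice_s[OF smooth_family, of t 0] vector_derivative_unique_at by fastforce
  qed
  then have E: "(E has_real_derivative c * MW_form I \<gamma> (Y k \<gamma>) \<xi>) (at 0)"
    using integral_variation[of t0 j 0] unfolding E_def[abs_def] I_def Suc by (simp add: G0 MW_form_scale)
  let ?r = "\<lambda>s. arcsin (s / c)"
  have r: "(?r has_real_derivative 1 / c) (at 0)"
    using c by (auto intro!: derivative_eq_intros)
  have "((\<lambda>s. E (?r s)) has_real_derivative MW_form I \<gamma> (Y k \<gamma>) \<xi>) (at 0)"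
  proof -
    have "(E has_real_derivative c * MW_form I \<gamma> (Y k \<gamma>) \<xi>) (at (?r 0))" using E by simp
    from DERIV_chain2[OF this r] show ?thesis using c by simp
  qed
  moreover have "\<exists>n::int. E (?r s) = hamiltonian A \<tau> t0 k (\<Gamma> s) + (if k = 2 then 2 * pi else 0) * of_int n"
    if "\<bar>s\<bar> < c" for s
  proof -
    have "c * sin (?r s) = s" using c that by (simp add: abs_less_iff field_simps)
    then have curve_s: "(\<lambda>t. \<Gamma> (c * sin (fst (?r s, t))) (snd (?r s, t))) = \<Gamma> s" by simp
    show ?thesis
    proof (cases "j = 1")
      case False
      then show ?thesis
        using hamiltonian_eq_integral_G[of j t0 "?r s"] unfolding curve_s
        by (simp add: E_def I_def Suc)
    next
      case True
      obtain n :: int where "total_torsion A \<tau> t0 (\<Gamma> s)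
          = torsion_integral I (\<Gamma> s) (\<lambda>t. N (?r s, t)) + 2 * pi * of_int n"
        using curve.total_torsion_mod[OF normal, of t0 "?r s"] unfolding curve_s I_def by blast
      then have "E (?r s) = hamiltonian A \<tau> t0 k (\<Gamma> s) + 2 * pi * of_int (- n)"
        using torsion_eq_integral_G[of t0 "?r s"] unfolding curve_s
        by (simp add: E_def I_def Suc True hamiltonian_nth)
      then show ?thesis using Suc True by (intro exI[of _ "- n"]) (simp add: numeral_2_eq_2)
    qed
  qed
  then have "\<forall>\<^sub>F s in nhds 0. \<exists>n::int. E (?r s) = hamiltonian A \<tau> t0 k (\<Gamma> s) + (if k = 2 then 2 * pi else 0) * of_int n"
    using c by (auto simp: eventually_nhds_metric dist_real_def)
  ultimately show ?thesis by (intro exI[of _ "\<lambda>s. E (?r s)"] conjI)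
qed

section \<open>The first Hamiltonians\<close>

context immersed_curve
begin

text \<open>Arclength derivatives of the unit tangent, the squared curvature \<open>\<kappa>2\<close>, and
  \<open>\<delta> = det (\<gamma>', \<gamma>'', \<gamma>''')\<close>.\<close>

abbreviation "T1 \<equiv> dx T"
abbreviation "T2 \<equiv> dx T1"
abbreviation "T3 \<equiv> dx T2"
abbreviation "T4 \<equiv> dx T3"
abbreviation "\<kappa>2 t \<equiv> T1 t \<bullet> T1 t"
abbreviation "\<delta> t \<equiv> T t \<bullet> cross3 (T1 t) (T2 t)"

lemma smooth_Ts: "smooth T" "smooth T1" "smooth T2" "smooth T3" "smooth T4"
  by (intro smooth_arc smooth_tangent)+

lemma tangent_orth: "T t \<bullet> T1 t = 0" "T t \<bullet> T2 t = - \<kappa>2 t"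
proof -
  show 1: "T t \<bullet> T1 t = 0" for t
    using arc_inner[OF smooth_Ts(1,1), of t] by (simp add: tangent_unit arc_const inner_commute)
  show "T t \<bullet> T2 t = - \<kappa>2 t"
    using arc_inner[OF smooth_Ts(1,2), of t] by (simp add: 1 arc_const)
qed

lemma Y_1: "Y (Suc 0) \<gamma> = (\<lambda>t. cross3 (T t) (T1 t))"
proof
  have "Y 0 \<gamma> = T" by (simp add: fun_eq_iff Y.simps(1))
  then show "Y (Suc 0) \<gamma> t = cross3 (T t) (T1 t)" for t
    using Y.simps(2)[of 0 \<gamma> t] by simp
qed

lemma Y_2: "Y 2 \<gamma> = (\<lambda>t. - T2 t - ((3/2) * \<kappa>2 t) *\<^sub>R T t)"
proof
  fix t
  have "dx (Y (Suc 0) \<gamma>) t = cross3 (T t) (T2 t)"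
    unfolding Y_1 by (simp add: arc_cross3 smooth_Ts)
  then have "Y 2 \<gamma> t = cross3 (T t) (cross3 (T t) (T2 t)) - ((1/2) * (Y (Suc 0) \<gamma> t \<bullet> Y (Suc 0) \<gamma> t)) *\<^sub>R T t"
    using Y.simps(2)[of "Suc 0" \<gamma> t] by (simp add: numeral_2_eq_2)
  also have "Y (Suc 0) \<gamma> t \<bullet> Y (Suc 0) \<gamma> t = \<kappa>2 t"
    by (simp add: Y_1 dot_cross tangent_unit tangent_orth)
  also have "cross3 (T t) (cross3 (T t) (T2 t)) = - \<kappa>2 t *\<^sub>R T t - T2 t"
    by (simp add: Lagrange tangent_unit tangent_orth)
  finally have eq: "Y 2 \<gamma> t = - \<kappa>2 t *\<^sub>R T t - T2 t - ((1/2) * \<kappa>2 t) *\<^sub>R T t" .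
  show "Y 2 \<gamma> t = - T2 t - ((3/2) * \<kappa>2 t) *\<^sub>R T t"
  proof -
    have "((3/2) * \<kappa>2 t) *\<^sub>R T t = \<kappa>2 t *\<^sub>R T t + ((1/2) * \<kappa>2 t) *\<^sub>R T t"
      unfolding scaleR_left_distrib[symmetric] by (rule arg_cong) simp
    then show ?thesis unfolding eq by simp
  qed
qed

lemma cross3_inner_cross3: "cross3 u w \<bullet> z = u \<bullet> cross3 w z" for u w z :: "real^3"
  by (simp add: cross3_simps)

lemma Y_1_Y_2: "Y 1 \<gamma> t \<bullet> Y 2 \<gamma> t = - \<delta> t"
  by (simp add: Y_1 Y_2 inner_diff_right dot_cross_self cross3_inner_cross3)

lemma Y_3: "Y 3 \<gamma> = (\<lambda>t. - cross3 (T t) (T3 t) - ((3/2) * \<kappa>2 t) *\<^sub>R cross3 (T t) (T1 t) + \<delta> t *\<^sub>R T t)"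
proof
  fix t
  have s: "smooth (\<lambda>t. (3/2) * \<kappa>2 t)" "smooth (\<lambda>t. ((3/2) * \<kappa>2 t) *\<^sub>R T t)"
    by (intro smooth_mult smooth_scaleR smooth_const smooth_inner smooth_Ts)+
  have "dx (Y 2 \<gamma>) t = - T3 t - (((3/2) * \<kappa>2 t) *\<^sub>R T1 t + dx (\<lambda>t. (3/2) * \<kappa>2 t) t *\<^sub>R T t)"
    unfolding Y_2 using s by (simp only: arc_diff arc_minus arc_scaleR smooth_minus smooth_Ts)
  then have "cross3 (T t) (dx (Y 2 \<gamma>) t) = - cross3 (T t) (T3 t) - ((3/2) * \<kappa>2 t) *\<^sub>R cross3 (T t) (T1 t)"
    by (simp add: Cross3.right_diff_distrib cross_add_right cross_mult_right)
  moreover have "Y 3 \<gamma> t = cross3 (T t) (dx (Y 2 \<gamma>) t)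
      - ((1/2) * (Y 1 \<gamma> t \<bullet> Y 2 \<gamma> t + Y 2 \<gamma> t \<bullet> Y 1 \<gamma> t)) *\<^sub>R T t"
    using Y.simps(2)[of 2 \<gamma> t] by (simp add: numeral_2_eq_2 numeral_3_eq_3)
  ultimately show "Y 3 \<gamma> t = - cross3 (T t) (T3 t) - ((3/2) * \<kappa>2 t) *\<^sub>R cross3 (T t) (T1 t) + \<delta> t *\<^sub>R T t"
    using Y_1_Y_2[of t] by (simp add: inner_commute[of "Y 2 \<gamma> t"])
qed

lemma Y_dot_Y_1:
  "Y 1 \<gamma> t \<bullet> Y 1 \<gamma> t = \<kappa>2 t"
  "Y 2 \<gamma> t \<bullet> Y 1 \<gamma> t = - \<delta> t"
  "Y 3 \<gamma> t \<bullet> Y 1 \<gamma> t = - (T3 t \<bullet> T1 t) - 3/2 * (\<kappa>2 t)\<^sup>2"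
  "Y 4 \<gamma> t \<bullet> Y 1 \<gamma> t = T t \<bullet> cross3 (T1 t) (T4 t) + 5/2 * \<kappa>2 t * \<delta> t"
proof -
  show 1: "Y 1 \<gamma> t \<bullet> Y 1 \<gamma> t = \<kappa>2 t"
    by (simp add: Y_1 dot_cross tangent_unit tangent_orth)
  show "Y 2 \<gamma> t \<bullet> Y 1 \<gamma> t = - \<delta> t"
    using Y_1_Y_2 by (simp add: inner_commute)
  show "Y 3 \<gamma> t \<bullet> Y 1 \<gamma> t = - (T3 t \<bullet> T1 t) - 3/2 * (\<kappa>2 t)\<^sup>2"
    by (simp add: Y_3 Y_1 inner_diff_left inner_add_left dot_cross dot_cross_self tangent_unit tangent_orth power2_eq_square)
  have s: "smooth (\<lambda>t. (3/2) * \<kappa>2 t)" "smooth \<delta>" "smooth (\<lambda>t. cross3 (T t) (T3 t))" "smooth (\<lambda>t. cross3 (T t) (T1 t))"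
    "smooth (\<lambda>t. ((3/2) * \<kappa>2 t) *\<^sub>R cross3 (T t) (T1 t))" "smooth (\<lambda>t. \<delta> t *\<^sub>R T t)"
    "smooth (\<lambda>t. - cross3 (T t) (T3 t) - ((3/2) * \<kappa>2 t) *\<^sub>R cross3 (T t) (T1 t))"
    by (intro smooth_mult smooth_diff smooth_minus smooth_scaleR smooth_const smooth_inner smooth_cross3 smooth_Ts)+
  have dY3: "dx (Y 3 \<gamma>) t = - (cross3 (T t) (T4 t) + cross3 (T1 t) (T3 t))
      - (((3/2) * \<kappa>2 t) *\<^sub>R (cross3 (T t) (T2 t) + cross3 (T1 t) (T1 t)) + dx (\<lambda>t. (3/2) * \<kappa>2 t) t *\<^sub>R cross3 (T t) (T1 t))
      + (\<delta> t *\<^sub>R T1 t + dx \<delta> t *\<^sub>R T t)"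
    unfolding Y_3 using s by (simp only: arc_add arc_diff arc_minus arc_scaleR arc_cross3 smooth_minus smooth_Ts)
  have "Y 4 \<gamma> t = cross3 (T t) (dx (Y 3 \<gamma>) t)
      - ((1/2) * (\<Sum>i=1..3. Y i \<gamma> t \<bullet> Y (3 - i + 1) \<gamma> t)) *\<^sub>R T t"
    using Y.simps(2)[of 3 \<gamma> t] by simp
  then have "Y 4 \<gamma> t \<bullet> Y 1 \<gamma> t = cross3 (T t) (dx (Y 3 \<gamma>) t) \<bullet> cross3 (T t) (T1 t)"
    by (simp add: Y_1 inner_diff_left dot_cross_self)
  also have "\<dots> = dx (Y 3 \<gamma>) t \<bullet> T1 t"
    by (simp add: dot_cross tangent_unit tangent_orth)
  also have "\<dots> = - (cross3 (T t) (T4 t) \<bullet> T1 t) - (3/2) * \<kappa>2 t * (cross3 (T t) (T2 t) \<bullet> T1 t) + \<delta> t * \<kappa>2 t"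
    by (simp add: dY3 inner_diff_left inner_add_left dot_cross_self tangent_orth)
  also have "\<dots> = T t \<bullet> cross3 (T1 t) (T4 t) + (3/2) * \<kappa>2 t * \<delta> t + \<delta> t * \<kappa>2 t"
  proof -
    have "cross3 (T t) w \<bullet> T1 t = - (T t \<bullet> cross3 (T1 t) w)" for w
      by (simp add: cross3_inner_cross3 cross_skew[of "T1 t" w])
    then show ?thesis by simp
  qed
  finally show "Y 4 \<gamma> t \<bullet> Y 1 \<gamma> t = T t \<bullet> cross3 (T1 t) (T4 t) + 5/2 * \<kappa>2 t * \<delta> t"
    by (simp add: algebra_simps)
qed

lemma tangent_dot_Y:
  "T t \<bullet> Y 2 \<gamma> t = - 1/2 * \<kappa>2 t" "T t \<bullet> Y 3 \<gamma> t = \<delta> t"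
  by (simp_all add: Y_2 Y_3 inner_diff_right inner_add_right tangent_unit tangent_orth dot_cross_self)

text \<open>The inverse of \<open>1 + w2 z\<^sup>2 + w3 z\<^sup>3 + ...\<close> is \<open>1 - w2 z\<^sup>2 - w3 z\<^sup>3 - ...\<close> up to order three, which
  is all that these coefficients see.\<close>

lemma hamiltonian_density_nth:
  "fps_nth (hamiltonian_density \<gamma> t) 2 = - \<delta> t"
  "fps_nth (hamiltonian_density \<gamma> t) 3 = - (T3 t \<bullet> T1 t) - 5/4 * (\<kappa>2 t)\<^sup>2"
  "fps_nth (hamiltonian_density \<gamma> t) 4 = T t \<bullet> cross3 (T1 t) (T4 t) + 7/4 * \<kappa>2 t * \<delta> t"
proof -
  let ?P = "energy_numerator \<gamma> t" and ?Q = "energy_denominator \<gamma> t" and ?R = "inverse (energy_denominator \<gamma> t)"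
  have Q: "fps_nth ?Q 0 = 1" "fps_nth ?Q 1 = 0" "fps_nth ?Q 2 = - 1/4 * \<kappa>2 t" "fps_nth ?Q 3 = 1/2 * \<delta> t"
    by (simp_all add: energy_denominator_def tangent_dot_Y)
  have P: "fps_nth ?P 0 = 0" "fps_nth ?P 1 = \<kappa>2 t" "fps_nth ?P 2 = - \<delta> t"
    "fps_nth ?P 3 = - (T3 t \<bullet> T1 t) - 3/2 * (\<kappa>2 t)\<^sup>2"
    "fps_nth ?P 4 = T t \<bullet> cross3 (T1 t) (T4 t) + 5/2 * \<kappa>2 t * \<delta> t"
    using Y_dot_Y_1[of t] by (simp_all add: energy_numerator_def)
  have sums: "(\<Sum>i=0..1. f i) = f 0 + f 1" "(\<Sum>i=0..2. f i) = f 0 + f 1 + f 2" "(\<Sum>i=0..3. f i) = f 0 + f 1 + f 2 + f 3"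
    "(\<Sum>i=0..4. f i) = f 0 + f 1 + f 2 + f 3 + f 4" for f :: "nat \<Rightarrow> real"
    by (simp_all add: eval_nat_numeral)
  have "?Q * ?R = 1" by (rule inverse_mult_eq_1') (simp add: Q)
  then have c: "fps_nth (?Q * ?R) n = (if n = 0 then 1 else 0)" for n by simp
  have R0: "fps_nth ?R 0 = 1" using c[of 0] by (simp add: Q)
  have R1: "fps_nth ?R 1 = 0" using c[of 1] by (simp only: fps_mult_nth sums) (simp add: Q R0 Q(2)[simplified])
  have R2: "fps_nth ?R 2 = 1/4 * \<kappa>2 t" using c[of 2] R1 by (simp only: fps_mult_nth sums) (simp add: Q R0 Q(2)[simplified])
  have R3: "fps_nth ?R 3 = - 1/2 * \<delta> t" using c[of 3] R1 by (simp only: fps_mult_nth sums) (simp add: Q R0 R2 Q(2)[simplified])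
  note all = Q(1) P R0 R1 R2 R3 P(2)[simplified] R1[simplified]
  show "fps_nth (hamiltonian_density \<gamma> t) 2 = - \<delta> t"
    unfolding hamiltonian_density_eq by (simp only: fps_mult_nth sums) (simp add: all)
  show "fps_nth (hamiltonian_density \<gamma> t) 3 = - (T3 t \<bullet> T1 t) - 5/4 * (\<kappa>2 t)\<^sup>2"
    unfolding hamiltonian_density_eq by (simp only: fps_mult_nth sums) (simp add: all power2_eq_square)
  show "fps_nth (hamiltonian_density \<gamma> t) 4 = T t \<bullet> cross3 (T1 t) (T4 t) + 7/4 * \<kappa>2 t * \<delta> t"
    unfolding hamiltonian_density_eq by (simp only: fps_mult_nth sums) (simp add: all algebra_simps)
qed

lemma arc_integral_add_derivative:
  assumes "smooth g" "smooth h" "h a = h b"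
  shows "arc_integral (closed_segment a b) \<gamma> (\<lambda>t. g t + dx h t) = arc_integral (closed_segment a b) \<gamma> g"
proof -
  have int: "(\<lambda>t. f t * speed \<gamma> t) integrable_on closed_segment a b" if "smooth f" for f :: "real \<Rightarrow> real"
    using smooth_continuous[OF smooth_mult[OF that smooth_speed]]
    by (auto simp: closed_segment_eq_real_ivl intro: integrable_continuous_interval)
  show ?thesis
    using integral_arc_eq_0[OF assms(2,3)] integral_add[OF int[OF assms(1)] int[OF smooth_arc[OF assms(2)]]]
    by (simp add: arc_integral_def distrib_right)
qed

lemma arc_diff_eq:
  "arc_diff 1 \<gamma> = T" "arc_diff 2 \<gamma> = T1" "arc_diff 3 \<gamma> = T2" "arc_diff 4 \<gamma> = T3"
  by (simp_all add: eval_nat_numeral tangent_def)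

end

lemma arc_integral_cmult: "c * arc_integral I \<gamma> f = arc_integral I \<gamma> (\<lambda>t. c * f t)"
  by (simp add: arc_integral_def mult.assoc)

lemma det3_eq: "det3 u w z = u \<bullet> cross3 w z"
  by (simp add: det3_def dot_cross_det)

context equivariant_curve
begin

lemma Ts_deck: "T1 (\<tau> t) = A *v T1 t" "T2 (\<tau> t) = A *v T2 t" "T3 (\<tau> t) = A *v T3 t"
proof -
  show 1: "T1 (\<tau> t) = A *v T1 t" for t by (rule arc_deck[OF smooth_Ts(1) tangent_deck])
  show 2: "T2 (\<tau> t) = A *v T2 t" for t by (rule arc_deck[OF smooth_Ts(2) 1])
  show "T3 (\<tau> t) = A *v T3 t" by (rule arc_deck[OF smooth_Ts(3) 2])
qed

lemma hamiltonian_4: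
  "hamiltonian A \<tau> t0 4 \<gamma> = - (1/2) * arc_integral (fundamental_domain \<tau> t0) \<gamma> (\<lambda>t.
        det3 (arc_diff 1 \<gamma> t) (arc_diff 2 \<gamma> t) (arc_diff 3 \<gamma> t))"
  using hamiltonian_nth(4)[of A \<tau> t0 1 \<gamma>] hamiltonian_density_nth(1)
  unfolding arc_integral_cmult arc_diff_eq det3_eq by (simp add: eval_nat_numeral)

text \<open>The density differs from the one in the generating function by the derivative of
  \<open>1/2 * (\<gamma>'' \<bullet> \<gamma>''')\<close>.\<close>

lemma hamiltonian_5:
  "hamiltonian A \<tau> t0 5 \<gamma> = arc_integral (fundamental_domain \<tau> t0) \<gamma> (\<lambda>t.
        1/2 * norm (arc_diff 3 \<gamma> t) ^ 2 - 5/8 * norm (arc_diff 2 \<gamma> t) ^ 4)"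
proof -
  let ?h = "\<lambda>t. 1/2 * (T1 t \<bullet> T2 t)"
  let ?g = "\<lambda>t. 1/2 * (- (T3 t \<bullet> T1 t) - 5/4 * (\<kappa>2 t)\<^sup>2)"
  have s: "smooth ?g" "smooth ?h" "smooth (\<lambda>t. T1 t \<bullet> T2 t)" "smooth (\<lambda>t. 1/2 :: real)"
    by (intro smooth_mult smooth_diff smooth_minus smooth_power smooth_const smooth_inner smooth_Ts)+
  have dh: "dx ?h t = 1/2 * (T1 t \<bullet> T3 t + T2 t \<bullet> T2 t)" for t
    by (simp only: arc_mult[OF s(4,3)] arc_inner smooth_Ts arc_const)
  have eq: "1/2 * norm (T2 t) ^ 2 - 5/8 * norm (T1 t) ^ 4 = ?g t + dx ?h t" for t
    unfolding dh using power_mult[of "norm (T1 t)" 2 2]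
    by (simp add: dot_square_norm inner_commute[of "T3 t"] algebra_simps)
  have "hamiltonian A \<tau> t0 5 \<gamma> = arc_integral (fundamental_domain \<tau> t0) \<gamma> ?g"
    using hamiltonian_nth(4)[of A \<tau> t0 2 \<gamma>] hamiltonian_density_nth(2)
    unfolding arc_integral_cmult by (simp add: eval_nat_numeral)
  also have "\<dots> = arc_integral (fundamental_domain \<tau> t0) \<gamma> (\<lambda>t. ?g t + dx ?h t)"
    unfolding fundamental_domain_def
    by (rule arc_integral_add_derivative[OF s(1,2), symmetric]) (simp add: Ts_deck rotation_inner[OF rot])
  finally show ?thesis by (simp only: arc_diff_eq eq)
qed

text \<open>The density differs from the one in the generating function by the derivative of
  \<open>- 1/2 * det (\<gamma>', \<gamma>'', \<gamma>'''')\<close>.\<close>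

lemma hamiltonian_6:
  "hamiltonian A \<tau> t0 6 \<gamma> = arc_integral (fundamental_domain \<tau> t0) \<gamma> (\<lambda>t.
        - (1/2) * det3 (arc_diff 1 \<gamma> t) (arc_diff 3 \<gamma> t) (arc_diff 4 \<gamma> t)
        + 7/8 * norm (arc_diff 2 \<gamma> t) ^ 2
          * det3 (arc_diff 1 \<gamma> t) (arc_diff 2 \<gamma> t) (arc_diff 3 \<gamma> t))"
proof -
  let ?h = "\<lambda>t. - (1/2) * (T t \<bullet> cross3 (T1 t) (T3 t))"
  let ?g = "\<lambda>t. 1/2 * (T t \<bullet> cross3 (T1 t) (T4 t) + 7/4 * \<kappa>2 t * \<delta> t)"
  have s: "smooth ?g" "smooth ?h" "smooth (\<lambda>t. T t \<bullet> cross3 (T1 t) (T3 t))" "smooth (\<lambda>t. - (1/2) :: real)"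
     "smooth (\<lambda>t. cross3 (T1 t) (T3 t))"
    by (intro smooth_mult smooth_add smooth_power smooth_const smooth_inner smooth_cross3 smooth_Ts)+
  have dh: "dx ?h t = - (1/2) * (T t \<bullet> (cross3 (T1 t) (T4 t) + cross3 (T2 t) (T3 t)))" for t
    by (simp only: arc_mult[OF s(4,3)] arc_inner[OF smooth_Ts(1) s(5)] arc_cross3 smooth_Ts arc_const)
      (simp add: dot_cross_self)
  have eq: "- (1/2) * (T t \<bullet> cross3 (T2 t) (T3 t)) + 7/8 * norm (T1 t) ^ 2 * \<delta> t = ?g t + dx ?h t" for t
    unfolding dh by (simp add: dot_square_norm inner_add_right algebra_simps)
  have "hamiltonian A \<tau> t0 6 \<gamma> = arc_integral (fundamental_domain \<tau> t0) \<gamma> ?g"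
    using hamiltonian_nth(4)[of A \<tau> t0 3 \<gamma>] hamiltonian_density_nth(3)
    unfolding arc_integral_cmult by (simp add: eval_nat_numeral)
  also have "\<dots> = arc_integral (fundamental_domain \<tau> t0) \<gamma> (\<lambda>t. ?g t + dx ?h t)"
    unfolding fundamental_domain_def
    by (rule arc_integral_add_derivative[OF s(1,2), symmetric])
      (simp add: Ts_deck tangent_deck rotation_inner[OF rot] cross_rotation_matrix[OF rot])
  finally show ?thesis by (simp only: arc_diff_eq eq det3_eq)
qed

end

section \<open>The Hamiltonians of the commuting flows\<close>

theorem theorem13:
  fixes A :: "real^3^3" and a :: "real^3" and \<tau> :: "real \<Rightarrow> real" and t0 :: real
  assumes rot: "rotation_matrix A"
    and deck: "deck_transformation \<tau>"
  defines "M \<equiv> curve_space A a \<tau>"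
    and "V \<equiv> tangent_space A \<tau>"
    and "I \<equiv> fundamental_domain \<tau> t0"
    and "E \<equiv> hamiltonian A \<tau> t0"
  shows "\<forall>\<gamma>\<in>M.
     (\<forall>k. has_differential_mod (if k = 2 then 2 * pi else 0) M V (E k) \<gamma>
            (\<lambda>\<xi>. MW_form I \<gamma> (Y k \<gamma>) \<xi>)) \<and>
     E 0 \<gamma> = 0 \<and>
     E 1 \<gamma> = curve_length I \<gamma> \<and>
     (\<exists>\<nu>. unit_normal_field A \<tau> \<gamma> \<nu>) \<and>
     (\<forall>\<nu>. unit_normal_field A \<tau> \<gamma> \<nu> \<longrightarrow>
        (\<exists>n::int. E 2 \<gamma> = torsion_integral I \<gamma> \<nu> + 2 * pi * of_int n)) \<and>
     E 4 \<gamma> = - (1/2) * arc_integral I \<gamma> (\<lambda>t.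
        det3 (arc_diff 1 \<gamma> t) (arc_diff 2 \<gamma> t) (arc_diff 3 \<gamma> t)) \<and>
     E 5 \<gamma> = arc_integral I \<gamma> (\<lambda>t.
        1/2 * norm (arc_diff 3 \<gamma> t) ^ 2 - 5/8 * norm (arc_diff 2 \<gamma> t) ^ 4) \<and>
     E 6 \<gamma> = arc_integral I \<gamma> (\<lambda>t.
        - (1/2) * det3 (arc_diff 1 \<gamma> t) (arc_diff 3 \<gamma> t) (arc_diff 4 \<gamma> t)
        + 7/8 * norm (arc_diff 2 \<gamma> t) ^ 2
          * det3 (arc_diff 1 \<gamma> t) (arc_diff 2 \<gamma> t) (arc_diff 3 \<gamma> t))"
proof
  fix \<gamma> assume "\<gamma> \<in> M"
  then interpret c: equivariant_curve A a \<tau> \<gamma>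
    by unfold_locales (auto simp: M_def rot deck)
  have "has_differential_mod (if k = 2 then 2 * pi else 0) M V (E k) \<gamma> (\<lambda>\<xi>. MW_form I \<gamma> (Y k \<gamma>) \<xi>)" for k
    unfolding has_differential_mod_def M_def E_def I_def
    using hamiltonian_derivative[OF rot deck] by blast
  moreover have "E 0 \<gamma> = 0" "E 1 \<gamma> = curve_length I \<gamma>" and E2: "E 2 \<gamma> = total_torsion A \<tau> t0 \<gamma>"
    by (simp_all add: E_def I_def hamiltonian_nth numeral_2_eq_2)
  moreover have "\<exists>n::int. E 2 \<gamma> = torsion_integral I \<gamma> \<nu> + 2 * pi * of_int n"
    if "unit_normal_field A \<tau> \<gamma> \<nu>" for \<nu>
    unfolding E2 I_def by (rule c.total_torsion_mod[OF that])
  ultimately show "(\<forall>k. has_differential_mod (if k = 2 then 2 * pi else 0) M V (E k) \<gamma>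
            (\<lambda>\<xi>. MW_form I \<gamma> (Y k \<gamma>) \<xi>)) \<and>
     E 0 \<gamma> = 0 \<and>
     E 1 \<gamma> = curve_length I \<gamma> \<and>
     (\<exists>\<nu>. unit_normal_field A \<tau> \<gamma> \<nu>) \<and>
     (\<forall>\<nu>. unit_normal_field A \<tau> \<gamma> \<nu> \<longrightarrow>
        (\<exists>n::int. E 2 \<gamma> = torsion_integral I \<gamma> \<nu> + 2 * pi * of_int n)) \<and>
     E 4 \<gamma> = - (1/2) * arc_integral I \<gamma> (\<lambda>t.
        det3 (arc_diff 1 \<gamma> t) (arc_diff 2 \<gamma> t) (arc_diff 3 \<gamma> t)) \<and>
     E 5 \<gamma> = arc_integral I \<gamma> (\<lambda>t.
        1/2 * norm (arc_diff 3 \<gamma> t) ^ 2 - 5/8 * norm (arc_diff 2 \<gamma> t) ^ 4) \<and>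
     E 6 \<gamma> = arc_integral I \<gamma> (\<lambda>t.
        - (1/2) * det3 (arc_diff 1 \<gamma> t) (arc_diff 3 \<gamma> t) (arc_diff 4 \<gamma> t)
        + 7/8 * norm (arc_diff 2 \<gamma> t) ^ 2
          * det3 (arc_diff 1 \<gamma> t) (arc_diff 2 \<gamma> t) (arc_diff 3 \<gamma> t))"
    using c.hamiltonian_4[of t0] c.hamiltonian_5[of t0] c.hamiltonian_6[of t0] c.unit_normal_field_exists
    unfolding E_def I_def by blast
qed

end
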